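(* Consider the factor model $Y_{jt}^N=\lambda_j'F_t+u_{jt}$, $1\le j\le N$, $1\le t\le T$, with $k$-dimensional unobserved factors $F_t$ and loadings $\lambda_j$ ($k$ fixed), where $u_{jt}$ is uncorrelated with $(F_t,\lambda_j)$. Suppose there is a constant $D_0>0$ such that: (1) $\max_tE\|F_t\|_2^4\le D_0$, $\max_j\|\lambda_j\|_2^4\le D_0$, $\max_{j,t}E|u_{jt}|^8\le D_0$ and $E(u_{jt})=0$; (2) $\max_sN^{-1}\sum_{t=1}^T|\sum_{i=1}^NE(u_{is}u_{it})|\le D_0$ and $\max_i\sum_{j=1}^N\max_{1\le t\le T}|E(u_{it}u_{jt})|\le D_0$; (3) $(NT)^{-1}\sum_{s=1}^T\sum_{t=1}^T\sum_{i=1}^N\sum_{j=1}^N|E(u_{it}u_{js})|\le D_0$ and $\max_{s,t}E|N^{-1/2}\sum_{i=1}^N[u_{is}u_{it}-E(u_{is}u_{it})]|^4\le D_0$; (4) $N^{-1}\sum_{i=1}^NE\|T^{-1/2}\sum_{t=1}^TF_tu_{it}\|_2^2\le D_0$; (5) $\max_tE\|(NT)^{-1/2}\sum_{s=1}^T\sum_{i=1}^NF_s[u_{is}u_{it}-E(u_{is}u_{it})]\|_2^2\le D_0$; (6) $E\|(NT)^{-1/2}\sum_{t=1}^T\sum_{i=1}^NF_t\lambda_i'u_{it}\|_2^2\le D_0$; and moreover: (7) for each $t$, $N^{-1/2}\sum_{i=1}^N\lambda_iu_{it}\to^dN(0,\Gamma_t)$ as $N\to\infty$, where $\Gamma_t=\lim_{N\to\infty}N^{-1}\sum_{i=1}^N\sum_{j=1}^N\lambda_i\lambda_j'E(u_{it}u_{jt})$;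 (8) for each $i$, $T^{-1/2}\sum_{t=1}^TF_tu_{it}\to^dN(0,\Phi_i)$ as $T\to\infty$, where $\Phi_i=\lim_{T\to\infty}T^{-1}\sum_{s=1}^T\sum_{t=1}^TE(F_tF_s'u_{is}u_{it})$; (9) $N^{-1}\sum_{i=1}^N\lambda_i\lambda_i'\to\Sigma_\Lambda$ and $T^{-1}\sum_{t=1}^TF_tF_t'=\Sigma_F+o_P(1)$ for some $k\times k$ positive definite matrices $\Sigma_\Lambda,\Sigma_F$ such that $\Sigma_\Lambda\Sigma_F$ has distinct eigenvalues. Let $P_t^N=\lambda_1'F_t$ and let $\hat P_t^N=\hat\lambda_1'\hat F_t$ be the principal component estimator. Then, for any $1\le t\le T$, as $N\to\infty$ and $T\to\infty$, $$\hat P_t^N-P_t^N=O_P(1/\sqrt N+1/\sqrt T)\quad\text{and}\quad\frac1T\sum_{t=1}^T(\hat P_t^N-P_t^N)^2=O_P(1/N+1/T).$$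
   Context: Principal component estimator: let $Y^N\in\mathbb R^{T\times N}$ be the matrix with $(t,j)$ entry $Y_{jt}^N$ (fully observed, since the null hypothesis is imposed). $\hat F=(\hat F_1,\dots,\hat F_T)'\in\mathbb R^{T\times k}$ consists of the eigenvectors corresponding to the largest $k$ eigenvalues of $Y^N(Y^N)'$, normalized so that $\hat F'\hat F/T=I_k$; $\hat\Lambda=(Y^N)'\hat F/T\in\mathbb R^{N\times k}$ and $\hat\lambda_j'$ is its $j$-th row. *)

theory Defs
  imports "HOL-Probability.Probability" "Jordan_Normal_Form.Char_Poly"
begin

section \<open>Stochastic order symbols and convergence\<close>

text \<open>\<open>X = O\<^sub>P(r)\<close> along the filter \<open>\<F>\<close> of the (possibly multi-dimensional) sample size.\<close>

definition bigO_prob ::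
  "'a measure \<Rightarrow> 'n filter \<Rightarrow> ('n \<Rightarrow> 'a \<Rightarrow> real) \<Rightarrow> ('n \<Rightarrow> real) \<Rightarrow> bool" where
  "bigO_prob M \<F> X r \<longleftrightarrow>
     (\<forall>\<epsilon>>0. \<exists>C>0. eventually
        (\<lambda>n. measure M {\<omega> \<in> space M. \<bar>X n \<omega>\<bar> > C * \<bar>r n\<bar>} \<le> \<epsilon>) \<F>)"

definition conv_in_prob ::
  "'a measure \<Rightarrow> (nat \<Rightarrow> 'a \<Rightarrow> 'b::metric_space) \<Rightarrow> 'b \<Rightarrow> bool" where
  "conv_in_prob M X c \<longleftrightarrow>
     (\<forall>\<epsilon>>0. (\<lambda>n. measure M {\<omega> \<in> space M. dist (X n \<omega>) c > \<epsilon>}) \<longlonglongrightarrow> 0)"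

text \<open>The library constant \<^const>\<open>weak_conv_m\<close> only covers laws on the real line.\<close>

definition conv_in_distr ::
  "'a measure \<Rightarrow> (nat \<Rightarrow> 'a \<Rightarrow> 'b::topological_space) \<Rightarrow> 'b measure \<Rightarrow> bool" where
  "conv_in_distr M X \<mu> \<longleftrightarrow>
     (\<forall>f :: 'b \<Rightarrow> real. continuous_on UNIV f \<and> bounded (range f) \<longrightarrow>
        (\<lambda>n. \<integral>\<omega>. f (X n \<omega>) \<partial>M) \<longlonglongrightarrow> (\<integral>x. f x \<partial>\<mu>))"

text \<open>\<open>N(m, \<Sigma>)\<close> is the law of \<open>m + A Z\<close> with \<open>Z\<close> standard normal and \<open>A A' = \<Sigma>\<close>; it does not
  depend on the choice of \<open>A\<close>, and \<open>\<Sigma>\<close> may be singular.\<close>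

definition is_mv_normal :: "(real^'n) measure \<Rightarrow> real^'n \<Rightarrow> real^'n^'n \<Rightarrow> bool" where
  "is_mv_normal \<mu> m \<Sigma> \<longleftrightarrow>
     (\<exists>A :: real^'n^'n. A ** transpose A = \<Sigma> \<and>
        \<mu> = distr (PiM UNIV (\<lambda>_::'n. std_normal_distribution)) borel
              (\<lambda>z. m + A *v (\<chi> i. z i)))"

text \<open>The covariance vector of a scalar and a random vector vanishes.\<close>

definition uncorrelated :: "'a measure \<Rightarrow> ('a \<Rightarrow> real) \<Rightarrow> ('a \<Rightarrow> real^'n) \<Rightarrow> bool" where
  "uncorrelated M X Y \<longleftrightarrow>
     (\<integral>\<omega>. (X \<omega> - (\<integral>\<eta>. X \<eta> \<partial>M)) *\<^sub>R (Y \<omega> - (\<integral>\<eta>. Y \<eta> \<partial>M)) \<partial>M) = 0"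

section \<open>Matrices of fixed dimension\<close>

definition outer :: "real^'n \<Rightarrow> real^'m \<Rightarrow> real^'m^'n" where
  "outer x y = (\<chi> a b. vec_nth x a * vec_nth y b)"

definition pos_def :: "real^'n^'n \<Rightarrow> bool" where
  "pos_def A \<longleftrightarrow> transpose A = A \<and> (\<forall>x. x \<noteq> 0 \<longrightarrow> inner x (A *v x) > 0)"

text \<open>Eigenvalues are taken in \<open>\<complex>\<close>: the characteristic polynomial has \<open>CARD('n)\<close> different roots.\<close>

definition distinct_eigenvalues :: "real^'n^'n \<Rightarrow> bool" where
  "distinct_eigenvalues A \<longleftrightarrow>
     card {z :: complex. \<exists>v. v \<noteq> 0 \<and>
        (\<chi> a b. complex_of_real (vec_nth (vec_nth A a) b)) *v v = z *s v} = CARD('n)"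

section \<open>Principal component estimator\<close>

text \<open>Sample matrices have varying dimension and are 0-indexed: row \<open>t\<close>, column \<open>j\<close> holds the
  observation of unit \<open>j + 1\<close> at time \<open>t + 1\<close>.\<close>

definition data_mat :: "(nat \<Rightarrow> nat \<Rightarrow> real) \<Rightarrow> nat \<Rightarrow> nat \<Rightarrow> real mat" where
  "data_mat Y N T = Matrix.mat T N (\<lambda>(t, j). Y (Suc j) (Suc t))"

text \<open>The sequence \<open>d\<close> lists the eigenvalues of \<open>Y Y'\<close> with multiplicity, the \<open>k\<close> largest ones
  first; the columns of \<open>Fh\<close> are eigenvectors for these \<open>k\<close> eigenvalues, in any order. Signs, and
  the choice of basis in case of ties, are left open.\<close>

definition pc_factors :: "real mat \<Rightarrow> nat \<Rightarrow> real mat \<Rightarrow> bool" where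
  "pc_factors Y k Fh \<longleftrightarrow>
     (let T = dim_row Y; S = Y * Y\<^sup>T in
      Fh \<in> carrier_mat T k \<and>
      (1 / real T) \<cdot>\<^sub>m (Fh\<^sup>T * Fh) = 1\<^sub>m k \<and>
      (\<exists>d :: nat \<Rightarrow> real.
         char_poly S = (\<Prod>i<T. [:- d i, 1:]) \<and>
         (\<forall>i<k. \<forall>j\<in>{k..<T}. d j \<le> d i) \<and>
         (\<forall>l<k. eigenvector S (col Fh l) (d l))))"

definition pc_loadings :: "real mat \<Rightarrow> real mat \<Rightarrow> real mat" where
  "pc_loadings Y Fh = (1 / real (dim_row Y)) \<cdot>\<^sub>m (Y\<^sup>T * Fh)"

text \<open>The fitted value \<open>\<lambda>\<^sub>1' F\<^sub>t\<close> of unit 1 at time \<open>t \<ge> 1\<close>.\<close>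

definition pc_fit :: "real mat \<Rightarrow> real mat \<Rightarrow> nat \<Rightarrow> real" where
  "pc_fit Y Fh t = scalar_prod (Matrix.row (pc_loadings Y Fh) 0) (Matrix.row Fh (t - 1))"

end

theory Submission
  imports Defs "Jordan_Normal_Form.Schur_Decomposition"
begin

text \<open>Write \<open>Y = F \<Lambda>' + U\<close>, let \<open>V\<close> be the diagonal matrix of the \<open>k\<close> largest eigenvalues of
  \<open>Y Y' / (N T)\<close>, and let \<open>H = (\<Lambda>' \<Lambda> / N) (F' Fh / T) V\<inverse>\<close>. The eigenvector equation gives
  \<open>Fh - F H = (F \<Lambda>' U' + U \<Lambda> F' + U U') Fh V\<inverse> / (N T)\<close>. Second moments bound the three terms,
  pointwise in \<open>t\<close> and on average, by \<open>\<delta> = (1/N + 1/T)\<^sup>1\<^sup>/\<^sup>2\<close>, using \<open>|U U'|\<^sub>F\<close> for the last one.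
  That \<open>V\<close> is bounded away from 0 follows from the Courant--Fischer principle, since \<open>|U U'|\<^sub>F = o(N T)\<close> and
  \<open>\<Lambda>' \<Lambda> / N\<close> and \<open>F' F / T\<close> have positive definite limits. The normalization of \<open>Fh\<close> makes
  \<open>(F' Fh / T)' H\<close> close to the identity, so \<open>\<lambda>\<^sub>1 = H h\<close> with \<open>h\<close> bounded, and with \<open>E = Fh - F H\<close> and the
  errors \<open>u\<^sub>1\<close> of unit 1 the fitted values satisfy
  \<open>Fh Fh' (F \<lambda>\<^sub>1 + u\<^sub>1) / T - F \<lambda>\<^sub>1 = Fh (Fh' u\<^sub>1 / T - Fh' E h / T) + E h\<close>,
  where every term is of order \<open>\<delta>\<close>.\<close>

section \<open>Eigenvalues of real symmetric matrices\<close>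

unbundle no inner_syntax

text \<open>Factors and loadings are identified only up to an invertible matrix, and signs and bases
  of the eigenvectors are left open, so \<open>Fh\<close> need not converge to anything. The common
  component is invariant under such a change. Hence \<open>H\<close> may depend on the sample in an
  uncontrolled way, as long as the coefficients of \<open>\<lambda>\<^sub>1\<close> in its columns
  stay bounded. Both rates come from one deterministic estimate. It holds for every admissible
  \<open>Fh\<close> at every sample point where finitely many normalized sums are at most a constant
  and the Gram matrices of factors and loadings are near their limits, once N and T are large.
  Probability enters only in showing that these points have mass at least
  \<open>1 - \<epsilon>\<close>. The obstacle is \<open>Fh' u / T\<close> for the errors u of unit
  1: \<open>Fh\<close> depends on u, and Cauchy-Schwarz with the normalization of \<open>Fh\<close>
  gives no decay. Replacing \<open>Fh\<close> by \<open>F H + E\<close> leaves the factor-error sum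
  of unit 1, which has a second moment of order T, and a term controlled by E.\<close>

lemma orthogonal_matrix_with_first_column:
  fixes v :: "real vec"
  assumes v: "v \<in> carrier_vec n" "v \<noteq> 0\<^sub>v n"
  obtains W c where "W \<in> carrier_mat n n" "W\<^sup>T * W = 1\<^sub>m n" "col W 0 = c \<cdot>\<^sub>v v"
proof -
  interpret cof_vec_space n "TYPE(real)" .
  define b where "b = basis_completion v"
  define ws where "ws = gram_schmidt n b"
  from basis_completion[OF v, folded b_def]
  have b: "distinct b" "\<not> lin_dep (set b)" "set b \<subseteq> carrier_vec n" "hd b = v" "length b = n"
    by auto
  have n: "n > 0" using v by (cases n) auto
  with b obtain vs where bv: "b = v # vs" by (cases b) auto
  from gram_schmidt_result[OF b(3,1,2) refl, folded ws_def]
  have ws: "set ws \<subseteq> carrier_vec n" "corthogonal ws" "length ws = n" using b(5) by auto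
  \<comment> \<open>Gram-Schmidt keeps the first vector, so normalizing the columns only rescales
    \<open>v\<close>.\<close>
  have "hd ws = v" unfolding ws_def bv by (rule gram_schmidt_hd[OF v(1)])
  with ws(3) n have ws0: "ws ! 0 = v" by (cases ws) auto
  have wsc: "ws ! i \<in> carrier_vec n" if "i < n" for i using ws that by auto
  have conj: "conjugate w = w" for w :: "real vec" by (intro eq_vecI) auto
  have orth: "(ws ! i \<bullet> ws ! j = 0) = (i \<noteq> j)" if "i < n" "j < n" for i j
    using corthogonalD[OF ws(2), of i j] that ws(3) by (simp add: conj)
  have pos: "ws ! i \<bullet> ws ! i > 0" if "i < n" for i
  proof -
    have "ws ! i \<bullet> ws ! i \<ge> 0" by (simp add: scalar_prod_def sum_nonneg)
    with orth[OF that that] show ?thesis by simp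
  qed
  define W where "W = Matrix.mat n n (\<lambda>(i, j). vec_index (ws ! j) i / sqrt (ws ! j \<bullet> ws ! j))"
  have W: "W \<in> carrier_mat n n" by (simp add: W_def)
  have "W\<^sup>T * W = 1\<^sub>m n"
  proof (rule eq_matI)
    fix i j assume ij: "i < dim_row (1\<^sub>m n)" "j < dim_col (1\<^sub>m n)"
    have "(W\<^sup>T * W) $$ (i, j) = (\<Sum>r<n. (vec_index (ws ! i) r * vec_index (ws ! j) r)
        / (sqrt (ws ! i \<bullet> ws ! i) * sqrt (ws ! j \<bullet> ws ! j)))"
      using ij W by (simp add: scalar_prod_def W_def lessThan_atLeast0)
    also have "\<dots> = (ws ! i \<bullet> ws ! j) / (sqrt (ws ! i \<bullet> ws ! i) * sqrt (ws ! j \<bullet> ws ! j))"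
      using ij wsc[of j] by (simp add: scalar_prod_def sum_divide_distrib lessThan_atLeast0)
    also have "\<dots> = 1\<^sub>m n $$ (i, j)"
      using ij orth[of i j] pos[of i] by auto
    finally show "(W\<^sup>T * W) $$ (i, j) = 1\<^sub>m n $$ (i, j)" .
  qed (use W in auto)
  moreover have "col W 0 = (1 / sqrt (v \<bullet> v)) \<cdot>\<^sub>v v"
    using v n by (intro eq_vecI) (auto simp: W_def ws0)
  ultimately show ?thesis using W that by blast
qed

text \<open>Deflation by induction on the list of roots: an orthogonal change of basis starting with
  an eigenvector splits off one root. The list \<open>es\<close> is kept in its given order, so that
  the eigenvalue sequence in \<open>pc_factors\<close>, which is known only through the
  characteristic polynomial, is matched index by index with an orthonormal eigenbasis.\<close>

lemma real_symmetric_orthogonally_diagonalizable: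
  fixes A :: "real mat"
  assumes "A \<in> carrier_mat n n" "A\<^sup>T = A" "char_poly A = (\<Prod>e\<leftarrow>es. [:- e, 1:])"
  shows "\<exists>P\<in>carrier_mat n n. P\<^sup>T * P = 1\<^sub>m n \<and> A * P = P * mat_diag n (\<lambda>i. es ! i)"
  using assms
proof (induction es arbitrary: n A)
  case Nil
  then have "n = 0" using degree_monic_char_poly[of A n] by auto
  then show ?case using Nil.prems(1) by (intro bexI[of _ "1\<^sub>m 0"]) (auto simp: mat_diag_def)
next
  case (Cons e es)
  note A = Cons.prems(1)
  obtain m where n: "n = Suc m"
  proof (cases n)
    case 0
    then have "degree (char_poly A) = 0" using degree_monic_char_poly[OF A] by simp
    moreover have "degree ([:- e, 1:] * (\<Prod>e\<leftarrow>es. [:- e, 1:])) = Suc (degree (\<Prod>e\<leftarrow>es. [:- e, 1:]))"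
      using monic_prod_list[of "map (\<lambda>e. [:- e, 1:]) es"]
      by (subst degree_mult_eq) auto
    ultimately show ?thesis using Cons.prems(3) by simp
  qed
  have "eigenvalue A e" unfolding eigenvalue_root_char_poly[OF A] Cons.prems(3) by simp
  then obtain v where "eigenvector A v e" unfolding eigenvalue_def by blast
  then have v: "v \<in> carrier_vec n" "v \<noteq> 0\<^sub>v n" "A *\<^sub>v v = e \<cdot>\<^sub>v v"
    using A unfolding eigenvector_def by auto
  obtain W c where W: "W \<in> carrier_mat n n" "W\<^sup>T * W = 1\<^sub>m n" "col W 0 = c \<cdot>\<^sub>v v"
    using orthogonal_matrix_with_first_column[OF v(1,2)] by blast
  have WT: "W\<^sup>T \<in> carrier_mat n n" using W by simp
  have WW: "W * W\<^sup>T = 1\<^sub>m n" using mat_mult_left_right_inverse[OF WT W(1) W(2)] .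
  define B where "B = W\<^sup>T * A * W"
  have B: "B \<in> carrier_mat n n" using W A by (simp add: B_def)
  have BT: "B\<^sup>T = B"
  proof -
    have "B\<^sup>T = W\<^sup>T * (A\<^sup>T * W\<^sup>T\<^sup>T)"
      unfolding B_def
      by (subst transpose_mult[of _ n n _ n], use A W WT in simp, use W in simp,
          subst transpose_mult[of _ n n _ n], use A W WT in auto)
    then show ?thesis
      using A W WT Cons.prems(2) by (simp add: B_def)
  qed
  have AW: "A * W = W * B"
  proof -
    have "W * B = W * (W\<^sup>T * (A * W))" using A W WT by (simp add: B_def)
    also have "\<dots> = (W * W\<^sup>T) * (A * W)"
      by (rule assoc_mult_mat[symmetric, of _ n n _ n _ n]) (use A W WT in auto)
    finally show ?thesis using A W WW by simp
  qed
  have AWW: "A = W * B * W\<^sup>T"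
  proof -
    have "W * B * W\<^sup>T = A * (W * W\<^sup>T)"
      unfolding AW[symmetric] by (rule assoc_mult_mat[of _ n n _ n _ n]) (use A W WT in auto)
    then show ?thesis using A WW by simp
  qed
  have "similar_mat_wit A B W W\<^sup>T"
    by (rule similar_mat_witI[of _ _ n]) (use A W WT WW B AWW in auto)
  then have "similar_mat A B" unfolding similar_mat_def by blast
  then have cpB: "char_poly B = [:- e, 1:] * (\<Prod>e\<leftarrow>es. [:- e, 1:])"
    using char_poly_similar Cons.prems(3) by fastforce
  have B0: "B $$ (i, 0) = (if i = 0 then e else 0)" if i: "i < n" for i
  proof -
    have "B = W\<^sup>T * (A * W)" using A W WT by (simp add: B_def)
    then have "B $$ (i, 0) = row W\<^sup>T i \<bullet> (A *\<^sub>v col W 0)"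
      using A W WT i n col_mult2[OF A W(1), of 0] by simp
    also have "A *\<^sub>v col W 0 = e \<cdot>\<^sub>v col W 0"
      using A v W(3) by (simp add: mult_mat_vec smult_smult_assoc mult.commute)
    also have "row W\<^sup>T i \<bullet> (e \<cdot>\<^sub>v col W 0) = e * (row W\<^sup>T i \<bullet> col W 0)"
      using W(1) i by (intro scalar_prod_smult_distrib[of _ n]) auto
    also have "row W\<^sup>T i \<bullet> col W 0 = (W\<^sup>T * W) $$ (i, 0)"
      using W(1) i n by simp
    also have "e * \<dots> = (if i = 0 then e else 0)" using W(2) i n by simp
    finally show ?thesis .
  qed
  have B0': "B $$ (0, i) = (if i = 0 then e else 0)" if "i < n" for i
  proof -
    have "B $$ (0, i) = B\<^sup>T $$ (i, 0)" using B that n by simp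
    then show ?thesis using B0[OF that] BT by simp
  qed
  \<comment> \<open>The first column of \<open>B\<close> is \<open>e\<close> times the first unit
    vector, and by symmetry so is the first row. Hence \<open>B\<close> is block diagonal, its
    characteristic polynomial factors, and cancelling the linear factor leaves exactly the roots
    \<open>es\<close> for \<open>B1\<close>.\<close>
  define B1 where "B1 = Matrix.mat m m (\<lambda>(i, j). B $$ (Suc i, Suc j))"
  let ?E = "Matrix.mat 1 1 (\<lambda>_. e)"
  have B1: "B1 \<in> carrier_mat m m" by (simp add: B1_def)
  have Bb: "B = four_block_mat ?E (0\<^sub>m 1 m) (0\<^sub>m m 1) B1"
    using B n B0 B0' by (intro eq_matI) (auto simp: B1_def)
  have B1T: "B1\<^sup>T = B1"
  proof (rule eq_matI)
    fix i j assume "i < dim_row B1" "j < dim_col B1"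
    then have ij: "i < m" "j < m" using B1 by auto
    have "B $$ (Suc j, Suc i) = B\<^sup>T $$ (Suc i, Suc j)" using B ij n by simp
    then show "B1\<^sup>T $$ (i, j) = B1 $$ (i, j)" using ij BT by (simp add: B1_def)
  qed (use B1 in auto)
  have "char_poly B = char_poly ?E * char_poly B1"
    unfolding Bb by (rule char_poly_four_block_zeros_col) (use B1 in auto)
  also have "char_poly ?E = [:- e, 1:]" by (simp add: char_poly_defs det_def sign_def)
  finally have "char_poly B1 = (\<Prod>e\<leftarrow>es. [:- e, 1:])" using cpB
    by (metis mult_cancel_left pCons_eq_0_iff zero_neq_one)
  from Cons.IH[OF B1 B1T this] obtain P where
    P: "P \<in> carrier_mat m m" "P\<^sup>T * P = 1\<^sub>m m" "B1 * P = P * mat_diag m (\<lambda>i. es ! i)" by blast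
  define R where "R = four_block_mat (1\<^sub>m 1) (0\<^sub>m 1 m) (0\<^sub>m m 1) P"
  have R: "R \<in> carrier_mat n n" using P(1) n four_block_carrier_mat[of "1\<^sub>m 1" 1 1 P m m] by (simp add: R_def)
  have RT: "R\<^sup>T = four_block_mat (1\<^sub>m 1) (0\<^sub>m 1 m) (0\<^sub>m m 1) P\<^sup>T"
    unfolding R_def by (subst transpose_four_block_mat) (use P in auto)
  have RR: "R\<^sup>T * R = 1\<^sub>m n"
    unfolding RT unfolding R_def
    by (subst mult_four_block_mat[of _ 1 1 _ m _ m _ _ 1 _ m])
      (use P n in \<open>auto simp: four_block_one_mat\<close>)
  have D: "mat_diag n (\<lambda>i. (e # es) ! i) = four_block_mat ?E (0\<^sub>m 1 m) (0\<^sub>m m 1) (mat_diag m (\<lambda>i. es ! i))"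
    using n by (intro eq_matI) (auto simp: mat_diag_def nth_Cons')
  have BR: "B * R = R * mat_diag n (\<lambda>i. (e # es) ! i)"
    unfolding Bb R_def D
    using P B1 left_mult_zero_mat[OF mat_diag_dim, of 1 m "\<lambda>i. es ! i"]
    by (simp add: mult_four_block_mat[of _ 1 1 _ m _ m _ _ 1 _ m])
  define Q where "Q = W * R"
  have Q: "Q \<in> carrier_mat n n" using W R by (simp add: Q_def)
  have "Q\<^sup>T * Q = R\<^sup>T * W\<^sup>T * (W * R)"
    using W R by (simp add: Q_def transpose_mult[of _ n n _ n])
  also have "\<dots> = R\<^sup>T * (W\<^sup>T * (W * R))"
    by (rule assoc_mult_mat[of _ n n _ n _ n]) (use W R in auto)
  also have "W\<^sup>T * (W * R) = (W\<^sup>T * W) * R"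
    by (rule assoc_mult_mat[symmetric, of _ n n _ n _ n]) (use W R in auto)
  finally have "Q\<^sup>T * Q = 1\<^sub>m n" using W R RR by simp
  moreover have "A * Q = Q * mat_diag n (\<lambda>i. (e # es) ! i)"
  proof -
    have "A * Q = A * W * R"
      unfolding Q_def by (rule assoc_mult_mat[symmetric, of _ n n _ n _ n]) (use A W R in auto)
    also have "\<dots> = W * (B * R)"
      unfolding AW by (rule assoc_mult_mat[of _ n n _ n _ n]) (use B W R in auto)
    also have "\<dots> = Q * mat_diag n (\<lambda>i. (e # es) ! i)"
      unfolding BR Q_def by (rule assoc_mult_mat[symmetric, of _ n n _ n _ n]) (use W R in auto)
    finally show ?thesis .
  qed
  ultimately show ?case using Q by blast
qed

text \<open>Courant--Fischer: if fewer than \<open>k\<close> eigenvalues were at least \<open>c\<close>, some nonzero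
  combination of the \<open>k\<close> coordinates of \<open>f\<close> would be orthogonal to all their eigenvectors, and its
  quadratic form would be less than \<open>c\<close> times its squared length.\<close>

lemma pc_factors_eigenvalue_ge:
  fixes f :: "nat \<Rightarrow> real^'k" and Y Fh :: "real mat"
  assumes Y: "Y \<in> carrier_mat T N" and pc: "pc_factors Y CARD('k) Fh" and KT: "CARD('k) \<le> T"
    and low: "\<And>z. z \<noteq> 0 \<Longrightarrow>
      c * (\<Sum>t<T. (inner (f t) z)\<^sup>2) \<le> (\<Sum>j<N. (\<Sum>t<T. Y $$ (t, j) * inner (f t) z)\<^sup>2)"
    and pos: "\<And>z. z \<noteq> 0 \<Longrightarrow> (\<Sum>t<T. (inner (f t) z)\<^sup>2) > 0"
  obtains d where "\<And>l. l < CARD('k) \<Longrightarrow> c \<le> d l"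
    and "\<And>l t. l < CARD('k) \<Longrightarrow> t < T \<Longrightarrow>
      d l * Fh $$ (t, l) = (\<Sum>s<T. \<Sum>j<N. Y $$ (t, j) * Y $$ (s, j) * Fh $$ (s, l))"
    and "\<And>l m. l < CARD('k) \<Longrightarrow> m < CARD('k) \<Longrightarrow>
      (\<Sum>t<T. Fh $$ (t, l) * Fh $$ (t, m)) = (if l = m then real T else 0)"
proof -
  let ?K = "CARD('k)"
  define S where "S = Y * Y\<^sup>T"
  have dim: "dim_row Y = T" using Y by simp
  from pc obtain d where Fh: "Fh \<in> carrier_mat T ?K"
    and norm: "(1 / real T) \<cdot>\<^sub>m (Fh\<^sup>T * Fh) = 1\<^sub>m ?K"
    and cp: "char_poly S = (\<Prod>i<T. [:- d i, 1:])"
    and ord: "\<And>i j. i < ?K \<Longrightarrow> j \<in> {?K..<T} \<Longrightarrow> d j \<le> d i"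
    and ev: "\<And>l. l < ?K \<Longrightarrow> eigenvector S (col Fh l) (d l)"
    unfolding pc_factors_def Let_def dim S_def by blast
  have S: "S \<in> carrier_mat T T" using Y by (simp add: S_def)
  have ST: "S\<^sup>T = S" using Y by (simp add: S_def transpose_mult[of _ T N _ T])
  have T: "T > 0" using KT by (meson less_le_trans zero_less_card_finite)
  have Sx: "vec_index (S *\<^sub>v x) t = (\<Sum>s<T. \<Sum>j<N. Y $$ (t, j) * Y $$ (s, j) * vec_index x s)"
    if "x \<in> carrier_vec T" "t < T" for x t
  proof -
    have "vec_index (S *\<^sub>v x) t = (\<Sum>j<N. \<Sum>s<T. Y $$ (t, j) * Y $$ (s, j) * vec_index x s)"
      using that Y by (simp add: S_def scalar_prod_def lessThan_atLeast0 sum_distrib_left mult.assoc)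
    then show ?thesis by (simp only: sum.swap[of _ "{..<N}"])
  qed
  have 1: "c \<le> d l" if l: "l < ?K" for l
  proof (rule ccontr)
    assume "\<not> c \<le> d l"
    then have dl: "d l < c" by simp
    define J where "J = {i. i < T \<and> c \<le> d i}"
    \<comment> \<open>The ordering of \<open>d\<close> enters here: an index from \<open>?K\<close>
      on has an eigenvalue at most \<open>d l\<close>, hence below \<open>c\<close>.\<close>
    have "i < ?K \<and> i \<noteq> l" if "i \<in> J" for i
      using ord[OF l, of i] dl that by (cases "i < ?K") (auto simp: J_def)
    then have "J \<subset> {..<?K}" using l by blast
    then have J: "finite J" "card J < ?K"
      using psubset_card_mono[of "{..<?K}" J] finite_subset[of J "{..<?K}"] by auto
    have "char_poly S = (\<Prod>e\<leftarrow>map d [0..<T]. [:- e, 1:])"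
      unfolding cp by (simp add: prod.list_conv_set_nth lessThan_atLeast0)
    from real_symmetric_orthogonally_diagonalizable[OF S ST this] obtain P where
      P: "P \<in> carrier_mat T T" "P\<^sup>T * P = 1\<^sub>m T" "S * P = P * mat_diag T (\<lambda>i. map d [0..<T] ! i)"
      by blast
    have SP: "S * P = P * mat_diag T d"
      unfolding P(3) by (intro arg_cong[of _ _ "(*) P"] eq_matI) (auto simp: mat_diag_def)
    have PT: "P\<^sup>T \<in> carrier_mat T T" using P by simp
    have PP: "P * P\<^sup>T = 1\<^sub>m T" using mat_mult_left_right_inverse[OF PT P(1,2)] .
    \<comment> \<open>With \<open>x\<close> the vector of the \<open>inner (f t) z\<close>, its
      coordinate along column \<open>i\<close> of \<open>P\<close> is \<open>inner (w i) z\<close>.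
      Choosing \<open>z\<close> orthogonal to all \<open>w i\<close> with \<open>i\<close> in
      \<open>J\<close> therefore removes every coordinate with a large eigenvalue; a nonzero such
      \<open>z\<close> exists because \<open>J\<close> has fewer elements than the
      dimension.\<close>
    define w where "w i = (\<Sum>t<T. P $$ (t, i) *\<^sub>R f t)" for i
    have "dim (w ` J) < DIM(real^'k)"
      using J by (metis DIM_real dim_le_card' card_image_le finite_imageI le_less_trans DIM_cart mult.right_neutral)
    then obtain z where z: "z \<noteq> 0" "\<And>y. y \<in> span (w ` J) \<Longrightarrow> real_inner_class.orthogonal z y"
      using orthogonal_to_subspace_exists by blast
    define x where "x = Matrix.vec T (\<lambda>t. inner (f t) z)"
    define y where "y = P\<^sup>T *\<^sub>v x"
    have x: "x \<in> carrier_vec T" by (simp add: x_def)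
    have y: "y \<in> carrier_vec T" using PT x by (simp add: y_def)
    have xy: "x = P *\<^sub>v y"
      using P PT PP x by (simp add: y_def assoc_mult_mat_vec[of _ T T _ T, symmetric])
    have y0: "vec_index y i = 0" if "i \<in> J" for i
    proof -
      have "vec_index y i = inner (w i) z"
        using that P by (simp add: J_def y_def x_def w_def scalar_prod_def inner_sum_left lessThan_atLeast0)
      also have "\<dots> = 0" using z(2)[of "w i"] that by (simp add: span_base real_inner_class.orthogonal_def inner_commute)
      finally show ?thesis .
    qed
    have yx: "y \<bullet> y = x \<bullet> x"
      using transpose_vec_mult_scalar[OF P(1) y x] unfolding xy[symmetric] y_def[symmetric] .
    have sq: "v \<bullet> v = (\<Sum>t<T. (vec_index v t)\<^sup>2)" if "v \<in> carrier_vec T" for v :: "real vec"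
      using that by (simp add: scalar_prod_def lessThan_atLeast0 power2_eq_square)
    have "S *\<^sub>v x = (S * P) *\<^sub>v y"
      unfolding xy using P(1) y S by simp
    also have "\<dots> = P *\<^sub>v (mat_diag T d *\<^sub>v y)"
      unfolding SP using P(1) y by (intro assoc_mult_mat_vec[of _ T T _ T]) auto
    finally have "x \<bullet> (S *\<^sub>v x) = y \<bullet> (mat_diag T d *\<^sub>v y)"
      using transpose_vec_mult_scalar[OF P(1) mult_mat_vec_carrier[OF mat_diag_dim y] x, of d]
      unfolding y_def[symmetric] by simp
    also have "mat_diag T d *\<^sub>v y = Matrix.vec T (\<lambda>i. d i * vec_index y i)"
    proof (rule eq_vecI)
      fix i assume "i < dim_vec (Matrix.vec T (\<lambda>i. d i * vec_index y i))"
      then have i: "i < T" by simp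
      have "vec_index (mat_diag T d *\<^sub>v y) i
          = (\<Sum>j<T. (if i = j then d j else 0) * vec_index y j)"
        using i y by (simp add: mat_diag_def scalar_prod_def lessThan_atLeast0)
      also have "\<dots> = (\<Sum>j<T. if i = j then d j * vec_index y j else 0)"
        by (intro sum.cong) auto
      also have "\<dots> = d i * vec_index y i"
        using i by simp
      finally show "vec_index (mat_diag T d *\<^sub>v y) i = vec_index (Matrix.vec T (\<lambda>i. d i * vec_index y i)) i"
        using i by simp
    qed (simp add: mat_diag_def)
    also have "y \<bullet> \<dots> = (\<Sum>i<T. d i * (vec_index y i)\<^sup>2)"
      using y by (simp add: scalar_prod_def lessThan_atLeast0 power2_eq_square algebra_simps)
    finally have q1: "x \<bullet> (S *\<^sub>v x) = (\<Sum>i<T. d i * (vec_index y i)\<^sup>2)" .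
    have ypos: "(\<Sum>t<T. (vec_index y t)\<^sup>2) > 0"
      using yx sq[OF x] sq[OF y] pos[OF z(1)] by (simp add: x_def)
    then obtain i0 where i0: "i0 < T" "vec_index y i0 \<noteq> 0"
      by (metis (no_types, lifting) lessThan_iff less_irrefl power_zero_numeral sum.neutral)
    \<comment> \<open>Strictness needs an index with \<open>d i < c\<close> and a nonzero
      coordinate. Since \<open>y\<close> vanishes on \<open>J\<close> and is not zero, any of its
      nonzero coordinates serves.\<close>
    have "(\<Sum>i<T. d i * (vec_index y i)\<^sup>2) < (\<Sum>i<T. c * (vec_index y i)\<^sup>2)"
    proof (rule sum_strict_mono_ex1)
      have *: "vec_index y i = 0 \<or> d i < c" if "i < T" for i
        using y0[of i] that by (auto simp: J_def)
      show "\<forall>i\<in>{..<T}. d i * (vec_index y i)\<^sup>2 \<le> c * (vec_index y i)\<^sup>2"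
      proof
        fix i assume "i \<in> {..<T}"
        with *[of i] show "d i * (vec_index y i)\<^sup>2 \<le> c * (vec_index y i)\<^sup>2"
          by (cases "vec_index y i = 0") (auto intro!: mult_right_mono)
      qed
      show "\<exists>i\<in>{..<T}. d i * (vec_index y i)\<^sup>2 < c * (vec_index y i)\<^sup>2"
        using *[OF i0(1)] i0 by (intro bexI[of _ i0]) (auto intro!: mult_strict_right_mono)
    qed simp
    also have "\<dots> = c * (\<Sum>t<T. (inner (f t) z)\<^sup>2)"
      using yx sq[OF x] sq[OF y] by (simp add: sum_distrib_left[symmetric] x_def)
    also have "\<dots> \<le> (\<Sum>j<N. (\<Sum>t<T. Y $$ (t, j) * inner (f t) z)\<^sup>2)" by (rule low[OF z(1)])
    also have "\<dots> = (Y\<^sup>T *\<^sub>v x) \<bullet> (Y\<^sup>T *\<^sub>v x)"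
      using Y by (simp add: scalar_prod_def lessThan_atLeast0 x_def power2_eq_square)
    also have "\<dots> = x \<bullet> (Y *\<^sub>v (Y\<^sup>T *\<^sub>v x))"
      using Y x by (intro transpose_vec_mult_scalar[of _ T N]) auto
    also have "\<dots> = x \<bullet> (S *\<^sub>v x)"
      using Y x by (simp add: S_def)
    finally show False using q1 by simp
  qed
  have 2: "d l * Fh $$ (t, l) = (\<Sum>s<T. \<Sum>j<N. Y $$ (t, j) * Y $$ (s, j) * Fh $$ (s, l))"
    if "l < ?K" "t < T" for l t
  proof -
    have "vec_index (S *\<^sub>v col Fh l) t = d l * Fh $$ (t, l)"
      using ev[OF that(1)] that Fh by (simp add: eigenvector_def)
    then show ?thesis using Sx[of "col Fh l" t] that Fh by simp
  qed
  have 3: "(\<Sum>t<T. Fh $$ (t, l) * Fh $$ (t, m)) = (if l = m then real T else 0)"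
    if "l < ?K" "m < ?K" for l m
  proof -
    have "((1 / real T) \<cdot>\<^sub>m (Fh\<^sup>T * Fh)) $$ (l, m) = (if l = m then 1 else 0)"
      unfolding norm using that by simp
    then show ?thesis using that Fh T
      by (simp add: scalar_prod_def lessThan_atLeast0 divide_eq_eq split: if_splits)
  qed
  show ?thesis using 1 2 3 that by blast
qed

section \<open>Deviation of the estimated from the rotated factors\<close>

no_notation vec_index (infixl "$" 100)

lemma norm_sum_scaleR_le_sqrt:
  fixes f :: "'i \<Rightarrow> real" and X :: "'i \<Rightarrow> 'b::real_normed_vector"
  shows "norm (\<Sum>s\<in>A. f s *\<^sub>R X s) \<le> sqrt (\<Sum>s\<in>A. (f s)\<^sup>2) * sqrt (\<Sum>s\<in>A. (norm (X s))\<^sup>2)"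
proof -
  have "norm (\<Sum>s\<in>A. f s *\<^sub>R X s) \<le> (\<Sum>s\<in>A. \<bar>f s\<bar> * \<bar>norm (X s)\<bar>)"
    by (rule order_trans[OF norm_sum]) simp
  also have "\<dots> \<le> L2_set f A * L2_set (\<lambda>s. norm (X s)) A" by (rule L2_set_mult_ineq)
  finally show ?thesis by (simp add: L2_set_def)
qed

lemma square_sum3_le: "(a + b + c)\<^sup>2 \<le> 3 * (a\<^sup>2 + b\<^sup>2 + c\<^sup>2)" for a b c :: real
proof -
  have "3 * (a\<^sup>2 + b\<^sup>2 + c\<^sup>2) - (a + b + c)\<^sup>2 = (a - b)\<^sup>2 + (b - c)\<^sup>2 + (a - c)\<^sup>2"
    by (simp add: power2_eq_square algebra_simps)
  then show ?thesis by (metis add_nonneg_nonneg diff_ge_0_iff_ge zero_le_power2)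
qed

lemma square_sum2_le: "(a + b)\<^sup>2 \<le> 2 * (a\<^sup>2 + b\<^sup>2)" for a b :: real
proof -
  have "2 * (a\<^sup>2 + b\<^sup>2) - (a + b)\<^sup>2 = (a - b)\<^sup>2"
    by (simp add: power2_eq_square algebra_simps)
  then show ?thesis by (metis diff_ge_0_iff_ge zero_le_power2)
qed

text \<open>One realization of the sample. The rows of \<open>Fh\<close> appear as vectors \<open>fh t\<close> in some
  enumeration of its columns, and \<open>v\<close> holds the corresponding eigenvalues divided by \<open>NT\<close>.
  With \<open>G = F' Fh / T\<close>, the rotation is \<open>H = (\<Lambda>' \<Lambda> / N) G diag(v)\<inverse>\<close> and \<open>E = Fh - F H\<close>; the column of
  index \<open>a\<close> of \<open>G\<close> and \<open>H\<close> is \<open>G a\<close> and \<open>H a\<close>.\<close>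

locale factor_sample =
  fixes N T :: nat
    and F fh :: "nat \<Rightarrow> real^'k" and lam :: "nat \<Rightarrow> real^'k"
    and u :: "nat \<Rightarrow> nat \<Rightarrow> real" and v :: "real^'k" and c :: real
  assumes N: "N \<ge> 1" and T: "T \<ge> 1" and c: "c > 0"
    and fh_orth: "(\<Sum>t=1..T. fh t $ a * fh t $ b) = (if a = b then real T else 0)"
    and fh_eigen: "t \<in> {1..T} \<Longrightarrow> real N * real T * v $ a * fh t $ a =
      (\<Sum>s=1..T. \<Sum>i=1..N. (inner (lam i) (F t) + u i t) * (inner (lam i) (F s) + u i s) * fh s $ a)"
    and v: "c \<le> v $ a"
begin

definition "G a = (1 / real T) *\<^sub>R (\<Sum>s=1..T. fh s $ a *\<^sub>R F s)"

definition "H a = (1 / (v $ a * real N)) *\<^sub>R (\<Sum>i=1..N. inner (lam i) (G a) *\<^sub>R lam i)"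

definition "E t a = fh t $ a - inner (F t) (H a)"

text \<open>In matrix terms \<open>L s\<close> is column s of \<open>\<Lambda>' U'\<close> and
  \<open>psi t s\<close> is an entry of \<open>U U'\<close>: the two objects through which the
  errors enter the deviation \<open>E\<close>.\<close>

definition "L s = (\<Sum>i=1..N. u i s *\<^sub>R lam i)"

definition "psi t s = (\<Sum>i=1..N. u i t * u i s)"

definition "R a b = (1 / real T) * (\<Sum>s=1..T. fh s $ a * E s b)"

text \<open>A bound on row t of \<open>E\<close> that mentions neither \<open>fh\<close> nor the
  column index. Only sums whose moments the model controls are left in it.\<close>

definition "e t = (norm (F t) * sqrt (\<Sum>s=1..T. (norm (L s))\<^sup>2) + norm (L t) * sqrt (\<Sum>s=1..T. (norm (F s))\<^sup>2)
    + sqrt (\<Sum>s=1..T. (psi t s)\<^sup>2)) / (c * real N * sqrt (real T))"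

lemma Npos: "real N > 0" and Tpos: "real T > 0" and vpos: "v $ a > 0"
  using N T c v[of a] by auto

lemma fh_square_sum: "(\<Sum>t=1..T. (fh t $ a)\<^sup>2) = real T"
  using fh_orth[of a a] by (simp add: power2_eq_square)

text \<open>Each column of \<open>fh\<close> has squared length exactly T, so Cauchy-Schwarz removes
  the estimated factors from a sum without any moment bound for them.\<close>

lemma norm_fh_sum_le:
  fixes X :: "nat \<Rightarrow> 'b::real_normed_vector"
  shows "norm (\<Sum>s=1..T. fh s $ a *\<^sub>R X s) \<le> sqrt (real T) * sqrt (\<Sum>s=1..T. (norm (X s))\<^sup>2)"
  using norm_sum_scaleR_le_sqrt[of "\<lambda>s. fh s $ a" X "{1..T}"] fh_square_sum[of a] by simp

lemma abs_fh_sum_le: "\<bar>\<Sum>s=1..T. fh s $ a * x s\<bar> \<le> sqrt (real T) * sqrt (\<Sum>s=1..T. (x s)\<^sup>2)"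
  using norm_fh_sum_le[of a x] by simp

lemma e_nonneg: "e t \<ge> 0"
  unfolding e_def using c by (intro divide_nonneg_nonneg add_nonneg_nonneg mult_nonneg_nonneg) (auto intro: sum_nonneg)

text \<open>\<open>H\<close> is chosen such that the eigenvector equation loses its pure signal term.\<close>

lemma E_expand:
  assumes t: "t \<in> {1..T}"
  shows "real N * real T * v $ a * E t a =
    inner (F t) (\<Sum>s=1..T. fh s $ a *\<^sub>R L s) + inner (L t) (\<Sum>s=1..T. fh s $ a *\<^sub>R F s)
    + (\<Sum>s=1..T. fh s $ a * psi t s)"
proof -
  have "real N * real T * v $ a * inner (F t) (H a)
      = real T * (\<Sum>i=1..N. inner (lam i) (G a) * inner (lam i) (F t))"
    using Npos vpos[of a] by (simp add: H_def inner_sum_right inner_commute)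
  also have "\<dots> = (\<Sum>i=1..N. (\<Sum>s=1..T. fh s $ a * inner (lam i) (F s)) * inner (lam i) (F t))"
  proof -
    have "real T * inner (lam i) (G a) = (\<Sum>s=1..T. fh s $ a * inner (lam i) (F s))" for i
      using Tpos by (simp add: G_def inner_sum_right)
    then show ?thesis by (simp add: sum_distrib_left mult.assoc[symmetric])
  qed
  also have "\<dots> = (\<Sum>s=1..T. \<Sum>i=1..N. inner (lam i) (F t) * inner (lam i) (F s) * fh s $ a)"
    by (subst sum.swap) (simp add: sum_distrib_left sum_distrib_right mult_ac)
  finally have 1: "real N * real T * v $ a * inner (F t) (H a)
      = (\<Sum>s=1..T. \<Sum>i=1..N. inner (lam i) (F t) * inner (lam i) (F s) * fh s $ a)" .
  have 2: "inner (F t) (\<Sum>s=1..T. fh s $ a *\<^sub>R L s) = (\<Sum>s=1..T. \<Sum>i=1..N. inner (lam i) (F t) * u i s * fh s $ a)"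
    by (simp add: L_def inner_sum_right sum_distrib_left inner_commute mult_ac)
  have 3: "inner (L t) (\<Sum>s=1..T. fh s $ a *\<^sub>R F s) = (\<Sum>s=1..T. \<Sum>i=1..N. u i t * inner (lam i) (F s) * fh s $ a)"
    by (simp add: L_def inner_sum_right inner_sum_left sum_distrib_left mult_ac)
  have 4: "(\<Sum>s=1..T. fh s $ a * psi t s) = (\<Sum>s=1..T. \<Sum>i=1..N. u i t * u i s * fh s $ a)"
    by (simp add: psi_def sum_distrib_left mult_ac)
  have "real N * real T * v $ a * E t a = real N * real T * v $ a * fh t $ a - real N * real T * v $ a * inner (F t) (H a)"
    by (simp add: E_def algebra_simps)
  then show ?thesis
    unfolding fh_eigen[OF t] 1 2 3 4 by (simp add: algebra_simps sum.distrib)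
qed

text \<open>Cauchy-Schwarz is applied to each of the three terms of the eigenvector equation, and
  the eigenvalue on the left is replaced by its lower bound \<open>c\<close>.\<close>

lemma abs_E_le:
  assumes t: "t \<in> {1..T}"
  shows "\<bar>E t a\<bar> \<le> e t"
proof -
  let ?r = "sqrt (real T)"
  have "c * real N * real T * \<bar>E t a\<bar> \<le> v $ a * real N * real T * \<bar>E t a\<bar>"
    using v[of a] by (intro mult_right_mono) auto
  also have "\<dots> = \<bar>real N * real T * v $ a * E t a\<bar>"
    using vpos[of a] by (simp add: abs_mult)
  also have "\<dots> \<le> norm (F t) * norm (\<Sum>s=1..T. fh s $ a *\<^sub>R L s) + norm (L t) * norm (\<Sum>s=1..T. fh s $ a *\<^sub>R F s)
      + \<bar>\<Sum>s=1..T. fh s $ a * psi t s\<bar>"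
    unfolding E_expand[OF t]
    using Cauchy_Schwarz_ineq2[of "F t" "\<Sum>s=1..T. fh s $ a *\<^sub>R L s"]
      Cauchy_Schwarz_ineq2[of "L t" "\<Sum>s=1..T. fh s $ a *\<^sub>R F s"] by linarith
  also have "\<dots> \<le> norm (F t) * (?r * sqrt (\<Sum>s=1..T. (norm (L s))\<^sup>2)) + norm (L t) * (?r * sqrt (\<Sum>s=1..T. (norm (F s))\<^sup>2))
      + ?r * sqrt (\<Sum>s=1..T. (psi t s)\<^sup>2)"
    by (intro add_mono mult_left_mono norm_fh_sum_le abs_fh_sum_le) auto
  also have "\<dots> = ?r * (norm (F t) * sqrt (\<Sum>s=1..T. (norm (L s))\<^sup>2) + norm (L t) * sqrt (\<Sum>s=1..T. (norm (F s))\<^sup>2)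
      + sqrt (\<Sum>s=1..T. (psi t s)\<^sup>2))"
    by (simp only: distrib_left mult.left_commute)
  also have "\<dots> = (c * real N * (?r * ?r)) * e t"
  proof -
    have "r * x = c * real N * (r * r) * (x / (c * real N * r))" if "r > 0" for r x :: real
      using that c Npos by (simp add: field_simps)
    moreover have "?r > 0" using Tpos by simp
    ultimately show ?thesis unfolding e_def by blast
  qed
  finally have "(c * real N * real T) * \<bar>E t a\<bar> \<le> (c * real N * real T) * e t" by simp
  then show ?thesis using c Npos Tpos by (simp add: mult_le_cancel_left)
qed

text \<open>The 3 comes from squaring a sum of three terms. The two cross terms become equal after
  summation over t, whence the factor 2.\<close>

lemma e_square_sum_le:
  "(\<Sum>t=1..T. (e t)\<^sup>2) \<le> 3 / (c\<^sup>2 * (real N)\<^sup>2 * real T) *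
     (2 * (\<Sum>t=1..T. (norm (F t))\<^sup>2) * (\<Sum>t=1..T. (norm (L t))\<^sup>2) + (\<Sum>t=1..T. \<Sum>s=1..T. (psi t s)\<^sup>2))"
proof -
  let ?SF = "\<Sum>t=1..T. (norm (F t))\<^sup>2" and ?SL = "\<Sum>t=1..T. (norm (L t))\<^sup>2"
  have SF: "?SF \<ge> 0" and SL: "?SL \<ge> 0" and SP: "(\<Sum>s=1..T. (psi t s)\<^sup>2) \<ge> 0" for t by (auto intro: sum_nonneg)
  have "(e t)\<^sup>2 \<le> 3 / (c\<^sup>2 * (real N)\<^sup>2 * real T) *
      ((norm (F t))\<^sup>2 * ?SL + (norm (L t))\<^sup>2 * ?SF + (\<Sum>s=1..T. (psi t s)\<^sup>2))" for t
  proof -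
    have "(e t)\<^sup>2 = (norm (F t) * sqrt ?SL + norm (L t) * sqrt ?SF + sqrt (\<Sum>s=1..T. (psi t s)\<^sup>2))\<^sup>2 / (c\<^sup>2 * (real N)\<^sup>2 * real T)"
      by (simp add: e_def power_divide power_mult_distrib)
    also have "\<dots> \<le> 3 * ((norm (F t) * sqrt ?SL)\<^sup>2 + (norm (L t) * sqrt ?SF)\<^sup>2 + (sqrt (\<Sum>s=1..T. (psi t s)\<^sup>2))\<^sup>2) / (c\<^sup>2 * (real N)\<^sup>2 * real T)"
      by (intro divide_right_mono square_sum3_le) auto
    finally show ?thesis
      using SF SL SP[of t] by (simp add: power_mult_distrib)
  qed
  then have "(\<Sum>t=1..T. (e t)\<^sup>2) \<le> (\<Sum>t=1..T. 3 / (c\<^sup>2 * (real N)\<^sup>2 * real T) *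
      ((norm (F t))\<^sup>2 * ?SL + (norm (L t))\<^sup>2 * ?SF + (\<Sum>s=1..T. (psi t s)\<^sup>2)))"
    by (intro sum_mono)
  also have "\<dots> = 3 / (c\<^sup>2 * (real N)\<^sup>2 * real T) * (?SF * ?SL + ?SL * ?SF + (\<Sum>t=1..T. \<Sum>s=1..T. (psi t s)\<^sup>2))"
    unfolding sum_distrib_left[symmetric] sum.distrib sum_distrib_right[symmetric] ..
  finally show ?thesis by (simp add: algebra_simps)
qed

definition "ee = sqrt ((1 / real T) * (\<Sum>t=1..T. (e t)\<^sup>2))"

lemma ee_nonneg: "ee \<ge> 0"
  by (simp add: ee_def sum_nonneg)

lemma E_square_sum_le: "sqrt (\<Sum>s=1..T. (E s a)\<^sup>2) \<le> sqrt (real T) * ee"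
proof -
  have "(\<Sum>s=1..T. (E s a)\<^sup>2) \<le> (\<Sum>s=1..T. (e s)\<^sup>2)"
  proof (intro sum_mono)
    fix s assume "s \<in> {1..T}"
    then show "(E s a)\<^sup>2 \<le> (e s)\<^sup>2" using abs_E_le[of s a] e_nonneg[of s] by (simp add: abs_le_square_iff[symmetric])
  qed
  then have "sqrt (\<Sum>s=1..T. (E s a)\<^sup>2) \<le> sqrt (real T * ((1 / real T) * (\<Sum>s=1..T. (e s)\<^sup>2)))"
    using Tpos by simp
  then show ?thesis unfolding ee_def real_sqrt_mult[symmetric] .
qed

text \<open>\<open>R a b\<close> averages \<open>E\<close> against a column of mean square one, so
  the root mean square of \<open>E\<close> bounds it.\<close>

lemma abs_R_le: "\<bar>R a b\<bar> \<le> ee"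
proof -
  have "\<bar>\<Sum>s=1..T. fh s $ a * E s b\<bar> \<le> sqrt (real T) * (sqrt (real T) * ee)"
    using abs_fh_sum_le[of a "\<lambda>s. E s b"] E_square_sum_le[of b]
    by (meson mult_left_mono order_trans real_sqrt_ge_zero of_nat_0_le_iff)
  also have "\<dots> = real T * ee" by (simp add: mult.assoc[symmetric])
  finally show ?thesis using Tpos by (simp add: R_def abs_mult field_simps)
qed

text \<open>In the normalization \<open>Fh' Fh / T = I\<close>, the second factor is split as
  \<open>F H + E\<close>.\<close>

lemma inner_G_H: "inner (G a) (H b) = (if a = b then 1 else 0) - R a b"
proof -
  have "real T * inner (G a) (H b) = (\<Sum>s=1..T. fh s $ a * inner (F s) (H b))"
    using Tpos by (simp add: G_def inner_sum_left)
  also have "\<dots> = (\<Sum>s=1..T. fh s $ a * fh s $ b) - (\<Sum>s=1..T. fh s $ a * E s b)"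
    by (simp add: E_def sum_subtractf[symmetric] algebra_simps)
  also have "\<dots> = real T * ((if a = b then 1 else 0) - R a b)"
    unfolding fh_orth using Tpos by (simp add: R_def algebra_simps)
  finally show ?thesis using Tpos by simp
qed

lemma inner_G_combination:
  "inner (G a) (\<Sum>b\<in>UNIV. h b *\<^sub>R H b) = h a - (\<Sum>b\<in>UNIV. R a b * h b)"
proof -
  have "inner (G a) (\<Sum>b\<in>UNIV. h b *\<^sub>R H b) = (\<Sum>b\<in>UNIV. h b * (if a = b then 1 else 0) - R a b * h b)"
    by (simp add: inner_sum_right inner_G_H algebra_simps)
  also have "\<dots> = (\<Sum>b\<in>UNIV. if a = b then h b else 0) - (\<Sum>b\<in>UNIV. R a b * h b)"
    unfolding sum_subtractf by (intro arg_cong2[of _ _ _ _ "(-)"] sum.cong) auto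
  finally show ?thesis by simp
qed

text \<open>By \<open>inner_G_H\<close>, \<open>G' H\<close> is close to the identity, so that \<open>H\<close> is invertible with controlled
  inverse.\<close>

lemma coefficient_bound:
  assumes small: "CARD('k) * ee \<le> 1 / 2"
  shows "(\<Sum>a\<in>UNIV. \<bar>h a\<bar>) \<le> 2 * (\<Sum>a\<in>UNIV. \<bar>inner (G a) (\<Sum>b\<in>UNIV. h b *\<^sub>R H b)\<bar>)"
proof -
  let ?S = "\<Sum>a\<in>UNIV. \<bar>h a\<bar>"
  have Rh: "\<bar>\<Sum>b\<in>UNIV. R a b * h b\<bar> \<le> ee * ?S" for a
  proof -
    have "\<bar>\<Sum>b\<in>UNIV. R a b * h b\<bar> \<le> (\<Sum>b\<in>UNIV. \<bar>R a b\<bar> * \<bar>h b\<bar>)"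
      unfolding abs_mult[symmetric] by (rule sum_abs)
    also have "\<dots> \<le> (\<Sum>b\<in>UNIV. ee * \<bar>h b\<bar>)" by (intro sum_mono mult_right_mono abs_R_le) auto
    finally show ?thesis by (simp add: sum_distrib_left)
  qed
  have "\<bar>h a\<bar> \<le> \<bar>inner (G a) (\<Sum>b\<in>UNIV. h b *\<^sub>R H b)\<bar> + ee * ?S" for a
    unfolding inner_G_combination using Rh[of a] by linarith
  then have "?S \<le> (\<Sum>a\<in>UNIV. \<bar>inner (G a) (\<Sum>b\<in>UNIV. h b *\<^sub>R H b)\<bar> + ee * ?S)"
    by (intro sum_mono)
  also have "\<dots> = (\<Sum>a\<in>UNIV. \<bar>inner (G a) (\<Sum>b\<in>UNIV. h b *\<^sub>R H b)\<bar>) + (CARD('k) * ee) * ?S"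
    by (simp add: sum.distrib)
  finally have *: "?S \<le> (\<Sum>a\<in>UNIV. \<bar>inner (G a) (\<Sum>b\<in>UNIV. h b *\<^sub>R H b)\<bar>) + (CARD('k) * ee) * ?S" .
  \<comment> \<open>At most half of \<open>?S\<close> is produced by the remainder \<open>R\<close>,
    so it is absorbed on the left; this is the source of the factor 2 in the claim.\<close>
  have "(CARD('k) * ee) * ?S \<le> 1 / 2 * ?S"
    by (intro mult_right_mono small sum_nonneg) auto
  with * show ?thesis by simp
qed

text \<open>\<open>coefficient_bound\<close> makes the map from \<open>h\<close> to the combination
  of the columns of \<open>H\<close> injective, and an injective linear map of
  \<open>real^'k\<close> into itself is onto. The same bound then controls the coefficients found
  here.\<close>

lemma H_spans:
  assumes small: "CARD('k) * ee \<le> 1 / 2"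
  obtains h :: "real^'k" where "(\<Sum>b\<in>UNIV. h $ b *\<^sub>R H b) = \<mu>"
proof -
  let ?f = "\<lambda>h::real^'k. \<Sum>b\<in>UNIV. h $ b *\<^sub>R H b"
  have lin: "linear ?f"
    by (intro linearI) (simp_all add: scaleR_add_left sum.distrib scaleR_sum_right)
  have "inj ?f"
    unfolding linear_injective_0[OF lin]
  proof (intro allI impI)
    fix h :: "real^'k" assume "?f h = 0"
    then have "(\<Sum>a\<in>UNIV. \<bar>h $ a\<bar>) \<le> 0"
      using coefficient_bound[OF small, of "\<lambda>a. h $ a"] by simp
    then have "(\<Sum>a\<in>UNIV. \<bar>h $ a\<bar>) = 0"
      by (intro antisym sum_nonneg) auto
    then show "h = 0" by (simp add: sum_nonneg_eq_0_iff Finite_Cartesian_Product.vec_eq_iff)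
  qed
  then have "surj ?f" using linear_injective_imp_surjective[OF lin] by simp
  from surjD[OF this, of \<mu>] obtain h where "\<mu> = ?f h" by blast
  then show ?thesis using that[of h] by simp
qed

text \<open>Since \<open>F \<lambda> = (Fh - E) h\<close> and \<open>G' \<lambda> = h - R h\<close>,
  the terms \<open>Fh h\<close> of order one cancel, and \<open>h\<close> survives only in products
  with \<open>R\<close> and \<open>E\<close>.\<close>

lemma fit_error:
  fixes h :: "real^'k"
  assumes h: "(\<Sum>b\<in>UNIV. h $ b *\<^sub>R H b) = lam j"
  shows "(\<Sum>a\<in>UNIV. fh t $ a * ((1 / real T) * (\<Sum>s=1..T. fh s $ a * (inner (lam j) (F s) + u j s))))
      - inner (lam j) (F t)
    = (\<Sum>a\<in>UNIV. fh t $ a * ((1 / real T) * (\<Sum>s=1..T. fh s $ a * u j s) - (\<Sum>b\<in>UNIV. R a b * h $ b)))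
      + (\<Sum>b\<in>UNIV. h $ b * E t b)"
proof -
  have 1: "inner (lam j) (F t) = (\<Sum>b\<in>UNIV. h $ b * fh t $ b) - (\<Sum>b\<in>UNIV. h $ b * E t b)"
    unfolding h[symmetric] inner_sum_left sum_subtractf[symmetric]
    by (intro sum.cong) (auto simp: E_def inner_commute algebra_simps)
  have 2: "(1 / real T) * (\<Sum>s=1..T. fh s $ a * (inner (lam j) (F s) + u j s))
      = h $ a - (\<Sum>b\<in>UNIV. R a b * h $ b) + (1 / real T) * (\<Sum>s=1..T. fh s $ a * u j s)" for a
  proof -
    have "(1 / real T) * (\<Sum>s=1..T. fh s $ a * (inner (lam j) (F s) + u j s))
        = inner (G a) (lam j) + (1 / real T) * (\<Sum>s=1..T. fh s $ a * u j s)"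
      by (simp add: G_def inner_sum_left inner_commute[of "lam j"] distrib_left sum.distrib add_divide_distrib)
    then show ?thesis using inner_G_combination[of a "\<lambda>b. h $ b"] h by simp
  qed
  show ?thesis unfolding 1 2 by (simp add: algebra_simps sum.distrib sum_subtractf)
qed

end

section \<open>Deterministic error rates for one realization\<close>

context factor_sample
begin

lemma norm_G_le: "norm (G a) \<le> sqrt ((\<Sum>t=1..T. (norm (F t))\<^sup>2) / real T)"
proof -
  have "norm (G a) = norm (\<Sum>s=1..T. fh s $ a *\<^sub>R F s) / real T"
    using Tpos by (simp add: G_def)
  also have "\<dots> \<le> sqrt (real T) * sqrt (\<Sum>t=1..T. (norm (F t))\<^sup>2) / real T"
    by (intro divide_right_mono norm_fh_sum_le) auto
  also have "\<dots> = sqrt (\<Sum>t=1..T. (norm (F t))\<^sup>2) / sqrt (real T)"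
  proof -
    have "sqrt (real T) * x / real T = x / sqrt (real T)" for x
      using real_sqrt_mult_self[of "real T"] Tpos by (simp add: field_simps del: real_sqrt_mult_self)
    then show ?thesis .
  qed
  finally show ?thesis by (simp add: real_sqrt_divide)
qed

lemma norm_H_le:
  assumes B: "\<And>i. i \<in> {1..N} \<Longrightarrow> norm (lam i) \<le> B" and g: "norm (G a) \<le> g"
  shows "norm (H a) \<le> B\<^sup>2 * g / c"
proof -
  have "norm (\<Sum>i=1..N. inner (lam i) (G a) *\<^sub>R lam i) \<le> (\<Sum>i=1..N. B\<^sup>2 * g)"
  proof (intro order_trans[OF norm_sum] sum_mono)
    fix i assume i: "i \<in> {1..N}"
    have "norm (inner (lam i) (G a) *\<^sub>R lam i) \<le> (norm (lam i) * norm (G a)) * norm (lam i)"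
      by (simp add: Cauchy_Schwarz_ineq2 mult_right_mono)
    also have "\<dots> \<le> (B * g) * B"
      using B[OF i] g order_trans[OF norm_ge_zero B[OF i]] order_trans[OF norm_ge_zero g]
      by (intro mult_mono) auto
    finally show "norm (inner (lam i) (G a) *\<^sub>R lam i) \<le> B\<^sup>2 * g"
      by (simp add: power2_eq_square mult_ac)
  qed
  then have 1: "norm (\<Sum>i=1..N. inner (lam i) (G a) *\<^sub>R lam i) \<le> real N * (B\<^sup>2 * g)" by simp
  have "norm (H a) = norm (\<Sum>i=1..N. inner (lam i) (G a) *\<^sub>R lam i) / (v $ a * real N)"
    using vpos[of a] Npos by (simp add: H_def)
  also have "\<dots> \<le> real N * (B\<^sup>2 * g) / (v $ a * real N)"
    using 1 vpos[of a] by (intro divide_right_mono) auto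
  also have "\<dots> = (B\<^sup>2 * g) / v $ a" using Npos by simp
  also have "\<dots> \<le> (B\<^sup>2 * g) / c"
    using v[of a] c g order_trans[OF norm_ge_zero g] by (intro divide_left_mono) auto
  finally show ?thesis .
qed

text \<open>The constants depend only on \<open>C\<close>, \<open>B\<close>, \<open>c\<close> and
  the number of factors, so they are uniform over sample points and sample sizes. \<open>A1\<close>
  belongs to the root mean square of \<open>E\<close>, \<open>A2\<close> to the absolute sum of the
  coefficients \<open>h\<close>, \<open>A3\<close> to the columns of \<open>H\<close>,
  \<open>A5\<close> to the bracket multiplying \<open>Fh\<close> in \<open>fit_error\<close>, and
  \<open>A6\<close> to \<open>E\<close> at a single time. The hypothesis \<open>small\<close> is
  what makes \<open>H\<close> invertible.\<close>

lemma fit_rates: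
  fixes C B :: real and j :: nat
  defines "\<delta> \<equiv> sqrt (1 / real N + 1 / real T)"
  defines "A1 \<equiv> sqrt (3 * (2 * C\<^sup>2 + C)) / c"
    and "A2 \<equiv> 2 * real CARD('k) * (sqrt C * B)"
    and "A3 \<equiv> B\<^sup>2 * sqrt C / c"
    and "A6 \<equiv> (2 * C + sqrt C) / c"
  defines "A5 \<equiv> (A3 + A1) * sqrt C + A1 * A2"
  defines "fit \<equiv> \<lambda>t. \<Sum>a\<in>UNIV. fh t $ a * ((1 / real T) * (\<Sum>s=1..T. fh s $ a * (inner (lam j) (F s) + u j s)))"
  assumes C: "C \<ge> 0" and B: "\<And>i. i \<in> {1..N} \<Longrightarrow> norm (lam i) \<le> B" and j: "j \<in> {1..N}"
    and SF: "(\<Sum>t=1..T. (norm (F t))\<^sup>2) \<le> C * real T"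
    and SL: "(\<Sum>t=1..T. (norm (\<Sum>i=1..N. u i t *\<^sub>R lam i))\<^sup>2) \<le> C * real N * real T"
    and SP: "(\<Sum>t=1..T. \<Sum>s=1..T. (\<Sum>i=1..N. u i t * u i s)\<^sup>2) \<le> C * ((real N)\<^sup>2 * real T + real N * (real T)\<^sup>2)"
    and Su: "(\<Sum>t=1..T. (u j t)\<^sup>2) \<le> C * real T"
    and phi: "(norm (\<Sum>t=1..T. u j t *\<^sub>R F t))\<^sup>2 \<le> C * real T"
    and small: "real CARD('k) * A1 * \<delta> \<le> 1 / 2"
  shows fit_average_rate: "(1 / real T) * (\<Sum>t=1..T. (fit t - inner (lam j) (F t))\<^sup>2)
      \<le> (2 * A5\<^sup>2 * (real CARD('k))\<^sup>2 + 2 * A2\<^sup>2 * A1\<^sup>2) * \<delta>\<^sup>2"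
    and fit_pointwise_rate: "t \<in> {1..T} \<Longrightarrow> (norm (F t))\<^sup>2 \<le> C \<Longrightarrow>
      (norm (\<Sum>i=1..N. u i t *\<^sub>R lam i))\<^sup>2 \<le> C * real N \<Longrightarrow>
      (\<Sum>s=1..T. (\<Sum>i=1..N. u i t * u i s)\<^sup>2) \<le> C * ((real N)\<^sup>2 + real N * real T) \<Longrightarrow>
      \<bar>fit t - inner (lam j) (F t)\<bar> \<le> (real CARD('k) * (sqrt C * A3 + 2 * A6) * A5 + A2 * A6) * \<delta>"
proof -
  let ?K = "real CARD('k)"
  have d0: "\<delta> > 0" using Npos Tpos by (simp add: \<delta>_def add_pos_pos)
  have d2: "\<delta>\<^sup>2 = 1 / real N + 1 / real T" by (simp add: \<delta>_def)
  have dN: "1 / sqrt (real N) \<le> \<delta>" and dT: "1 / sqrt (real T) \<le> \<delta>"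
    using real_sqrt_le_mono[of "1 / real N" "1 / real N + 1 / real T"]
      real_sqrt_le_mono[of "1 / real T" "1 / real N + 1 / real T"]
    by (simp_all add: \<delta>_def real_sqrt_divide)
  have "1 / real N + 1 / real T \<le> 1 + 1"
    using N T by (intro add_mono) auto
  then have d_le2: "\<delta> \<le> 2"
    unfolding \<delta>_def by (intro real_le_lsqrt) auto
  have B0: "B \<ge> 0" using order_trans[OF norm_ge_zero B[OF j]] .
  have A: "A1 \<ge> 0" "A2 \<ge> 0" "A3 \<ge> 0" "A6 \<ge> 0" "A5 \<ge> 0"
    using C c B0 by (simp_all add: A1_def A2_def A3_def A6_def A5_def)
  have SF0: "(\<Sum>t=1..T. (norm (F t))\<^sup>2) \<ge> 0" and SL0: "(\<Sum>t=1..T. (norm (L t))\<^sup>2) \<ge> 0"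
    by (auto intro: sum_nonneg)
  have ee2: "(1 / real T) * (\<Sum>t=1..T. (e t)\<^sup>2) \<le> A1\<^sup>2 * \<delta>\<^sup>2"
  proof -
    have "(\<Sum>t=1..T. (e t)\<^sup>2) \<le> 3 / (c\<^sup>2 * (real N)\<^sup>2 * real T) *
     (2 * (C * real T) * (C * real N * real T) + C * ((real N)\<^sup>2 * real T + real N * (real T)\<^sup>2))"
      using SF SL SP SF0 SL0 C
      by (intro order_trans[OF e_square_sum_le] mult_left_mono add_mono mult_mono)
        (auto simp: L_def psi_def)
    also have "\<dots> = real T * (3 / c\<^sup>2 * (2 * C\<^sup>2 / real N + C * (1 / real N + 1 / real T)))"
      using Npos Tpos c by (simp add: field_simps power2_eq_square)
    also have "\<dots> \<le> real T * (3 / c\<^sup>2 * (2 * C\<^sup>2 * (1 / real N + 1 / real T) + C * (1 / real N + 1 / real T)))"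
    proof -
      have "2 * C\<^sup>2 / real N \<le> 2 * C\<^sup>2 * (1 / real N + 1 / real T)" by (simp add: distrib_left)
      then show ?thesis using c by (intro mult_left_mono add_right_mono) auto
    qed
    also have "\<dots> = real T * (A1\<^sup>2 * \<delta>\<^sup>2)"
    proof -
      have "A1\<^sup>2 = 3 * (2 * C\<^sup>2 + C) / c\<^sup>2" using C by (simp add: A1_def power_divide)
      moreover have "2 * C\<^sup>2 * x + C * x = (2 * C\<^sup>2 + C) * x" for x by (simp add: distrib_right)
      ultimately show ?thesis
        by (simp only: d2 times_divide_eq_left times_divide_eq_right mult.assoc)
    qed
    finally show ?thesis using Tpos by (simp add: field_simps)
  qed
  then have ee: "ee \<le> A1 * \<delta>"
    unfolding ee_def using A d0 by (intro real_le_lsqrt) (auto simp: power_mult_distrib)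
  have "?K * ee \<le> ?K * (A1 * \<delta>)" using ee by (intro mult_left_mono) auto
  with small have small': "?K * ee \<le> 1 / 2" unfolding mult.assoc by linarith
  have Gb: "norm (G a) \<le> sqrt C" for a
    by (rule order_trans[OF norm_G_le]) (use SF Tpos in \<open>simp add: divide_le_eq\<close>)
  have Hb: "norm (H a) \<le> A3" for a
    using norm_H_le[OF B Gb] by (simp add: A3_def)
  obtain h :: "real^'k" where h: "(\<Sum>b\<in>UNIV. h $ b *\<^sub>R H b) = lam j"
    using H_spans[OF small'] .
  let ?h1 = "\<Sum>a\<in>UNIV. \<bar>h $ a\<bar>"
  have h1: "?h1 \<le> A2"
  proof -
    have "(\<Sum>a\<in>UNIV. \<bar>inner (G a) (lam j)\<bar>) \<le> (\<Sum>a\<in>(UNIV::'k set). sqrt C * B)"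
      by (intro sum_mono order_trans[OF Cauchy_Schwarz_ineq2] mult_mono Gb B j) (use C in auto)
    then show ?thesis
      using coefficient_bound[OF small', of "\<lambda>a. h $ a"] by (simp add: h A2_def)
  qed
  define q where "q a = (1 / real T) * (\<Sum>s=1..T. fh s $ a * u j s) - (\<Sum>b\<in>UNIV. R a b * h $ b)" for a
  have qb: "\<bar>q a\<bar> \<le> A5 * \<delta>" for a
  proof -
    \<comment> \<open>Splitting \<open>fh\<close> as \<open>F H + E\<close> gains the rate: the
      first part is governed by \<open>phi\<close>, and the second pairs the small \<open>E\<close>
      with errors of bounded mean square. A direct bound by the length of \<open>fh\<close> would be
      of order T.\<close>
    have "(\<Sum>s=1..T. fh s $ a * u j s) = inner (H a) (\<Sum>s=1..T. u j s *\<^sub>R F s) + (\<Sum>s=1..T. E s a * u j s)"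
      by (simp add: inner_sum_right E_def sum.distrib[symmetric] algebra_simps inner_commute)
    moreover have "\<bar>inner (H a) (\<Sum>s=1..T. u j s *\<^sub>R F s)\<bar> \<le> A3 * (sqrt C * sqrt (real T))"
    proof (intro order_trans[OF Cauchy_Schwarz_ineq2] mult_mono Hb A)
      show "norm (\<Sum>s=1..T. u j s *\<^sub>R F s) \<le> sqrt C * sqrt (real T)"
        using real_le_rsqrt[OF phi] by (simp add: real_sqrt_mult)
    qed auto
    moreover have "\<bar>\<Sum>s=1..T. E s a * u j s\<bar> \<le> (sqrt (real T) * (A1 * \<delta>)) * (sqrt C * sqrt (real T))"
    proof -
      have "\<bar>\<Sum>s=1..T. E s a * u j s\<bar> \<le> sqrt (\<Sum>s=1..T. (E s a)\<^sup>2) * sqrt (\<Sum>s=1..T. (u j s)\<^sup>2)"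
        using norm_sum_scaleR_le_sqrt[of "\<lambda>s. E s a" "\<lambda>s. u j s" "{1..T}"] by simp
      also have "\<dots> \<le> (sqrt (real T) * (A1 * \<delta>)) * sqrt (C * real T)"
        using ee A d0 Su ee_nonneg
        by (intro mult_mono order_trans[OF E_square_sum_le]) (auto intro: mult_left_mono sum_nonneg)
      finally show ?thesis by (simp add: real_sqrt_mult)
    qed
    ultimately have "\<bar>\<Sum>s=1..T. fh s $ a * u j s\<bar> \<le> A3 * (sqrt C * sqrt (real T)) + (sqrt (real T) * (A1 * \<delta>)) * (sqrt C * sqrt (real T))"
      by linarith
    then have "\<bar>(1 / real T) * (\<Sum>s=1..T. fh s $ a * u j s)\<bar> \<le> (1 / real T) * (A3 * (sqrt C * sqrt (real T)) + (sqrt (real T) * (A1 * \<delta>)) * (sqrt C * sqrt (real T)))"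
      using Tpos by (simp add: abs_mult field_simps)
    also have "\<dots> = A3 * sqrt C * (1 / sqrt (real T)) + A1 * \<delta> * sqrt C"
    proof -
      have "(1 / (r * r)) * (x * (y * r) + (r * z) * (y * r)) = x * y * (1 / r) + z * y" if "r > 0" for r x y z :: real
        using that by (simp add: field_simps)
      from this[of "sqrt (real T)" A3 "sqrt C" "A1 * \<delta>"] Tpos show ?thesis by simp
    qed
    also have "\<dots> \<le> A3 * sqrt C * \<delta> + A1 * \<delta> * sqrt C"
      using A C dT by (intro add_right_mono mult_left_mono) auto
    finally have 1: "\<bar>(1 / real T) * (\<Sum>s=1..T. fh s $ a * u j s)\<bar> \<le> (A3 + A1) * sqrt C * \<delta>"
      by (simp add: algebra_simps)
    have "\<bar>\<Sum>b\<in>UNIV. R a b * h $ b\<bar> \<le> (\<Sum>b\<in>UNIV. \<bar>R a b\<bar> * \<bar>h $ b\<bar>)"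
      unfolding abs_mult[symmetric] by (rule sum_abs)
    also have "\<dots> \<le> (\<Sum>b\<in>UNIV. (A1 * \<delta>) * \<bar>h $ b\<bar>)"
      by (intro sum_mono mult_right_mono order_trans[OF abs_R_le ee]) auto
    also have "\<dots> \<le> (A1 * \<delta>) * A2"
      unfolding sum_distrib_left[symmetric] using A d0 by (intro mult_left_mono h1) auto
    finally have "\<bar>\<Sum>b\<in>UNIV. R a b * h $ b\<bar> \<le> A1 * A2 * \<delta>" by (simp add: mult_ac)
    with 1 have "\<bar>q a\<bar> \<le> (A3 + A1) * sqrt C * \<delta> + A1 * A2 * \<delta>"
      unfolding q_def by linarith
    then show ?thesis by (simp add: A5_def algebra_simps)
  qed
  have err: "\<bar>fit t - inner (lam j) (F t)\<bar> \<le> (\<Sum>a\<in>UNIV. \<bar>fh t $ a\<bar>) * (A5 * \<delta>) + A2 * e t"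
    if t: "t \<in> {1..T}" for t
  proof -
    have "fit t - inner (lam j) (F t) = (\<Sum>a\<in>UNIV. fh t $ a * q a) + (\<Sum>b\<in>UNIV. h $ b * E t b)"
      unfolding fit_def q_def by (rule fit_error[OF h])
    moreover have "\<bar>\<Sum>a\<in>UNIV. fh t $ a * q a\<bar> \<le> (\<Sum>a\<in>UNIV. \<bar>fh t $ a\<bar> * (A5 * \<delta>))"
      by (rule order_trans[OF sum_abs], unfold abs_mult, intro sum_mono mult_left_mono qb) auto
    moreover have "\<bar>\<Sum>b\<in>UNIV. h $ b * E t b\<bar> \<le> (\<Sum>b\<in>UNIV. \<bar>h $ b\<bar> * e t)"
      by (rule order_trans[OF sum_abs], unfold abs_mult, intro sum_mono mult_left_mono abs_E_le t) auto
    moreover have "(\<Sum>b\<in>UNIV. \<bar>h $ b\<bar> * e t) \<le> A2 * e t"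
      unfolding sum_distrib_right[symmetric] by (intro mult_right_mono h1 e_nonneg)
    ultimately show ?thesis unfolding sum_distrib_right by linarith
  qed
  show "(1 / real T) * (\<Sum>t=1..T. (fit t - inner (lam j) (F t))\<^sup>2)
      \<le> (2 * A5\<^sup>2 * ?K\<^sup>2 + 2 * A2\<^sup>2 * A1\<^sup>2) * \<delta>\<^sup>2"
  proof -
    have "(fit t - inner (lam j) (F t))\<^sup>2 \<le> 2 * (A5 * \<delta>)\<^sup>2 * (?K * (\<Sum>a\<in>UNIV. (fh t $ a)\<^sup>2)) + 2 * A2\<^sup>2 * (e t)\<^sup>2"
      if t: "t \<in> {1..T}" for t
    proof -
      have "(fit t - inner (lam j) (F t))\<^sup>2 = \<bar>fit t - inner (lam j) (F t)\<bar>\<^sup>2" by simp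
      also have "\<dots> \<le> ((\<Sum>a\<in>UNIV. \<bar>fh t $ a\<bar>) * (A5 * \<delta>) + A2 * e t)\<^sup>2"
        by (intro power_mono err t) auto
      also have "\<dots> \<le> 2 * (((\<Sum>a\<in>UNIV. \<bar>fh t $ a\<bar>) * (A5 * \<delta>))\<^sup>2 + (A2 * e t)\<^sup>2)"
        by (rule square_sum2_le)
      also have "\<dots> = 2 * (A5 * \<delta>)\<^sup>2 * (\<Sum>a\<in>UNIV. \<bar>fh t $ a\<bar>)\<^sup>2 + 2 * A2\<^sup>2 * (e t)\<^sup>2"
        by (simp add: power_mult_distrib algebra_simps)
      also have "(\<Sum>a\<in>UNIV. \<bar>fh t $ a\<bar>)\<^sup>2 \<le> ?K * (\<Sum>a\<in>UNIV. (fh t $ a)\<^sup>2)"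
        using sum_squared_le_sum_of_squares[of "\<lambda>a. \<bar>fh t $ a\<bar>" UNIV] by (simp add: mult.commute)
      finally show ?thesis by (simp add: mult_left_mono)
    qed
    then have "(\<Sum>t=1..T. (fit t - inner (lam j) (F t))\<^sup>2)
        \<le> (\<Sum>t=1..T. 2 * (A5 * \<delta>)\<^sup>2 * (?K * (\<Sum>a\<in>UNIV. (fh t $ a)\<^sup>2)) + 2 * A2\<^sup>2 * (e t)\<^sup>2)"
      by (intro sum_mono)
    also have "\<dots> = 2 * (A5 * \<delta>)\<^sup>2 * (?K * (\<Sum>t=1..T. \<Sum>a\<in>UNIV. (fh t $ a)\<^sup>2)) + 2 * A2\<^sup>2 * (\<Sum>t=1..T. (e t)\<^sup>2)"
      by (simp only: sum.distrib sum_distrib_left)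
    \<comment> \<open>No bound on \<open>fh\<close> at individual times is at hand uniformly in t;
      the normalization gives the total of the squares exactly.\<close>
    also have "(\<Sum>t=1..T. \<Sum>a\<in>UNIV. (fh t $ a)\<^sup>2) = ?K * real T"
      by (subst sum.swap) (simp only: fh_square_sum sum_constant)
    finally have "(1 / real T) * (\<Sum>t=1..T. (fit t - inner (lam j) (F t))\<^sup>2)
       \<le> (1 / real T) * (2 * (A5 * \<delta>)\<^sup>2 * (?K * (?K * real T)) + 2 * A2\<^sup>2 * (\<Sum>t=1..T. (e t)\<^sup>2))"
      by (rule mult_left_mono) simp
    also have "\<dots> = 2 * (A5 * \<delta>)\<^sup>2 * ?K\<^sup>2 + 2 * A2\<^sup>2 * ((1 / real T) * (\<Sum>t=1..T. (e t)\<^sup>2))"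
      using Tpos by (simp add: field_simps power2_eq_square)
    also have "\<dots> \<le> 2 * (A5 * \<delta>)\<^sup>2 * ?K\<^sup>2 + 2 * A2\<^sup>2 * (A1\<^sup>2 * \<delta>\<^sup>2)"
      using ee2 by (intro add_left_mono mult_left_mono) auto
    finally show ?thesis by (simp add: power_mult_distrib algebra_simps)
  qed
  assume t: "t \<in> {1..T}" and Ft: "(norm (F t))\<^sup>2 \<le> C"
    and Lt: "(norm (\<Sum>i=1..N. u i t *\<^sub>R lam i))\<^sup>2 \<le> C * real N"
    and Pt: "(\<Sum>s=1..T. (\<Sum>i=1..N. u i t * u i s)\<^sup>2) \<le> C * ((real N)\<^sup>2 + real N * real T)"
  have Ft': "norm (F t) \<le> sqrt C" using real_le_rsqrt[OF Ft] .
  have et: "e t \<le> A6 * \<delta>"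
  proof -
    have "norm (F t) * sqrt (\<Sum>s=1..T. (norm (L s))\<^sup>2) + norm (L t) * sqrt (\<Sum>s=1..T. (norm (F s))\<^sup>2)
        + sqrt (\<Sum>s=1..T. (psi t s)\<^sup>2)
      \<le> sqrt C * sqrt (C * real N * real T) + sqrt (C * real N) * sqrt (C * real T)
        + sqrt (C * ((real N)\<^sup>2 + real N * real T))"
      using Ft' SF SL Pt real_le_rsqrt[OF Lt] C SF0 SL0
      by (intro add_mono mult_mono) (auto simp: L_def psi_def)
    \<comment> \<open>The last root uses that \<open>N^2 + N T\<close> equals \<open>N^2 T\<close>
      times the square of \<open>\<delta>\<close>. Below, \<open>sqrt N\<close> is written as
      \<open>N / sqrt N\<close> so that the cross terms also show a factor at most
      \<open>\<delta>\<close>.\<close>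
    also have "\<dots> = 2 * C * (sqrt (real N) * sqrt (real T)) + sqrt C * sqrt ((real N)\<^sup>2 * real T * (1 / real N + 1 / real T))"
    proof -
      have "(real N)\<^sup>2 + real N * real T = (real N)\<^sup>2 * real T * (1 / real N + 1 / real T)"
        using Npos Tpos by (simp add: field_simps power2_eq_square)
      then have "sqrt (C * ((real N)\<^sup>2 + real N * real T)) = sqrt C * sqrt ((real N)\<^sup>2 * real T * (1 / real N + 1 / real T))"
        by (simp only: real_sqrt_mult[of C])
      moreover have "sqrt C * sqrt (C * real N * real T) = (sqrt C * sqrt C) * (sqrt (real N) * sqrt (real T))"
        "sqrt (C * real N) * sqrt (C * real T) = (sqrt C * sqrt C) * (sqrt (real N) * sqrt (real T))"
        by (simp_all only: real_sqrt_mult mult_ac)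
      ultimately show ?thesis using C by simp
    qed
    also have "sqrt ((real N)\<^sup>2 * real T * (1 / real N + 1 / real T)) = real N * sqrt (real T) * \<delta>"
      by (simp add: \<delta>_def real_sqrt_mult)
    also have "2 * C * (sqrt (real N) * sqrt (real T)) = 2 * C * (real N * sqrt (real T) * (1 / sqrt (real N)))"
    proof -
      have "real N * sqrt (real T) * (1 / sqrt (real N)) = (real N / sqrt (real N)) * sqrt (real T)" by simp
      also have "real N / sqrt (real N) = sqrt (real N)" by (rule real_div_sqrt) simp
      finally show ?thesis by (simp only:)
    qed
    also have "\<dots> \<le> 2 * C * (real N * sqrt (real T) * \<delta>)"
      using C dN by (intro mult_left_mono) auto
    finally have "norm (F t) * sqrt (\<Sum>s=1..T. (norm (L s))\<^sup>2) + norm (L t) * sqrt (\<Sum>s=1..T. (norm (F s))\<^sup>2)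
        + sqrt (\<Sum>s=1..T. (psi t s)\<^sup>2) \<le> (2 * C + sqrt C) * \<delta> * (real N * sqrt (real T))"
      by (simp add: algebra_simps)
    then have "e t \<le> (2 * C + sqrt C) * \<delta> * (real N * sqrt (real T)) / (c * real N * sqrt (real T))"
      unfolding e_def using c by (intro divide_right_mono) auto
    also have "\<dots> = A6 * \<delta>"
      using Npos Tpos c by (simp add: A6_def)
    finally show ?thesis .
  qed
  \<comment> \<open>At a single time the normalization says too little, so \<open>fh\<close> is
    bounded through \<open>F H + E\<close>. Here \<open>E\<close> needs only to be bounded, and the
    crude estimate \<open>\<delta> \<le> 2\<close> suffices.\<close>
  have "\<bar>fh t $ a\<bar> \<le> sqrt C * A3 + 2 * A6" for a
  proof -
    have "\<bar>fh t $ a\<bar> \<le> \<bar>inner (F t) (H a)\<bar> + \<bar>E t a\<bar>" by (simp add: E_def)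
    also have "\<bar>inner (F t) (H a)\<bar> \<le> sqrt C * A3"
      by (intro order_trans[OF Cauchy_Schwarz_ineq2] mult_mono Ft' Hb) (use C in auto)
    also have "\<bar>E t a\<bar> \<le> A6 * 2"
      using abs_E_le[OF t, of a] et mult_left_mono[OF d_le2 A(4)] by linarith
    finally show ?thesis by simp
  qed
  then have "(\<Sum>a\<in>UNIV. \<bar>fh t $ a\<bar>) \<le> (\<Sum>a\<in>(UNIV::'k set). sqrt C * A3 + 2 * A6)"
    by (intro sum_mono)
  then have "(\<Sum>a\<in>UNIV. \<bar>fh t $ a\<bar>) * (A5 * \<delta>) \<le> (?K * (sqrt C * A3 + 2 * A6)) * (A5 * \<delta>)"
    using A d0 by (intro mult_right_mono) auto
  moreover have "A2 * e t \<le> A2 * (A6 * \<delta>)" using et A by (intro mult_left_mono) auto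
  ultimately have "\<bar>fit t - inner (lam j) (F t)\<bar> \<le> (?K * (sqrt C * A3 + 2 * A6)) * (A5 * \<delta>) + A2 * (A6 * \<delta>)"
    using err[OF t] by linarith
  then show "\<bar>fit t - inner (lam j) (F t)\<bar> \<le> (?K * (sqrt C * A3 + 2 * A6) * A5 + A2 * A6) * \<delta>"
    by (simp add: algebra_simps)
qed

end

text \<open>For \<open>x = F z\<close> one has \<open>Y' x = \<Lambda> p + w\<close> with
  \<open>p = F' x\<close> and \<open>w = U' x\<close>. The signal contributes at least
  \<open>a b N T\<close> times the squared length of \<open>x\<close>, and the hypothesis on
  \<open>U U'\<close> keeps the squared length of \<open>w\<close> below a quarter of this. The
  quarter is chosen so that the inequality between \<open>\<Lambda> p\<close> and
  \<open>\<Lambda> p + w\<close>, which costs a factor 2, still leaves a quarter of the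
  signal.\<close>

lemma factor_model_quadratic_lower_bound:
  fixes F lam :: "nat \<Rightarrow> 'b::real_inner" and u :: "nat \<Rightarrow> nat \<Rightarrow> real"
  assumes a: "a > 0" and b: "b > 0"
    and lam: "\<And>z. a * real N * (norm z)\<^sup>2 \<le> (\<Sum>i=1..N. (inner (lam i) z)\<^sup>2)"
    and F: "\<And>z. b * real T * (norm z)\<^sup>2 \<le> (\<Sum>t=1..T. (inner (F t) z)\<^sup>2)"
    and U: "(\<Sum>t=1..T. \<Sum>s=1..T. (\<Sum>i=1..N. u i t * u i s)\<^sup>2) \<le> (a * b / 4 * real N * real T)\<^sup>2"
  shows "(a * b / 4 * real N * real T) * (\<Sum>t=1..T. (inner (F t) z)\<^sup>2)
    \<le> (\<Sum>i=1..N. (\<Sum>t=1..T. (inner (lam i) (F t) + u i t) * inner (F t) z)\<^sup>2)"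
proof -
  define x where "x t = inner (F t) z" for t
  define p where "p = (\<Sum>t=1..T. x t *\<^sub>R F t)"
  define X where "X = (\<Sum>t=1..T. (x t)\<^sup>2)"
  define \<kappa> where "\<kappa> = a * b / 4 * real N * real T"
  have \<kappa>: "\<kappa> \<ge> 0" using a b by (simp add: \<kappa>_def)
  have X0: "X \<ge> 0" by (simp add: X_def sum_nonneg)
  have pz: "inner p z = X" by (simp add: p_def X_def x_def inner_sum_left power2_eq_square)
  \<comment> \<open>As \<open>inner p z = X\<close>, Cauchy-Schwarz bounds \<open>p\<close> from
    below by \<open>X\<close> over the length of \<open>z\<close>, and the lower bound
    \<open>F\<close> on \<open>X\<close> converts one factor \<open>X\<close> into the length of
    \<open>z\<close>.\<close>
  have p: "b * real T * X \<le> (norm p)\<^sup>2"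
  proof (cases "z = 0")
    case True
    then show ?thesis by (simp add: X_def x_def)
  next
    case False
    have "(b * real T * X) * (norm z)\<^sup>2 = (b * real T * (norm z)\<^sup>2) * X" by (simp add: mult_ac)
    also have "\<dots> \<le> X * X"
      using F[of z] X0 by (intro mult_right_mono) (simp_all add: X_def x_def)
    also have "\<dots> = \<bar>inner p z\<bar>\<^sup>2" by (simp add: pz power2_eq_square)
    also have "\<dots> \<le> (norm p * norm z)\<^sup>2" by (intro power_mono Cauchy_Schwarz_ineq2) simp
    also have "\<dots> = (norm p)\<^sup>2 * (norm z)\<^sup>2" by (simp add: power_mult_distrib)
    finally show ?thesis using False by simp
  qed
  define w where "w i = (\<Sum>t=1..T. u i t * x t)" for i
  have "(\<Sum>i=1..N. (w i)\<^sup>2) = (\<Sum>i=1..N. \<Sum>t=1..T. \<Sum>s=1..T. (x t * x s) * (u i t * u i s))"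
    by (simp add: w_def power2_eq_square sum_product mult_ac)
  also have "\<dots> = (\<Sum>t=1..T. \<Sum>s=1..T. (x t * x s) * (\<Sum>i=1..N. u i t * u i s))"
    unfolding sum_distrib_left
    by (subst sum.swap, intro sum.cong[OF refl], subst sum.swap, rule refl)
  \<comment> \<open>Taking pairs of times as one index allows Cauchy-Schwarz in the Frobenius inner
    product: the matrix of the products \<open>x t * x s\<close> has Frobenius norm
    \<open>X\<close>.\<close>
  also have "\<dots> = (\<Sum>q\<in>{1..T}\<times>{1..T}. (x (fst q) * x (snd q)) * (\<Sum>i=1..N. u i (fst q) * u i (snd q)))"
    by (simp add: sum.cartesian_product case_prod_beta)
  also have "\<dots> \<le> sqrt (\<Sum>q\<in>{1..T}\<times>{1..T}. (x (fst q) * x (snd q))\<^sup>2)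
      * sqrt (\<Sum>q\<in>{1..T}\<times>{1..T}. (\<Sum>i=1..N. u i (fst q) * u i (snd q))\<^sup>2)"
    using norm_sum_scaleR_le_sqrt[of "\<lambda>q. x (fst q) * x (snd q)" "\<lambda>q. \<Sum>i=1..N. u i (fst q) * u i (snd q)" "{1..T}\<times>{1..T}"]
    by simp
  also have "(\<Sum>q\<in>{1..T}\<times>{1..T}. (x (fst q) * x (snd q))\<^sup>2) = X\<^sup>2"
    by (simp add: X_def power2_eq_square[of "sum _ _"] sum_product sum.cartesian_product case_prod_beta power_mult_distrib)
  also have "(\<Sum>q\<in>{1..T}\<times>{1..T}. (\<Sum>i=1..N. u i (fst q) * u i (snd q))\<^sup>2)
      = (\<Sum>t=1..T. \<Sum>s=1..T. (\<Sum>i=1..N. u i t * u i s)\<^sup>2)"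
    by (simp add: sum.cartesian_product case_prod_beta)
  also have "sqrt (X\<^sup>2) * sqrt \<dots> \<le> X * \<kappa>"
    using U X0 \<kappa> by (intro mult_mono real_le_lsqrt) (auto simp: \<kappa>_def sum_nonneg)
  finally have w: "(\<Sum>i=1..N. (w i)\<^sup>2) \<le> \<kappa> * X" by (simp add: mult.commute)
  have "4 * \<kappa> * X = a * real N * (b * real T * X)" by (simp add: \<kappa>_def)
  also have "\<dots> \<le> a * real N * (norm p)\<^sup>2" using p a by (intro mult_left_mono) auto
  also have "\<dots> \<le> (\<Sum>i=1..N. (inner (lam i) p)\<^sup>2)" by (rule lam)
  \<comment> \<open>Adding and subtracting \<open>w i\<close> gives
    \<open>4 \<kappa> X \<le> 2 S + 2 \<kappa> X\<close> for the sum S of the squares with noise,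
    hence \<open>\<kappa> X \<le> S\<close>.\<close>
  also have "\<dots> \<le> (\<Sum>i=1..N. 2 * ((inner (lam i) p + w i)\<^sup>2 + (w i)\<^sup>2))"
  proof (intro sum_mono)
    fix i
    show "(inner (lam i) p)\<^sup>2 \<le> 2 * ((inner (lam i) p + w i)\<^sup>2 + (w i)\<^sup>2)"
      using square_sum2_le[of "inner (lam i) p + w i" "- w i"] by simp
  qed
  also have "\<dots> = 2 * (\<Sum>i=1..N. (inner (lam i) p + w i)\<^sup>2) + 2 * (\<Sum>i=1..N. (w i)\<^sup>2)"
    by (simp add: sum.distrib sum_distrib_left)
  finally have "\<kappa> * X \<le> (\<Sum>i=1..N. (inner (lam i) p + w i)\<^sup>2)" using w by linarith
  also have "\<dots> = (\<Sum>i=1..N. (\<Sum>t=1..T. (inner (lam i) (F t) + u i t) * inner (F t) z)\<^sup>2)"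
    unfolding p_def w_def x_def inner_sum_right inner_scaleR_right distrib_right sum.distrib
    by (simp add: mult.commute)
  finally show ?thesis by (simp add: \<kappa>_def X_def x_def)
qed

text \<open>The test space for the eigenvalue bound is spanned by the columns of the true factor
  matrix, so that only the signal and \<open>U U'\<close> have to be known there. The rest
  translates between matrices of varying size, indexed from 0, and vectors over the fixed type of
  factors.\<close>

lemma pc_factor_sample:
  fixes F lam :: "nat \<Rightarrow> real^'k"
  assumes pc: "pc_factors (data_mat Y N T) CARD('k) Fh"
    and N: "N \<ge> 1" and KT: "CARD('k) \<le> T"
    and model: "\<And>j t. j \<in> {1..N} \<Longrightarrow> t \<in> {1..T} \<Longrightarrow> Y j t = inner (lam j) (F t) + u j t"
    and a: "a > 0" and b: "b > 0"
    and lam: "\<And>z. a * real N * (norm z)\<^sup>2 \<le> (\<Sum>i=1..N. (inner (lam i) z)\<^sup>2)"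
    and F: "\<And>z. b * real T * (norm z)\<^sup>2 \<le> (\<Sum>t=1..T. (inner (F t) z)\<^sup>2)"
    and U: "(\<Sum>t=1..T. \<Sum>s=1..T. (\<Sum>i=1..N. u i t * u i s)\<^sup>2) \<le> (a * b / 4 * real N * real T)\<^sup>2"
  obtains fh v where "factor_sample N T F fh lam u v (a * b / 4)"
    and "\<And>t. t \<in> {1..T} \<Longrightarrow> pc_fit (data_mat Y N T) Fh t =
      (\<Sum>a\<in>UNIV. fh t $ a * ((1 / real T) * (\<Sum>s=1..T. fh s $ a * (inner (lam 1) (F s) + u 1 s))))"
proof -
  have T: "T > 0" using KT by (meson less_le_trans zero_less_card_finite)
  have carrier: "data_mat Y N T \<in> carrier_mat T N" by (simp add: data_mat_def)
  have entry: "data_mat Y N T $$ (t, j) = inner (lam (Suc j)) (F (Suc t)) + u (Suc j) (Suc t)"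
    if "t < T" "j < N" for t j
    using that model[of "Suc j" "Suc t"] by (simp add: data_mat_def)
  have shift: "(\<Sum>t<n. g (Suc t)) = (\<Sum>t=1..n. g t)" for n and g :: "nat \<Rightarrow> real"
    by (simp add: sum.atLeast1_atMost_eq)
  have low: "a * b / 4 * real N * real T * (\<Sum>t<T. (inner (F (Suc t)) z)\<^sup>2)
        \<le> (\<Sum>j<N. (\<Sum>t<T. data_mat Y N T $$ (t, j) * inner (F (Suc t)) z)\<^sup>2)" for z :: "real^'k"
  proof -
    have "(\<Sum>j<N. (\<Sum>t<T. data_mat Y N T $$ (t, j) * inner (F (Suc t)) z)\<^sup>2)
        = (\<Sum>j<N. (\<Sum>t<T. (inner (lam (Suc j)) (F (Suc t)) + u (Suc j) (Suc t)) * inner (F (Suc t)) z)\<^sup>2)"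
      by (simp add: entry)
    also have "\<dots> = (\<Sum>i=1..N. (\<Sum>t=1..T. (inner (lam i) (F t) + u i t) * inner (F t) z)\<^sup>2)"
      by (simp only: shift[of "\<lambda>t. (inner (lam _) (F t) + u _ t) * inner (F t) z"]
        shift[of "\<lambda>i. (\<Sum>t=1..T. (inner (lam i) (F t) + u i t) * inner (F t) z)\<^sup>2"])
    finally show ?thesis
      using factor_model_quadratic_lower_bound[OF a b lam F U, of z]
      by (simp only: shift[of "\<lambda>t. (inner (F t) z)\<^sup>2"])
  qed
  have pos: "0 < (\<Sum>t<T. (inner (F (Suc t)) z)\<^sup>2)" if z: "z \<noteq> 0" for z :: "real^'k"
  proof -
    have "0 < b * real T * (norm z)\<^sup>2" using b T z by simp
    also note F[of z]
    finally show ?thesis by (simp only: shift[of "\<lambda>t. (inner (F t) z)\<^sup>2"])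
  qed
  obtain d where d: "\<And>l. l < CARD('k) \<Longrightarrow> a * b / 4 * real N * real T \<le> d l"
    and eig: "\<And>l t. l < CARD('k) \<Longrightarrow> t < T \<Longrightarrow> d l * Fh $$ (t, l) =
      (\<Sum>s<T. \<Sum>j<N. data_mat Y N T $$ (t, j) * data_mat Y N T $$ (s, j) * Fh $$ (s, l))"
    and orth: "\<And>l m. l < CARD('k) \<Longrightarrow> m < CARD('k) \<Longrightarrow>
      (\<Sum>t<T. Fh $$ (t, l) * Fh $$ (t, m)) = (if l = m then real T else 0)"
    using pc_factors_eigenvalue_ge[OF carrier pc KT low pos] by blast
  \<comment> \<open>Columns of \<open>Fh\<close> are numbered while components over
    \<open>'k\<close> carry no order. Any bijection will do, because the fitted value is a sum over
    all columns.\<close>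
  obtain \<beta> :: "'k \<Rightarrow> nat" where \<beta>: "bij_betw \<beta> UNIV {..<CARD('k)}"
    using ex_bij_betw_finite_nat[of "UNIV :: 'k set"] by (auto simp: lessThan_atLeast0)
  have \<beta>K: "\<beta> i < CARD('k)" for i using \<beta> by (auto simp: bij_betw_def)
  have \<beta>i: "\<beta> i = \<beta> j \<longleftrightarrow> i = j" for i j using \<beta> by (auto simp: bij_betw_def inj_on_def)
  \<comment> \<open>Time t sits in row \<open>t - 1\<close>.\<close>
  define fh where "fh t = (\<chi> i. Fh $$ (t - 1, \<beta> i))" for t
  define v where "v = (\<chi> i. d (\<beta> i) / (real N * real T))"
  have "factor_sample N T F fh lam u v (a * b / 4)"
  proof
    show "1 \<le> N" "1 \<le> T" "a * b / 4 > 0" using N T a b by simp_all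
    show "(\<Sum>t=1..T. fh t $ i * fh t $ j) = (if i = j then real T else 0)" for i j
      using orth[OF \<beta>K \<beta>K, of i j] unfolding shift[symmetric] by (simp add: fh_def \<beta>i)
    show "a * b / 4 \<le> v $ i" for i
      using d[OF \<beta>K, of i] N T by (simp add: v_def field_simps)
    fix t i assume t: "t \<in> {1..T}"
    have "real N * real T * v $ i * fh t $ i = d (\<beta> i) * Fh $$ (t - 1, \<beta> i)"
      using N T by (simp add: v_def fh_def)
    also have "\<dots> = (\<Sum>s<T. \<Sum>j<N. data_mat Y N T $$ (t - 1, j) * data_mat Y N T $$ (s, j) * Fh $$ (s, \<beta> i))"
      using t by (intro eig \<beta>K) auto
    also have "\<dots> = (\<Sum>s<T. \<Sum>j<N. (inner (lam (Suc j)) (F t) + u (Suc j) t) *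
        (inner (lam (Suc j)) (F (Suc s)) + u (Suc j) (Suc s)) * fh (Suc s) $ i)"
    proof -
      have "data_mat Y N T $$ (t - 1, j) = inner (lam (Suc j)) (F t) + u (Suc j) t" if "j < N" for j
      proof -
        have "t - 1 < T" "Suc (t - 1) = t" using t by auto
        then show ?thesis using entry[of "t - 1" j] that by simp
      qed
      then show ?thesis by (simp add: entry fh_def)
    qed
    also have "\<dots> = (\<Sum>s=1..T. \<Sum>j=1..N. (inner (lam j) (F t) + u j t) *
        (inner (lam j) (F s) + u j s) * fh s $ i)"
      by (simp only: shift[of "\<lambda>j. (inner (lam j) (F t) + u j t) * (inner (lam j) (F _) + u j _) * fh _ $ i"]
        shift[of "\<lambda>s. \<Sum>j=1..N. (inner (lam j) (F t) + u j t) * (inner (lam j) (F s) + u j s) * fh s $ i"])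
    finally show "real N * real T * v $ i * fh t $ i = (\<Sum>s=1..T. \<Sum>j=1..N. (inner (lam j) (F t) + u j t) *
        (inner (lam j) (F s) + u j s) * fh s $ i)" .
  qed
  moreover have "pc_fit (data_mat Y N T) Fh t =
      (\<Sum>a\<in>UNIV. fh t $ a * ((1 / real T) * (\<Sum>s=1..T. fh s $ a * (inner (lam 1) (F s) + u 1 s))))"
    if t: "t \<in> {1..T}" for t
  proof -
    have t1: "t - 1 < T" using t by auto
    have Fh: "Fh \<in> carrier_mat T CARD('k)"
      using pc carrier unfolding pc_factors_def Let_def by auto
    have "pc_fit (data_mat Y N T) Fh t = (\<Sum>l<CARD('k). ((1 / real T) * (\<Sum>s<T. data_mat Y N T $$ (s, 0) * Fh $$ (s, l))) * Fh $$ (t - 1, l))"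
      using Fh carrier N t1
      by (simp add: pc_fit_def pc_loadings_def scalar_prod_def lessThan_atLeast0)
    also have "\<dots> = (\<Sum>a\<in>UNIV. ((1 / real T) * (\<Sum>s<T. data_mat Y N T $$ (s, 0) * Fh $$ (s, \<beta> a))) * Fh $$ (t - 1, \<beta> a))"
      by (rule sum.reindex_bij_betw[OF \<beta>, symmetric])
    also have "\<dots> = (\<Sum>a\<in>UNIV. fh t $ a * ((1 / real T) * (\<Sum>s<T. fh (Suc s) $ a * (inner (lam 1) (F (Suc s)) + u 1 (Suc s)))))"
      using N by (simp add: fh_def entry mult_ac)
    finally show ?thesis by (simp only: shift[of "\<lambda>s. fh s $ _ * (inner (lam 1) (F s) + u 1 s)"])
  qed
  ultimately show ?thesis using that by blast
qed

section \<open>Moment bounds and stochastic rates\<close>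

lemma outer_mult_vec: "outer x y *v z = inner y z *\<^sub>R x"
  by (simp add: outer_def matrix_vector_mult_def inner_vec_def Finite_Cartesian_Product.vec_eq_iff
      sum_distrib_left mult_ac)

lemma continuous_on_outer: "continuous_on UNIV (\<lambda>x :: real^'k. outer x x)"
  unfolding outer_def by (intro continuous_intros)

lemma matrix_quadratic_form_le:
  fixes A :: "real^'k^'k"
  shows "\<bar>inner z (A *v z)\<bar> \<le> (real CARD('k))\<^sup>2 * norm A * (norm z)\<^sup>2"
proof -
  have "\<bar>inner z (A *v z)\<bar> = \<bar>\<Sum>i\<in>UNIV. \<Sum>j\<in>UNIV. z $ i * (A $ i $ j * z $ j)\<bar>"
    by (simp add: inner_vec_def matrix_vector_mult_def sum_distrib_left)
  also have "\<dots> \<le> (\<Sum>i\<in>(UNIV::'k set). \<Sum>j\<in>(UNIV::'k set). norm z * (norm A * norm z))"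
  proof (intro order_trans[OF sum_abs] sum_mono)
    fix i j
    have "\<bar>A $ i $ j\<bar> \<le> norm A"
      using Finite_Cartesian_Product.norm_nth_le[of "A $ i" j] Finite_Cartesian_Product.norm_nth_le[of A i] by simp
    then show "\<bar>z $ i * (A $ i $ j * z $ j)\<bar> \<le> norm z * (norm A * norm z)"
      unfolding abs_mult by (intro mult_mono) (auto simp: component_le_norm_cart)
  qed
  finally show ?thesis by (simp add: power2_eq_square mult_ac)
qed

text \<open>The quadratic form attains a positive minimum on the compact unit sphere; homogeneity
  carries it to all vectors.\<close>

lemma pos_def_lower_bound:
  fixes S :: "real^'k^'k"
  assumes "pos_def S"
  obtains b where "b > 0" "\<And>z. b * (norm z)\<^sup>2 \<le> inner z (S *v z)"
proof -
  have cont: "continuous_on (sphere 0 1) (\<lambda>z. inner z (S *v z))"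
    by (intro continuous_intros linear_continuous_on matrix_vector_mul_bounded_linear)
  obtain x :: "real^'k" where "norm x = 1" using vector_choose_size[of 1] by auto
  then have "sphere (0 :: real^'k) 1 \<noteq> {}" by auto
  from continuous_attains_inf[OF compact_sphere this cont]
  obtain m where m: "m \<in> sphere 0 1" "\<And>z. z \<in> sphere 0 1 \<Longrightarrow> inner m (S *v m) \<le> inner z (S *v z)" by blast
  have "m \<noteq> 0" using m(1) by auto
  then have "inner m (S *v m) > 0" using assms by (simp add: pos_def_def)
  moreover have "inner m (S *v m) * (norm z)\<^sup>2 \<le> inner z (S *v z)" for z
  proof (cases "z = 0")
    case False
    define w where "w = (1 / norm z) *\<^sub>R z"
    have w: "w \<in> sphere 0 1" "z = norm z *\<^sub>R w" using False by (simp_all add: w_def)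
    have "inner z (S *v z) = (norm z)\<^sup>2 * inner w (S *v w)"
      by (subst (1 2) w(2)) (simp add: matrix_vector_mult_scaleR power2_eq_square)
    also have "\<dots> \<ge> (norm z)\<^sup>2 * inner m (S *v m)"
      by (intro mult_left_mono m(2) w(1)) simp
    finally show ?thesis by (simp only: mult.commute)
  qed simp
  ultimately show ?thesis using that by blast
qed

text \<open>Half of the lower bound for \<open>S\<close> survives a perturbation of size
  \<open>\<eta>\<close>, with \<open>\<eta>\<close> chosen to compensate the square of the dimension
  in \<open>matrix_quadratic_form_le\<close>. Neither constant depends on \<open>n\<close> or
  \<open>f\<close>, so the lemma serves both the deterministic loadings and the random factors at a
  fixed sample point.\<close>

lemma pos_def_gram_lower_bound:
  fixes S :: "real^'k^'k"
  assumes "pos_def S"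
  obtains a \<eta> where "a > 0" "\<eta> > 0"
    "\<And>n f z. n \<ge> 1 \<Longrightarrow> dist ((1 / real n) *\<^sub>R (\<Sum>i=1..n. outer (f i) (f i))) S \<le> \<eta> \<Longrightarrow>
      a * real n * (norm z)\<^sup>2 \<le> (\<Sum>i=1..n. (inner (f i) z)\<^sup>2)"
proof -
  obtain b where b: "b > 0" "\<And>z. b * (norm z)\<^sup>2 \<le> inner z (S *v z)"
    using pos_def_lower_bound[OF assms] by blast
  let ?K = "(real CARD('k))\<^sup>2"
  define \<eta> where "\<eta> = b / (2 * ?K)"
  have K: "?K > 0" by simp
  have "(b / 2) * real n * (norm z)\<^sup>2 \<le> (\<Sum>i=1..n. (inner (f i) z)\<^sup>2)"
    if n: "n \<ge> 1" and d: "dist ((1 / real n) *\<^sub>R (\<Sum>i=1..n. outer (f i) (f i))) S \<le> \<eta>" for n f z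
  proof -
    define A where "A = (1 / real n) *\<^sub>R (\<Sum>i=1..n. outer (f i) (f i))"
    have sum_mv: "(\<Sum>i\<in>I. X i) *v z = (\<Sum>i\<in>I. X i *v z)" for I and X :: "nat \<Rightarrow> real^'k^'k"
      by (induction I rule: infinite_finite_induct) (simp_all add: matrix_vector_mult_add_rdistrib)
    have "inner z (A *v z) = (1 / real n) * (\<Sum>i=1..n. (inner (f i) z)\<^sup>2)"
      by (simp add: A_def scaleR_matrix_vector_assoc[symmetric] sum_mv outer_mult_vec inner_sum_right
          power2_eq_square inner_commute)
    moreover have "inner z (S *v z) - b / 2 * (norm z)\<^sup>2 \<le> inner z (A *v z)"
    proof -
      have eq: "?K * \<eta> = b / 2" by (simp add: \<eta>_def)
      have "\<bar>inner z ((A - S) *v z)\<bar> \<le> ?K * \<eta> * (norm z)\<^sup>2"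
        using d by (intro order_trans[OF matrix_quadratic_form_le] mult_right_mono mult_left_mono)
          (auto simp: A_def dist_norm)
      then show ?thesis
        unfolding eq matrix_vector_mult_diff_rdistrib inner_diff_right by linarith
    qed
    ultimately have "b / 2 * (norm z)\<^sup>2 \<le> (1 / real n) * (\<Sum>i=1..n. (inner (f i) z)\<^sup>2)"
      using b(2)[of z] by (simp add: field_simps)
    then show ?thesis using n by (simp add: field_simps)
  qed
  moreover have "\<eta> > 0" using b K by (simp add: \<eta>_def)
  ultimately show ?thesis using that[of "b / 2" \<eta>] b(1) by simp
qed

section \<open>Integrability, moment comparison and tail bounds\<close>

lemma add_power_le:
  fixes a b :: real
  assumes "a \<ge> 0" "b \<ge> 0"
  shows "(a + b) ^ p \<le> 2 ^ p * (a ^ p + b ^ p)"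
proof -
  have "(a + b) ^ p \<le> (2 * max a b) ^ p" using assms by (intro power_mono) auto
  also have "\<dots> = 2 ^ p * (max a b) ^ p" by (simp add: power_mult_distrib)
  also have "\<dots> \<le> 2 ^ p * (a ^ p + b ^ p)"
    using assms by (intro mult_left_mono) (auto simp: max_def)
  finally show ?thesis .
qed

text \<open>A bound on a Bochner integral says nothing about a function that is not integrable,
  because its integral is 0 by convention. Integrability of powers of sums is therefore derived from
  the summands before moment bounds on such sums are applied.\<close>

lemma (in finite_measure) integrable_norm_power_sum:
  fixes X :: "'i \<Rightarrow> 'a \<Rightarrow> 'b::{second_countable_topology, real_normed_vector}"
  assumes "finite I" "\<And>i. i \<in> I \<Longrightarrow> X i \<in> borel_measurable M"
    "\<And>i. i \<in> I \<Longrightarrow> integrable M (\<lambda>\<omega>. norm (X i \<omega>) ^ p)"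
  shows "integrable M (\<lambda>\<omega>. norm (\<Sum>i\<in>I. X i \<omega>) ^ p)"
  using assms
proof (induction I rule: finite_induct)
  case (insert i I)
  have [measurable]: "X i \<in> borel_measurable M" "(\<lambda>\<omega>. \<Sum>i\<in>I. X i \<omega>) \<in> borel_measurable M"
    using insert.prems by auto
  show ?case
  proof (rule Bochner_Integration.integrable_bound)
    show "integrable M (\<lambda>\<omega>. 2 ^ p * (norm (X i \<omega>) ^ p + norm (\<Sum>i\<in>I. X i \<omega>) ^ p))"
      using insert by (intro integrable_mult_right Bochner_Integration.integrable_add) auto
    show "AE \<omega> in M. norm (norm (\<Sum>i\<in>insert i I. X i \<omega>) ^ p)
        \<le> norm (2 ^ p * (norm (X i \<omega>) ^ p + norm (\<Sum>i\<in>I. X i \<omega>) ^ p))"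
    proof (intro AE_I2)
      fix \<omega>
      have "norm (\<Sum>i\<in>insert i I. X i \<omega>) ^ p \<le> (norm (X i \<omega>) + norm (\<Sum>i\<in>I. X i \<omega>)) ^ p"
        using insert.hyps by (intro power_mono) (auto intro: norm_triangle_ineq)
      also have "\<dots> \<le> 2 ^ p * (norm (X i \<omega>) ^ p + norm (\<Sum>i\<in>I. X i \<omega>) ^ p)"
        by (rule add_power_le) auto
      finally show "norm (norm (\<Sum>i\<in>insert i I. X i \<omega>) ^ p)
        \<le> norm (2 ^ p * (norm (X i \<omega>) ^ p + norm (\<Sum>i\<in>I. X i \<omega>) ^ p))" by simp
    qed
    show "(\<lambda>\<omega>. norm (\<Sum>i\<in>insert i I. X i \<omega>) ^ p) \<in> borel_measurable M"
      using insert.hyps by simp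
  qed
qed simp

context prob_space
begin

text \<open>For nonnegative x, \<open>x^p \<le> 1 + x^q\<close>: either x is at most 1 or the powers
  increase. This is the origin of the many bounds \<open>1 + D0\<close>.\<close>

lemma moment_le:
  fixes X :: "'a \<Rightarrow> real"
  assumes [measurable]: "X \<in> borel_measurable M" and pos: "\<And>\<omega>. X \<omega> \<ge> 0"
    and int: "integrable M (\<lambda>\<omega>. X \<omega> ^ q)" and pq: "p \<le> q"
  shows integrable_lower_moment: "integrable M (\<lambda>\<omega>. X \<omega> ^ p)"
    and lower_moment_le: "expectation (\<lambda>\<omega>. X \<omega> ^ p) \<le> 1 + expectation (\<lambda>\<omega>. X \<omega> ^ q)"
proof -
  have le: "X \<omega> ^ p \<le> 1 + X \<omega> ^ q" for \<omega>
  proof (cases "X \<omega> \<le> 1")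
    case True
    then show ?thesis using power_le_one[of "X \<omega>" p] zero_le_power[OF pos, of \<omega> q] pos[of \<omega>] by linarith
  next
    case False
    then show ?thesis using power_increasing[OF pq, of "X \<omega>"] by linarith
  qed
  show 1: "integrable M (\<lambda>\<omega>. X \<omega> ^ p)"
    by (rule Bochner_Integration.integrable_bound[of _ "\<lambda>\<omega>. 1 + X \<omega> ^ q"])
      (use int le pos in \<open>auto simp: abs_of_nonneg\<close>)
  have "expectation (\<lambda>\<omega>. X \<omega> ^ p) \<le> expectation (\<lambda>\<omega>. 1 + X \<omega> ^ q)"
    using 1 int le by (intro integral_mono) auto
  also have "\<dots> = 1 + expectation (\<lambda>\<omega>. X \<omega> ^ q)"
    using int by (simp add: prob_space)
  finally show "expectation (\<lambda>\<omega>. X \<omega> ^ p) \<le> 1 + expectation (\<lambda>\<omega>. X \<omega> ^ q)" .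
qed

lemma integrable_mult_of_squares:
  fixes X Y :: "'a \<Rightarrow> real"
  assumes [measurable]: "X \<in> borel_measurable M" "Y \<in> borel_measurable M"
    and int: "integrable M (\<lambda>\<omega>. X \<omega> ^ 2)" "integrable M (\<lambda>\<omega>. Y \<omega> ^ 2)"
  shows "integrable M (\<lambda>\<omega>. X \<omega> * Y \<omega>)"
proof (rule Bochner_Integration.integrable_bound[of _ "\<lambda>\<omega>. X \<omega> ^ 2 + Y \<omega> ^ 2"])
  have "\<bar>x * y\<bar> \<le> x\<^sup>2 + y\<^sup>2" for x y :: real
  proof -
    have "2 * (\<bar>x\<bar> * \<bar>y\<bar>) \<le> x\<^sup>2 + y\<^sup>2" using sum_squares_bound[of "\<bar>x\<bar>" "\<bar>y\<bar>"] by simp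
    moreover have "0 \<le> \<bar>x\<bar> * \<bar>y\<bar>" by simp
    ultimately show ?thesis unfolding abs_mult by linarith
  qed
  then show "AE \<omega> in M. norm (X \<omega> * Y \<omega>) \<le> norm (X \<omega> ^ 2 + Y \<omega> ^ 2)" by simp
qed (use int in auto)

lemma prob_exceeds_le:
  fixes X :: "'a \<Rightarrow> real"
  assumes "integrable M X" "\<And>\<omega>. X \<omega> \<ge> 0" "expectation X \<le> m" "C > 0"
  shows "prob {\<omega> \<in> space M. X \<omega> > C} \<le> m / C"
proof -
  have [measurable]: "X \<in> borel_measurable M" using assms(1) by auto
  have "prob {\<omega> \<in> space M. X \<omega> > C} \<le> prob {\<omega> \<in> space M. X \<omega> \<ge> C}"
    by (intro finite_measure_mono) auto
  also have "\<dots> \<le> expectation X / C"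
    using assms by (intro integral_Markov_inequality_measure[of _ _ "space M"]) auto
  also have "\<dots> \<le> m / C" using assms by (intro divide_right_mono) auto
  finally show ?thesis .
qed

lemma prob_any_exceeds_le:
  fixes \<X> :: "('a \<Rightarrow> real) set"
  assumes fin: "finite \<X>"
    and int: "\<And>X. X \<in> \<X> \<Longrightarrow> integrable M X" and pos: "\<And>X \<omega>. X \<in> \<X> \<Longrightarrow> X \<omega> \<ge> 0"
    and m: "\<And>X. X \<in> \<X> \<Longrightarrow> expectation X \<le> m" and C: "C > 0"
  shows "{\<omega> \<in> space M. \<exists>X\<in>\<X>. X \<omega> > C} \<in> events"
    and "prob {\<omega> \<in> space M. \<exists>X\<in>\<X>. X \<omega> > C} \<le> real (card \<X>) * (m / C)"
proof -
  have eq: "{\<omega> \<in> space M. \<exists>X\<in>\<X>. X \<omega> > C} = (\<Union>X\<in>\<X>. {\<omega> \<in> space M. X \<omega> > C})" by auto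
  have meas: "{\<omega> \<in> space M. X \<omega> > C} \<in> events" if "X \<in> \<X>" for X
    using borel_measurable_integrable[OF int[OF that]] by measurable
  then show "{\<omega> \<in> space M. \<exists>X\<in>\<X>. X \<omega> > C} \<in> events"
    unfolding eq using fin by (intro sets.finite_UN) auto
  have "prob (\<Union>X\<in>\<X>. {\<omega> \<in> space M. X \<omega> > C}) \<le> (\<Sum>X\<in>\<X>. prob {\<omega> \<in> space M. X \<omega> > C})"
    using fin meas by (intro finite_measure_subadditive_finite) auto
  also have "\<dots> \<le> (\<Sum>X\<in>\<X>. m / C)"
    using int pos m C by (intro sum_mono prob_exceeds_le) auto
  finally show "prob {\<omega> \<in> space M. \<exists>X\<in>\<X>. X \<omega> > C} \<le> real (card \<X>) * (m / C)"
    unfolding eq by simp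
qed

end

section \<open>Moment bounds for the random terms of the model\<close>

locale factor_model = prob_space M for M :: "'a measure" +
  fixes F :: "nat \<Rightarrow> 'a \<Rightarrow> real^'k" and lam :: "nat \<Rightarrow> real^'k"
    and u :: "nat \<Rightarrow> nat \<Rightarrow> 'a \<Rightarrow> real" and D0 :: real
  assumes F_rv: "t \<ge> 1 \<Longrightarrow> F t \<in> borel_measurable M"
    and u_rv: "j \<ge> 1 \<Longrightarrow> t \<ge> 1 \<Longrightarrow> u j t \<in> borel_measurable M"
    and D0: "D0 > 0"
    and F_int: "t \<ge> 1 \<Longrightarrow> integrable M (\<lambda>\<omega>. norm (F t \<omega>) ^ 4)"
    and F_moment: "t \<ge> 1 \<Longrightarrow> expectation (\<lambda>\<omega>. norm (F t \<omega>) ^ 4) \<le> D0"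
    and lam_bound: "j \<ge> 1 \<Longrightarrow> norm (lam j) ^ 4 \<le> D0"
    and u_int: "j \<ge> 1 \<Longrightarrow> t \<ge> 1 \<Longrightarrow> integrable M (\<lambda>\<omega>. \<bar>u j t \<omega>\<bar> ^ 8)"
    and u_moment: "j \<ge> 1 \<Longrightarrow> t \<ge> 1 \<Longrightarrow> expectation (\<lambda>\<omega>. \<bar>u j t \<omega>\<bar> ^ 8) \<le> D0"
    and time_dependence: "N \<ge> 1 \<Longrightarrow> s \<in> {1..T} \<Longrightarrow>
      (1 / real N) * (\<Sum>t=1..T. \<bar>\<Sum>i=1..N. expectation (\<lambda>\<omega>. u i s \<omega> * u i t \<omega>)\<bar>) \<le> D0"
    and unit_dependence: "t \<ge> 1 \<Longrightarrow> i \<in> {1..N} \<Longrightarrow>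
      (\<Sum>j=1..N. \<bar>expectation (\<lambda>\<omega>. u i t \<omega> * u j t \<omega>)\<bar>) \<le> D0"
    and deviation_moment: "N \<ge> 1 \<Longrightarrow> s \<ge> 1 \<Longrightarrow> t \<ge> 1 \<Longrightarrow>
      expectation (\<lambda>\<omega>. \<bar>(1 / sqrt (real N)) * (\<Sum>i=1..N. u i s \<omega> * u i t \<omega>
        - expectation (\<lambda>\<eta>. u i s \<eta> * u i t \<eta>))\<bar> ^ 4) \<le> D0"
    and factor_error_moment: "T \<ge> 1 \<Longrightarrow>
      expectation (\<lambda>\<omega>. (norm ((1 / sqrt (real T)) *\<^sub>R (\<Sum>t=1..T. u 1 t \<omega> *\<^sub>R F t \<omega>)))\<^sup>2) \<le> D0"
begin

lemma u_power:
  assumes "j \<ge> 1" "t \<ge> 1" "p \<le> 8"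
  shows u_power_int: "integrable M (\<lambda>\<omega>. \<bar>u j t \<omega>\<bar> ^ p)"
    and u_power_moment: "expectation (\<lambda>\<omega>. \<bar>u j t \<omega>\<bar> ^ p) \<le> 1 + D0"
proof -
  have [measurable]: "u j t \<in> borel_measurable M" using u_rv assms by auto
  show "integrable M (\<lambda>\<omega>. \<bar>u j t \<omega>\<bar> ^ p)"
    by (rule integrable_lower_moment[OF _ _ u_int]) (use assms in auto)
  have "expectation (\<lambda>\<omega>. \<bar>u j t \<omega>\<bar> ^ p) \<le> 1 + expectation (\<lambda>\<omega>. \<bar>u j t \<omega>\<bar> ^ 8)"
    by (rule lower_moment_le[OF _ _ u_int]) (use assms in auto)
  then show "expectation (\<lambda>\<omega>. \<bar>u j t \<omega>\<bar> ^ p) \<le> 1 + D0"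
    using u_moment[OF assms(1,2)] by simp
qed

lemma F_square:
  assumes "t \<ge> 1"
  shows F_square_int: "integrable M (\<lambda>\<omega>. (norm (F t \<omega>))\<^sup>2)"
    and F_square_moment: "expectation (\<lambda>\<omega>. (norm (F t \<omega>))\<^sup>2) \<le> 1 + D0"
proof -
  have [measurable]: "F t \<in> borel_measurable M" using F_rv assms by auto
  show "integrable M (\<lambda>\<omega>. (norm (F t \<omega>))\<^sup>2)"
    by (rule integrable_lower_moment[OF _ _ F_int]) (use assms in auto)
  have "expectation (\<lambda>\<omega>. (norm (F t \<omega>))\<^sup>2) \<le> 1 + expectation (\<lambda>\<omega>. norm (F t \<omega>) ^ 4)"
    by (rule lower_moment_le[OF _ _ F_int]) (use assms in auto)
  then show "expectation (\<lambda>\<omega>. (norm (F t \<omega>))\<^sup>2) \<le> 1 + D0"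
    using F_moment[OF assms] by simp
qed

lemma norm_lam_le: "j \<ge> 1 \<Longrightarrow> norm (lam j) \<le> 1 + D0"
proof -
  assume j: "j \<ge> 1"
  show ?thesis
  proof (cases "norm (lam j) \<le> 1")
    case False
    then have "norm (lam j) ^ 1 \<le> norm (lam j) ^ 4" by (intro power_increasing) auto
    then show ?thesis using lam_bound[OF j] by simp
  qed (use D0 in auto)
qed

lemma uu_int:
  assumes "i \<ge> 1" "j \<ge> 1" "s \<ge> 1" "t \<ge> 1"
  shows "integrable M (\<lambda>\<omega>. u i s \<omega> * u j t \<omega>)"
  using u_power_int[of i s 2] u_power_int[of j t 2] assms
  by (intro integrable_mult_of_squares u_rv) auto

text \<open>The squared norm is a product of two square integrable functions, by fourth moments of
  the error and of the factor.\<close>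

lemma uF_square_int:
  assumes "j \<ge> 1" "t \<ge> 1"
  shows "integrable M (\<lambda>\<omega>. (norm (u j t \<omega> *\<^sub>R F t \<omega>))\<^sup>2)"
proof -
  have [measurable]: "u j t \<in> borel_measurable M" "F t \<in> borel_measurable M"
    using u_rv F_rv assms by auto
  have "integrable M (\<lambda>\<omega>. (u j t \<omega>)\<^sup>2 * (norm (F t \<omega>))\<^sup>2)"
    using u_power_int[of j t 4] F_int[of t] assms
    by (intro integrable_mult_of_squares) (auto simp: power_even_abs)
  then show ?thesis by (simp add: power_mult_distrib)
qed

lemma factor_error_sum:
  assumes T: "T \<ge> 1"
  shows factor_error_sum_int: "integrable M (\<lambda>\<omega>. (norm (\<Sum>t=1..T. u 1 t \<omega> *\<^sub>R F t \<omega>))\<^sup>2)"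
    and factor_error_sum_moment: "expectation (\<lambda>\<omega>. (norm (\<Sum>t=1..T. u 1 t \<omega> *\<^sub>R F t \<omega>))\<^sup>2) \<le> D0 * real T"
proof -
  show 1: "integrable M (\<lambda>\<omega>. (norm (\<Sum>t=1..T. u 1 t \<omega> *\<^sub>R F t \<omega>))\<^sup>2)"
    by (intro integrable_norm_power_sum uF_square_int borel_measurable_scaleR F_rv u_rv) auto
  have "(norm ((1 / sqrt (real T)) *\<^sub>R (\<Sum>t=1..T. u 1 t \<omega> *\<^sub>R F t \<omega>)))\<^sup>2
      = (norm (\<Sum>t=1..T. u 1 t \<omega> *\<^sub>R F t \<omega>))\<^sup>2 / real T" for \<omega>
    by (simp add: power_mult_distrib power_divide)
  then show "expectation (\<lambda>\<omega>. (norm (\<Sum>t=1..T. u 1 t \<omega> *\<^sub>R F t \<omega>))\<^sup>2) \<le> D0 * real T"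
    using factor_error_moment[OF T] T by (simp add: divide_le_eq)
qed

text \<open>Expanding the square leaves the cross-sectional covariances at one time. Their absolute
  row sums are at most \<open>D0\<close>, so the double sum grows like N instead of its number of
  terms.\<close>

lemma loading_error_sum:
  assumes t: "t \<ge> 1"
  shows loading_error_sum_int: "integrable M (\<lambda>\<omega>. (norm (\<Sum>i=1..N. u i t \<omega> *\<^sub>R lam i))\<^sup>2)"
    and loading_error_sum_moment:
      "expectation (\<lambda>\<omega>. (norm (\<Sum>i=1..N. u i t \<omega> *\<^sub>R lam i))\<^sup>2) \<le> (1 + D0)\<^sup>2 * D0 * real N"
proof -
  have eq: "(norm (\<Sum>i=1..N. u i t \<omega> *\<^sub>R lam i))\<^sup>2
      = (\<Sum>i=1..N. \<Sum>j=1..N. inner (lam i) (lam j) * (u i t \<omega> * u j t \<omega>))" for \<omega>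
    unfolding power2_norm_eq_inner inner_sum_left inner_sum_right by (simp add: inner_commute mult_ac)
  have int: "integrable M (\<lambda>\<omega>. inner (lam i) (lam j) * (u i t \<omega> * u j t \<omega>))"
    if "i \<in> {1..N}" "j \<in> {1..N}" for i j
    using that t by (intro integrable_mult_right uu_int) auto
  then show "integrable M (\<lambda>\<omega>. (norm (\<Sum>i=1..N. u i t \<omega> *\<^sub>R lam i))\<^sup>2)"
    unfolding eq by (intro Bochner_Integration.integrable_sum) auto
  have "expectation (\<lambda>\<omega>. (norm (\<Sum>i=1..N. u i t \<omega> *\<^sub>R lam i))\<^sup>2)
      = (\<Sum>i=1..N. expectation (\<lambda>\<omega>. \<Sum>j=1..N. inner (lam i) (lam j) * (u i t \<omega> * u j t \<omega>)))"
    unfolding eq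
    by (rule Bochner_Integration.integral_sum, rule Bochner_Integration.integrable_sum, rule int)
  also have "\<dots> = (\<Sum>i=1..N. \<Sum>j=1..N. expectation (\<lambda>\<omega>. inner (lam i) (lam j) * (u i t \<omega> * u j t \<omega>)))"
  proof (rule sum.cong[OF refl])
    fix i assume "i \<in> {1..N}"
    then show "expectation (\<lambda>\<omega>. \<Sum>j=1..N. inner (lam i) (lam j) * (u i t \<omega> * u j t \<omega>))
        = (\<Sum>j=1..N. expectation (\<lambda>\<omega>. inner (lam i) (lam j) * (u i t \<omega> * u j t \<omega>)))"
      by (rule Bochner_Integration.integral_sum[OF int])
  qed
  also have "\<dots> = (\<Sum>i=1..N. \<Sum>j=1..N. inner (lam i) (lam j) * expectation (\<lambda>\<omega>. u i t \<omega> * u j t \<omega>))"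
    by simp
  also have "\<dots> \<le> (\<Sum>i=1..N. \<Sum>j=1..N. (1 + D0)\<^sup>2 * \<bar>expectation (\<lambda>\<omega>. u i t \<omega> * u j t \<omega>)\<bar>)"
  proof (intro sum_mono)
    fix i j assume ij: "i \<in> {1..N}" "j \<in> {1..N}"
    have "\<bar>inner (lam i) (lam j)\<bar> \<le> (1 + D0) * (1 + D0)"
      using norm_lam_le[of i] norm_lam_le[of j] ij D0
      by (intro order_trans[OF Cauchy_Schwarz_ineq2] mult_mono) auto
    then have "\<bar>inner (lam i) (lam j)\<bar> * \<bar>expectation (\<lambda>\<omega>. u i t \<omega> * u j t \<omega>)\<bar>
        \<le> (1 + D0)\<^sup>2 * \<bar>expectation (\<lambda>\<omega>. u i t \<omega> * u j t \<omega>)\<bar>"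
      unfolding power2_eq_square by (rule mult_right_mono) simp
    then show "inner (lam i) (lam j) * expectation (\<lambda>\<omega>. u i t \<omega> * u j t \<omega>)
        \<le> (1 + D0)\<^sup>2 * \<bar>expectation (\<lambda>\<omega>. u i t \<omega> * u j t \<omega>)\<bar>"
      unfolding abs_mult[symmetric] by (rule order_trans[OF abs_ge_self])
  qed
  also have "\<dots> \<le> (\<Sum>i=1..N. (1 + D0)\<^sup>2 * D0)"
    unfolding sum_distrib_left[symmetric]
    by (intro mult_left_mono sum_mono) (use t unit_dependence in auto)
  finally show "expectation (\<lambda>\<omega>. (norm (\<Sum>i=1..N. u i t \<omega> *\<^sub>R lam i))\<^sup>2) \<le> (1 + D0)\<^sup>2 * D0 * real N"
    by (simp add: mult_ac)
qed

text \<open>Each entry of row t of \<open>U U'\<close> is split into its mean and its deviation. A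
  deviation has second moment of order N, which contributes \<open>N T\<close> over all times. The
  absolute means of the row sum to at most \<open>N D0\<close>, so their squares contribute only
  \<open>N^2\<close>, independently of T.\<close>

lemma error_product_sum:
  assumes N: "N \<ge> 1" and t: "t \<in> {1..T}"
  shows error_product_sum_int: "integrable M (\<lambda>\<omega>. \<Sum>s=1..T. (\<Sum>i=1..N. u i t \<omega> * u i s \<omega>)\<^sup>2)"
    and error_product_sum_moment: "expectation (\<lambda>\<omega>. \<Sum>s=1..T. (\<Sum>i=1..N. u i t \<omega> * u i s \<omega>)\<^sup>2)
      \<le> 2 * (D0\<^sup>2 + 1 + D0) * ((real N)\<^sup>2 + real N * real T)"
proof -
  have t1: "t \<ge> 1" using t by simp
  define g where "g i s = expectation (\<lambda>\<omega>. u i t \<omega> * u i s \<omega>)" for i s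
  define dev where "dev s \<omega> = (\<Sum>i=1..N. u i t \<omega> * u i s \<omega> - g i s)" for s \<omega>
  have meas: "u i t \<in> borel_measurable M" "u i s \<in> borel_measurable M" if "i \<in> {1..N}" "s \<in> {1..T}" for i s
    using that t u_rv by auto
  have dev_meas [measurable]: "dev s \<in> borel_measurable M" if "s \<in> {1..T}" for s
    unfolding dev_def using meas that by (intro borel_measurable_sum borel_measurable_diff borel_measurable_times) auto
  have term4: "integrable M (\<lambda>\<omega>. norm (u i t \<omega> * u i s \<omega> - g i s) ^ 4)"
    if ist: "i \<in> {1..N}" "s \<in> {1..T}" for i s
  proof -
    note [measurable] = meas[OF ist]
    \<comment> \<open>Eighth moments enter here: the fourth power of a product of two errors is a
      product of two square integrable functions.\<close>
    have "integrable M (\<lambda>\<omega>. (u i t \<omega>) ^ 4 * (u i s \<omega>) ^ 4)"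
      using u_power_int[of i t 8] u_power_int[of i s 8] ist t
      by (intro integrable_mult_of_squares) (auto simp: power_even_abs)
    then have 1: "integrable M (\<lambda>\<omega>. norm (u i t \<omega> * u i s \<omega>) ^ 4)"
      by (simp add: power_even_abs power_mult_distrib abs_mult)
    \<comment> \<open>Writing the difference as a sum over a set of two elements brings it under
      \<open>integrable_norm_power_sum\<close>.\<close>
    have "integrable M (\<lambda>\<omega>. norm (\<Sum>b\<in>{True, False}. if b then u i t \<omega> * u i s \<omega> else - g i s) ^ 4)"
    proof (rule integrable_norm_power_sum)
      fix b
      show "integrable M (\<lambda>\<omega>. norm (if b then u i t \<omega> * u i s \<omega> else - g i s) ^ 4)"
        using 1 by (cases b) simp_all
    qed auto
    then show ?thesis by simp
  qed
  have dev4: "integrable M (\<lambda>\<omega>. \<bar>dev s \<omega>\<bar> ^ 4)" if s: "s \<in> {1..T}" for s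
    unfolding dev_def real_norm_def[symmetric] using meas s term4
    by (intro integrable_norm_power_sum borel_measurable_diff borel_measurable_times) auto
  have dev2_int: "integrable M (\<lambda>\<omega>. (dev s \<omega>)\<^sup>2)"
    and dev2: "expectation (\<lambda>\<omega>. (dev s \<omega>)\<^sup>2) \<le> real N * (1 + D0)" if s: "s \<in> {1..T}" for s
  proof -
    let ?Z = "\<lambda>\<omega>. \<bar>(1 / sqrt (real N)) * dev s \<omega>\<bar>"
    have [measurable]: "dev s \<in> borel_measurable M" using dev_meas[OF s] .
    have "?Z \<omega> ^ 4 = (1 / sqrt (real N)) ^ 4 * \<bar>dev s \<omega>\<bar> ^ 4" for \<omega>
      by (simp add: abs_mult power_mult_distrib power_divide)
    then have Z4: "integrable M (\<lambda>\<omega>. ?Z \<omega> ^ 4)" using dev4[OF s] by simp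
    have Z2: "?Z \<omega> ^ 2 = (dev s \<omega>)\<^sup>2 / real N" for \<omega>
      by (simp add: power_divide)
    have "integrable M (\<lambda>\<omega>. ?Z \<omega> ^ 2)"
      by (rule integrable_lower_moment[OF _ _ Z4]) auto
    then have "integrable M (\<lambda>\<omega>. real N * ((dev s \<omega>)\<^sup>2 / real N))"
      unfolding Z2 by (rule integrable_mult_right)
    moreover have "real N * ((dev s \<omega>)\<^sup>2 / real N) = (dev s \<omega>)\<^sup>2" for \<omega> using N by simp
    ultimately show "integrable M (\<lambda>\<omega>. (dev s \<omega>)\<^sup>2)" by (simp only:)
    have "expectation (\<lambda>\<omega>. ?Z \<omega> ^ 2) \<le> 1 + expectation (\<lambda>\<omega>. ?Z \<omega> ^ 4)"
      by (rule lower_moment_le[OF _ _ Z4]) auto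
    also have "expectation (\<lambda>\<omega>. ?Z \<omega> ^ 4) \<le> D0"
      using deviation_moment[OF N t1, of s] s by (simp add: dev_def g_def)
    finally show "expectation (\<lambda>\<omega>. (dev s \<omega>)\<^sup>2) \<le> real N * (1 + D0)"
      unfolding Z2 using N by (simp add: divide_le_eq mult.commute)
  qed
  have psi: "(\<Sum>i=1..N. u i t \<omega> * u i s \<omega>) = dev s \<omega> + (\<Sum>i=1..N. g i s)" for s \<omega>
    by (simp add: dev_def sum_subtractf)
  have sq_le: "(\<Sum>i=1..N. u i t \<omega> * u i s \<omega>)\<^sup>2 \<le> 2 * (dev s \<omega>)\<^sup>2 + 2 * (\<Sum>i=1..N. g i s)\<^sup>2" for s \<omega>
  proof -
    have "(x + y)\<^sup>2 \<le> 2 * x\<^sup>2 + 2 * y\<^sup>2" for x y :: real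
      using sum_squares_bound[of x y] by (simp add: power2_sum)
    then show ?thesis unfolding psi .
  qed
  have bound_int: "integrable M (\<lambda>\<omega>. \<Sum>s=1..T. 2 * (dev s \<omega>)\<^sup>2 + 2 * (\<Sum>i=1..N. g i s)\<^sup>2)"
    using dev2_int by (intro Bochner_Integration.integrable_sum Bochner_Integration.integrable_add) auto
  show int: "integrable M (\<lambda>\<omega>. \<Sum>s=1..T. (\<Sum>i=1..N. u i t \<omega> * u i s \<omega>)\<^sup>2)"
  proof (rule Bochner_Integration.integrable_bound[OF bound_int])
    show "(\<lambda>\<omega>. \<Sum>s=1..T. (\<Sum>i=1..N. u i t \<omega> * u i s \<omega>)\<^sup>2) \<in> borel_measurable M"
      using meas by (intro borel_measurable_sum borel_measurable_power borel_measurable_times) auto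
    show "AE \<omega> in M. norm (\<Sum>s=1..T. (\<Sum>i=1..N. u i t \<omega> * u i s \<omega>)\<^sup>2)
        \<le> norm (\<Sum>s=1..T. 2 * (dev s \<omega>)\<^sup>2 + 2 * (\<Sum>i=1..N. g i s)\<^sup>2)"
    proof (intro AE_I2)
      fix \<omega>
      have "0 \<le> (\<Sum>s=1..T. (\<Sum>i=1..N. u i t \<omega> * u i s \<omega>)\<^sup>2)" by (intro sum_nonneg) simp
      moreover have "(\<Sum>s=1..T. (\<Sum>i=1..N. u i t \<omega> * u i s \<omega>)\<^sup>2)
          \<le> (\<Sum>s=1..T. 2 * (dev s \<omega>)\<^sup>2 + 2 * (\<Sum>i=1..N. g i s)\<^sup>2)"
        by (intro sum_mono sq_le)
      ultimately show "norm (\<Sum>s=1..T. (\<Sum>i=1..N. u i t \<omega> * u i s \<omega>)\<^sup>2)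
          \<le> norm (\<Sum>s=1..T. 2 * (dev s \<omega>)\<^sup>2 + 2 * (\<Sum>i=1..N. g i s)\<^sup>2)"
        unfolding real_norm_def by linarith
    qed
  qed
  \<comment> \<open>A sum of squares is at most the square of the sum of absolute values, and the
    latter is what the time dependence condition controls.\<close>
  have "(\<Sum>s=1..T. (\<Sum>i=1..N. g i s)\<^sup>2) \<le> (\<Sum>s=1..T. \<bar>\<Sum>i=1..N. g i s\<bar>)\<^sup>2"
  proof -
    have "(\<Sum>s\<in>S. (x s)\<^sup>2) \<le> (\<Sum>s\<in>S. x s)\<^sup>2" if "finite S" "\<And>s. x s \<ge> 0" for S and x :: "nat \<Rightarrow> real"
      using that
    proof (induction S rule: finite_induct)
      case (insert a S)
      have "0 \<le> 2 * x a * sum x S"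
        using insert.prems by (intro mult_nonneg_nonneg sum_nonneg) auto
      then show ?case using insert by (simp add: power2_sum)
    qed simp
    from this[of "{1..T}" "\<lambda>s. \<bar>\<Sum>i=1..N. g i s\<bar>"] show ?thesis by simp
  qed
  also have "\<dots> \<le> (real N * D0)\<^sup>2"
  proof (intro power_mono sum_nonneg)
    show "(\<Sum>s=1..T. \<bar>\<Sum>i=1..N. g i s\<bar>) \<le> real N * D0"
      using time_dependence[OF N t] N by (simp add: g_def divide_le_eq mult.commute)
  qed simp
  finally have g2: "(\<Sum>s=1..T. (\<Sum>i=1..N. g i s)\<^sup>2) \<le> (real N)\<^sup>2 * D0\<^sup>2" by (simp add: power_mult_distrib)
  have "expectation (\<lambda>\<omega>. \<Sum>s=1..T. (\<Sum>i=1..N. u i t \<omega> * u i s \<omega>)\<^sup>2)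
      \<le> expectation (\<lambda>\<omega>. \<Sum>s=1..T. 2 * (dev s \<omega>)\<^sup>2 + 2 * (\<Sum>i=1..N. g i s)\<^sup>2)"
    by (intro integral_mono int bound_int sum_mono sq_le)
  also have "\<dots> = (\<Sum>s=1..T. 2 * expectation (\<lambda>\<omega>. (dev s \<omega>)\<^sup>2) + 2 * (\<Sum>i=1..N. g i s)\<^sup>2)"
    using dev2_int
    by (subst Bochner_Integration.integral_sum) (auto intro!: sum.cong simp: prob_space)
  also have "\<dots> \<le> (\<Sum>s=1..T. 2 * (real N * (1 + D0)) + 2 * (\<Sum>i=1..N. g i s)\<^sup>2)"
    using dev2 by (intro sum_mono add_mono mult_left_mono) auto
  also have "\<dots> = 2 * (1 + D0) * (real N * real T) + 2 * (\<Sum>s=1..T. (\<Sum>i=1..N. g i s)\<^sup>2)"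
    by (simp add: sum.distrib sum_distrib_left algebra_simps)
  also have "\<dots> \<le> 2 * (D0\<^sup>2 + 1 + D0) * (real N * real T) + 2 * ((D0\<^sup>2 + 1 + D0) * (real N)\<^sup>2)"
  proof (intro add_mono mult_left_mono mult_right_mono)
    have "(real N)\<^sup>2 * D0\<^sup>2 \<le> (D0\<^sup>2 + 1 + D0) * (real N)\<^sup>2"
      using D0 by (simp add: algebra_simps)
    then show "(\<Sum>s=1..T. (\<Sum>i=1..N. g i s)\<^sup>2) \<le> (D0\<^sup>2 + 1 + D0) * (real N)\<^sup>2"
      using g2 by linarith
  qed auto
  finally show "expectation (\<lambda>\<omega>. \<Sum>s=1..T. (\<Sum>i=1..N. u i t \<omega> * u i s \<omega>)\<^sup>2)
      \<le> 2 * (D0\<^sup>2 + 1 + D0) * ((real N)\<^sup>2 + real N * real T)"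
    by (simp add: algebra_simps)
qed

end

text \<open>The order of quantifiers matters: \<open>A\<close> and \<open>n0\<close> depend on
  \<open>\<epsilon>\<close> alone, while the exceptional event may also depend on \<open>N\<close>,
  \<open>T\<close> and \<open>\<tau>\<close>. This yields the pointwise rate even for a time index
  that varies with the sample size.\<close>

lemma (in factor_model) pc_fit_bounds:
  fixes Y :: "nat \<Rightarrow> nat \<Rightarrow> 'a \<Rightarrow> real" and Fhat :: "nat \<Rightarrow> nat \<Rightarrow> 'a \<Rightarrow> real mat"
    and Sig_L Sig_F :: "real^'k^'k"
  assumes model: "\<And>j t \<omega>. j \<ge> 1 \<Longrightarrow> t \<ge> 1 \<Longrightarrow> \<omega> \<in> space M \<Longrightarrow> Y j t \<omega> = inner (lam j) (F t \<omega>) + u j t \<omega>"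
    and lam_lim: "(\<lambda>N. (1 / real N) *\<^sub>R (\<Sum>i=1..N. outer (lam i) (lam i))) \<longlonglongrightarrow> Sig_L"
    and F_lim: "conv_in_prob M (\<lambda>T \<omega>. (1 / real T) *\<^sub>R (\<Sum>t=1..T. outer (F t \<omega>) (F t \<omega>))) Sig_F"
    and pd: "pos_def Sig_L" "pos_def Sig_F"
    and pc: "\<And>N T \<omega>. N \<ge> 1 \<Longrightarrow> T \<ge> CARD('k) \<Longrightarrow> \<omega> \<in> space M \<Longrightarrow>
      pc_factors (data_mat (\<lambda>j t. Y j t \<omega>) N T) CARD('k) (Fhat N T \<omega>)"
    and \<epsilon>: "\<epsilon> > 0"
  shows "\<exists>A>0. \<exists>n0. \<forall>N\<ge>n0. \<forall>T\<ge>n0. \<forall>\<tau>\<in>{1..T}. \<exists>Bad\<in>events. prob Bad \<le> \<epsilon> \<and> (\<forall>\<omega>\<in>space M - Bad.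
      (1 / real T) * (\<Sum>t=1..T. (pc_fit (data_mat (\<lambda>j t. Y j t \<omega>) N T) (Fhat N T \<omega>) t - inner (lam 1) (F t \<omega>))\<^sup>2)
        \<le> A * (1 / real N + 1 / real T) \<and>
      \<bar>pc_fit (data_mat (\<lambda>j t. Y j t \<omega>) N T) (Fhat N T \<omega>) \<tau> - inner (lam 1) (F \<tau> \<omega>)\<bar>
        \<le> A * (1 / sqrt (real N) + 1 / sqrt (real T)))"
proof -
  obtain a \<eta>L where a: "a > 0" and \<eta>L: "\<eta>L > 0"
    and aL: "\<And>n f z. n \<ge> 1 \<Longrightarrow> dist ((1 / real n) *\<^sub>R (\<Sum>i=1..n. outer (f i) (f i))) Sig_L \<le> \<eta>L \<Longrightarrow>
      a * real n * (norm z)\<^sup>2 \<le> (\<Sum>i=1..n. (inner (f i) z)\<^sup>2)"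
    using pos_def_gram_lower_bound[OF pd(1)] by blast
  obtain b \<eta>F where b: "b > 0" and \<eta>F: "\<eta>F > 0"
    and bF: "\<And>n f z. n \<ge> 1 \<Longrightarrow> dist ((1 / real n) *\<^sub>R (\<Sum>i=1..n. outer (f i) (f i))) Sig_F \<le> \<eta>F \<Longrightarrow>
      b * real n * (norm z)\<^sup>2 \<le> (\<Sum>i=1..n. (inner (f i) z)\<^sup>2)"
    using pos_def_gram_lower_bound[OF pd(2)] by blast
  let ?K = "real CARD('k)"
  define m where "m = (1 + D0) + (1 + D0)\<^sup>2 * D0 + 2 * (D0\<^sup>2 + 1 + D0) + D0"
  have m: "m > 0" "1 + D0 \<le> m" "(1 + D0)\<^sup>2 * D0 \<le> m" "2 * (D0\<^sup>2 + 1 + D0) \<le> m" "D0 \<le> m"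
    using D0 by (simp_all add: m_def add_pos_pos)
  \<comment> \<open>Eight statistics with mean at most \<open>m\<close> are to stay below
    \<open>C\<close>. By Markov each fails with probability at most \<open>\<epsilon> / 16\<close>,
    so together they use half of \<open>\<epsilon>\<close>; the other half is for the Gram matrix of
    the factors.\<close>
  define C where "C = 16 * m / \<epsilon>"
  have C: "C > 0" using m \<epsilon> by (simp add: C_def)
  have mC: "8 * (m / C) = \<epsilon> / 2" using m \<epsilon> by (simp add: C_def)
  define c where "c = a * b / 4"
  have c: "c > 0" using a b by (simp add: c_def)
  define B where "B = 1 + D0"
  define A1 where "A1 = sqrt (3 * (2 * C\<^sup>2 + C)) / c"
  define A2 where "A2 = 2 * ?K * (sqrt C * B)"
  define A3 where "A3 = B\<^sup>2 * sqrt C / c"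
  define A6 where "A6 = (2 * C + sqrt C) / c"
  define A5 where "A5 = (A3 + A1) * sqrt C + A1 * A2"
  note const_defs = A5_def A1_def A2_def A3_def A6_def
  have A1: "A1 > 0" using C c by (simp add: A1_def add_pos_pos)
  define Aa where "Aa = 2 * A5\<^sup>2 * ?K\<^sup>2 + 2 * A2\<^sup>2 * A1\<^sup>2"
  define Ap where "Ap = ?K * (sqrt C * A3 + 2 * A6) * A5 + A2 * A6"
  define A where "A = 1 + \<bar>Aa\<bar> + \<bar>Ap\<bar>"
  have A: "A > 0" "Aa \<le> A" "Ap \<le> A" by (simp_all add: A_def)
  \<comment> \<open>The first entry makes the hypothesis \<open>small\<close> of
    \<open>fit_rates\<close> true, the second keeps the Frobenius norm of \<open>U U'\<close> below
    \<open>c N T\<close>, as the eigenvalue bound demands.\<close>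
  define \<delta>0 where "\<delta>0 = min ((1 / (2 * ?K * A1))\<^sup>2) (c\<^sup>2 / C)"
  have \<delta>0: "\<delta>0 > 0" using A1 c C by (simp add: \<delta>0_def)
  obtain n1 where n1: "\<And>N. N \<ge> n1 \<Longrightarrow> dist ((1 / real N) *\<^sub>R (\<Sum>i=1..N. outer (lam i) (lam i))) Sig_L < \<eta>L"
    using lam_lim \<eta>L unfolding lim_sequentially by blast
  have "(\<lambda>T. prob {\<omega> \<in> space M. dist ((1 / real T) *\<^sub>R (\<Sum>t=1..T. outer (F t \<omega>) (F t \<omega>))) Sig_F > \<eta>F}) \<longlonglongrightarrow> 0"
    using F_lim \<eta>F unfolding conv_in_prob_def by blast
  then have "\<forall>\<^sub>F T in sequentially. prob {\<omega> \<in> space M. dist ((1 / real T) *\<^sub>R (\<Sum>t=1..T. outer (F t \<omega>) (F t \<omega>))) Sig_F > \<eta>F} < \<epsilon> / 2"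
    using \<epsilon> by (intro order_tendstoD) auto
  then obtain n2 where n2: "\<And>T. T \<ge> n2 \<Longrightarrow>
      prob {\<omega> \<in> space M. dist ((1 / real T) *\<^sub>R (\<Sum>t=1..T. outer (F t \<omega>) (F t \<omega>))) Sig_F > \<eta>F} < \<epsilon> / 2"
    unfolding eventually_sequentially by blast
  \<comment> \<open>The last entry makes \<open>1 / N\<close> and \<open>1 / T\<close> at most half
    of \<open>\<delta>0\<close> each, and \<open>CARD('k)\<close> ensures that there are enough
    times for the required eigenvectors.\<close>
  define n0 where "n0 = max (max n1 n2) (max CARD('k) (nat \<lceil>2 / \<delta>0\<rceil>))"
  have "\<exists>Bad\<in>events. prob Bad \<le> \<epsilon> \<and> (\<forall>\<omega>\<in>space M - Bad.
      (1 / real T) * (\<Sum>t=1..T. (pc_fit (data_mat (\<lambda>j t. Y j t \<omega>) N T) (Fhat N T \<omega>) t - inner (lam 1) (F t \<omega>))\<^sup>2)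
        \<le> A * (1 / real N + 1 / real T) \<and>
      \<bar>pc_fit (data_mat (\<lambda>j t. Y j t \<omega>) N T) (Fhat N T \<omega>) \<tau> - inner (lam 1) (F \<tau> \<omega>)\<bar>
        \<le> A * (1 / sqrt (real N) + 1 / sqrt (real T)))"
    if NT: "N \<ge> n0" "T \<ge> n0" and \<tau>: "\<tau> \<in> {1..T}" for N T \<tau>
  proof -
    have n0: "n1 \<le> n0" "n2 \<le> n0" "CARD('k) \<le> n0" by (simp_all add: n0_def)
    have K0: "0 < CARD('k)" by simp
    have N: "N \<ge> 1" "N \<ge> n1" and T: "T \<ge> 1" "T \<ge> n2" "T \<ge> CARD('k)"
      using NT n0 K0 by linarith+
    have Npos: "real N > 0" and Tpos: "real T > 0" using N T by auto
    have inv: "1 / real n \<le> \<delta>0 / 2" if "n \<ge> n0" for n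
    proof -
      have le: "2 / \<delta>0 \<le> real n" using that by (simp add: n0_def nat_ceiling_le_eq)
      moreover have "2 / \<delta>0 > 0" using \<delta>0 by simp
      ultimately have "real n > 0" by linarith
      with le show ?thesis using \<delta>0 by (simp add: field_simps)
    qed
    have sum_le: "1 / real N + 1 / real T \<le> \<delta>0" using inv[OF NT(1)] inv[OF NT(2)] by simp
    have small: "?K * A1 * sqrt (1 / real N + 1 / real T) \<le> 1 / 2"
    proof -
      have "sqrt (1 / real N + 1 / real T) \<le> 1 / (2 * ?K * A1)"
        using sum_le A1 by (intro real_le_lsqrt) (auto simp: \<delta>0_def)
      then have "?K * A1 * sqrt (1 / real N + 1 / real T) \<le> ?K * A1 * (1 / (2 * ?K * A1))"
        using A1 by (intro mult_left_mono) auto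
      then show ?thesis using A1 by simp
    qed
    have small2: "C * ((real N)\<^sup>2 * real T + real N * (real T)\<^sup>2) \<le> (c * real N * real T)\<^sup>2"
    proof -
      have "C * (1 / real N + 1 / real T) \<le> C * (c\<^sup>2 / C)"
        using sum_le C by (intro mult_left_mono) (auto simp: \<delta>0_def)
      then have "(real N * real T)\<^sup>2 * (C * (1 / real N + 1 / real T)) \<le> (real N * real T)\<^sup>2 * c\<^sup>2"
        using C by (intro mult_left_mono) auto
      moreover have "(real N * real T)\<^sup>2 * (C * (1 / real N + 1 / real T)) = C * ((real N)\<^sup>2 * real T + real N * (real T)\<^sup>2)"
        using Npos Tpos by (simp add: field_simps power2_eq_square)
      moreover have "(real N * real T)\<^sup>2 * c\<^sup>2 = (c * real N * real T)\<^sup>2"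
        by (simp add: power_mult_distrib)
      ultimately show ?thesis by linarith
    qed
    \<comment> \<open>\<open>X1\<close> to \<open>X5\<close> concern the whole sample and
      \<open>X6\<close> to \<open>X8\<close> the time \<open>\<tau>\<close>. Each is divided by the
      order of its mean, so that \<open>m\<close> bounds all the means.\<close>
    define X1 where "X1 \<omega> = (\<Sum>t=1..T. (norm (F t \<omega>))\<^sup>2) / real T" for \<omega>
    define X2 where "X2 \<omega> = (\<Sum>t=1..T. (norm (\<Sum>i=1..N. u i t \<omega> *\<^sub>R lam i))\<^sup>2) / (real N * real T)" for \<omega>
    define X3 where "X3 \<omega> = (\<Sum>t=1..T. \<Sum>s=1..T. (\<Sum>i=1..N. u i t \<omega> * u i s \<omega>)\<^sup>2) / (((real N)\<^sup>2 + real N * real T) * real T)" for \<omega>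
    define X4 where "X4 \<omega> = (\<Sum>t=1..T. (u 1 t \<omega>)\<^sup>2) / real T" for \<omega>
    define X5 where "X5 \<omega> = (norm (\<Sum>t=1..T. u 1 t \<omega> *\<^sub>R F t \<omega>))\<^sup>2 / real T" for \<omega>
    define X6 where "X6 \<omega> = (norm (F \<tau> \<omega>))\<^sup>2" for \<omega>
    define X7 where "X7 \<omega> = (norm (\<Sum>i=1..N. u i \<tau> \<omega> *\<^sub>R lam i))\<^sup>2 / real N" for \<omega>
    define X8 where "X8 \<omega> = (\<Sum>s=1..T. (\<Sum>i=1..N. u i \<tau> \<omega> * u i s \<omega>)\<^sup>2) / ((real N)\<^sup>2 + real N * real T)" for \<omega>
    have scaled: "integrable M (\<lambda>\<omega>. f \<omega> / r) \<and> expectation (\<lambda>\<omega>. f \<omega> / r) \<le> m"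
      if "integrable M f" "expectation f \<le> q * r" "q \<le> m" "r > 0" for f q r
      using that by (auto simp: divide_le_eq intro: order_trans[OF _ mult_right_mono])
    have summed: "integrable M (\<lambda>\<omega>. (\<Sum>t=1..T. f t \<omega>) / (r * real T)) \<and> expectation (\<lambda>\<omega>. (\<Sum>t=1..T. f t \<omega>) / (r * real T)) \<le> m"
      if int: "\<And>t. t \<in> {1..T} \<Longrightarrow> integrable M (f t)" and le: "\<And>t. t \<in> {1..T} \<Longrightarrow> expectation (f t) \<le> q * r"
        and "q \<le> m" "r > 0" for f q r
    proof (rule scaled)
      show "integrable M (\<lambda>\<omega>. \<Sum>t=1..T. f t \<omega>)" using int by (rule Bochner_Integration.integrable_sum)
      have "expectation (\<lambda>\<omega>. \<Sum>t=1..T. f t \<omega>) = (\<Sum>t=1..T. expectation (f t))"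
        using int by (rule Bochner_Integration.integral_sum)
      also have "\<dots> \<le> (\<Sum>t=1..T. q * r)" using le by (rule sum_mono)
      finally show "expectation (\<lambda>\<omega>. \<Sum>t=1..T. f t \<omega>) \<le> q * (r * real T)" by (simp add: mult_ac)
    qed (use that Tpos in auto)
    let ?r8 = "(real N)\<^sup>2 + real N * real T"
    have r8: "?r8 > 0" using Npos Tpos by (simp add: add_pos_pos)
    have \<tau>1: "\<tau> \<ge> 1" using \<tau> by simp
    have E1: "integrable M X1 \<and> expectation X1 \<le> m"
      unfolding X1_def using summed[of "\<lambda>t \<omega>. (norm (F t \<omega>))\<^sup>2" "1 + D0" 1] F_square_int F_square_moment m by simp
    have E2: "integrable M X2 \<and> expectation X2 \<le> m"
      unfolding X2_def
      by (rule summed[OF _ _ m(3)]) (use loading_error_sum_int loading_error_sum_moment Npos in auto)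
    have E3: "integrable M X3 \<and> expectation X3 \<le> m"
      unfolding X3_def
      by (rule summed[OF _ _ m(4) r8]) (use error_product_sum_int error_product_sum_moment N in auto)
    have E4: "integrable M X4 \<and> expectation X4 \<le> m"
      unfolding X4_def
      using summed[of "\<lambda>t \<omega>. (u 1 t \<omega>)\<^sup>2" "1 + D0" 1] u_power_int[of 1 _ 2] u_power_moment[of 1 _ 2] m by simp
    have E5: "integrable M X5 \<and> expectation X5 \<le> m"
      unfolding X5_def
      by (rule scaled[OF _ _ m(5) Tpos]) (use factor_error_sum_int factor_error_sum_moment T in auto)
    have E6: "integrable M X6 \<and> expectation X6 \<le> m"
      unfolding X6_def using F_square_int[OF \<tau>1] F_square_moment[OF \<tau>1] m by auto
    have E7: "integrable M X7 \<and> expectation X7 \<le> m"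
      unfolding X7_def
      by (rule scaled[OF _ _ m(3) Npos]) (use loading_error_sum_int loading_error_sum_moment \<tau>1 in auto)
    have E8: "integrable M X8 \<and> expectation X8 \<le> m"
      unfolding X8_def
      by (rule scaled[OF _ _ m(4) r8]) (use error_product_sum_int error_product_sum_moment N \<tau> in auto)
    \<comment> \<open>Some of the eight functions may coincide. The set of a list has at most as
      many elements as the list, which is all the union bound asks for.\<close>
    let ?Xs = "set [X1, X2, X3, X4, X5, X6, X7, X8]"
    have Xint: "integrable M X" and Xm: "expectation X \<le> m" if "X \<in> ?Xs" for X
      using that E1 E2 E3 E4 E5 E6 E7 E8 by auto
    have Xpos: "X \<omega> \<ge> 0" if "X \<in> ?Xs" for X \<omega>
      using that by (auto simp: X1_def X2_def X3_def X4_def X5_def X6_def X7_def X8_def intro!: sum_nonneg divide_nonneg_nonneg)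
    define Bad1 where "Bad1 = {\<omega> \<in> space M. \<exists>X\<in>?Xs. X \<omega> > C}"
    define Bad2 where "Bad2 = {\<omega> \<in> space M. dist ((1 / real T) *\<^sub>R (\<Sum>t=1..T. outer (F t \<omega>) (F t \<omega>))) Sig_F > \<eta>F}"
    have Bad1: "Bad1 \<in> events" "prob Bad1 \<le> \<epsilon> / 2"
    proof -
      show "Bad1 \<in> events"
        unfolding Bad1_def by (rule prob_any_exceeds_le(1)[of ?Xs m C], rule finite_set, rule Xint, assumption, rule Xpos, assumption, rule Xm, assumption, rule C)
      have "prob Bad1 \<le> real (card ?Xs) * (m / C)"
        unfolding Bad1_def by (rule prob_any_exceeds_le(2)[of ?Xs m C], rule finite_set, rule Xint, assumption, rule Xpos, assumption, rule Xm, assumption, rule C)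
      also have "\<dots> \<le> 8 * (m / C)"
        using card_length[of "[X1, X2, X3, X4, X5, X6, X7, X8]"] m C by (intro mult_right_mono) auto
      finally show "prob Bad1 \<le> \<epsilon> / 2" using mC by simp
    qed
    have Bad2: "Bad2 \<in> events" "prob Bad2 \<le> \<epsilon> / 2"
    proof -
      have "(\<lambda>\<omega>. outer (F t \<omega>) (F t \<omega>)) \<in> borel_measurable M" if "t \<in> {1..T}" for t
        using measurable_compose[OF F_rv borel_measurable_continuous_onI[OF continuous_on_outer]] that by simp
      then have [measurable]: "(\<lambda>\<omega>. \<Sum>t=1..T. outer (F t \<omega>) (F t \<omega>)) \<in> borel_measurable M"
        by (rule borel_measurable_sum)
      show "Bad2 \<in> events" unfolding Bad2_def by measurable
      show "prob Bad2 \<le> \<epsilon> / 2" using n2[OF T(2)] by (simp add: Bad2_def)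
    qed
    have "prob (Bad1 \<union> Bad2) \<le> \<epsilon>"
      using measure_Un_le[OF Bad1(1) Bad2(1)] Bad1(2) Bad2(2) by linarith
    moreover have "(1 / real T) * (\<Sum>t=1..T. (pc_fit (data_mat (\<lambda>j t. Y j t \<omega>) N T) (Fhat N T \<omega>) t - inner (lam 1) (F t \<omega>))\<^sup>2)
          \<le> A * (1 / real N + 1 / real T) \<and>
        \<bar>pc_fit (data_mat (\<lambda>j t. Y j t \<omega>) N T) (Fhat N T \<omega>) \<tau> - inner (lam 1) (F \<tau> \<omega>)\<bar>
          \<le> A * (1 / sqrt (real N) + 1 / sqrt (real T))"
      if \<omega>: "\<omega> \<in> space M - (Bad1 \<union> Bad2)" for \<omega>
    proof -
      have X: "X1 \<omega> \<le> C" "X2 \<omega> \<le> C" "X3 \<omega> \<le> C" "X4 \<omega> \<le> C" "X5 \<omega> \<le> C" "X6 \<omega> \<le> C" "X7 \<omega> \<le> C" "X8 \<omega> \<le> C"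
        using \<omega> unfolding Bad1_def by (auto simp: not_less)
      have S1: "(\<Sum>t=1..T. (norm (F t \<omega>))\<^sup>2) \<le> C * real T"
        using X(1) Tpos by (simp add: X1_def divide_le_eq)
      have S2: "(\<Sum>t=1..T. (norm (\<Sum>i=1..N. u i t \<omega> *\<^sub>R lam i))\<^sup>2) \<le> C * real N * real T"
        using X(2) Tpos Npos by (simp add: X2_def divide_le_eq mult.assoc)
      have S3: "(\<Sum>t=1..T. \<Sum>s=1..T. (\<Sum>i=1..N. u i t \<omega> * u i s \<omega>)\<^sup>2) \<le> C * ((real N)\<^sup>2 * real T + real N * (real T)\<^sup>2)"
      proof -
        have "(\<Sum>t=1..T. \<Sum>s=1..T. (\<Sum>i=1..N. u i t \<omega> * u i s \<omega>)\<^sup>2) \<le> C * (?r8 * real T)"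
          using X(3) r8 Tpos pos_divide_le_eq[OF mult_pos_pos[OF r8 Tpos]] unfolding X3_def by blast
        also have "?r8 * real T = (real N)\<^sup>2 * real T + real N * (real T)\<^sup>2"
          by (simp add: algebra_simps power2_eq_square)
        finally show ?thesis .
      qed
      have S4: "(\<Sum>t=1..T. (u 1 t \<omega>)\<^sup>2) \<le> C * real T"
        using X(4) Tpos by (simp add: X4_def divide_le_eq)
      have S5: "(norm (\<Sum>t=1..T. u 1 t \<omega> *\<^sub>R F t \<omega>))\<^sup>2 \<le> C * real T"
        using X(5) Tpos by (simp add: X5_def divide_le_eq)
      have S6: "(norm (F \<tau> \<omega>))\<^sup>2 \<le> C" using X(6) by (simp add: X6_def)
      have S7: "(norm (\<Sum>i=1..N. u i \<tau> \<omega> *\<^sub>R lam i))\<^sup>2 \<le> C * real N"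
        using X(7) Npos by (simp add: X7_def divide_le_eq)
      have S8: "(\<Sum>s=1..T. (\<Sum>i=1..N. u i \<tau> \<omega> * u i s \<omega>)\<^sup>2) \<le> C * ?r8"
        using X(8) pos_divide_le_eq[OF r8] unfolding X8_def by blast
      have lamlow: "a * real N * (norm z)\<^sup>2 \<le> (\<Sum>i=1..N. (inner (lam i) z)\<^sup>2)" for z
        using n1[OF N(2)] by (intro aL N(1)) simp
      have Flow: "b * real T * (norm z)\<^sup>2 \<le> (\<Sum>t=1..T. (inner (F t \<omega>) z)\<^sup>2)" for z
        using \<omega> by (intro bF T(1)) (auto simp: Bad2_def not_less)
      have mdl: "Y j t \<omega> = inner (lam j) (F t \<omega>) + u j t \<omega>" if "j \<in> {1..N}" "t \<in> {1..T}" for j t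
        using model \<omega> that by auto
      have Usmall: "(\<Sum>t=1..T. \<Sum>s=1..T. (\<Sum>i=1..N. u i t \<omega> * u i s \<omega>)\<^sup>2) \<le> (a * b / 4 * real N * real T)\<^sup>2"
        using S3 small2 by (simp add: c_def)
      have "pc_factors (data_mat (\<lambda>j t. Y j t \<omega>) N T) CARD('k) (Fhat N T \<omega>)"
        using pc N T \<omega> by blast
      from pc_factor_sample[OF this N(1) T(3) mdl a b lamlow Flow Usmall, folded c_def]
      obtain fh v where fs: "factor_sample N T (\<lambda>t. F t \<omega>) fh lam (\<lambda>i t. u i t \<omega>) v c"
        and fit: "\<And>t. t \<in> {1..T} \<Longrightarrow> pc_fit (data_mat (\<lambda>j t. Y j t \<omega>) N T) (Fhat N T \<omega>) t =
          (\<Sum>a\<in>UNIV. fh t $ a * ((1 / real T) * (\<Sum>s=1..T. fh s $ a * (inner (lam 1) (F s \<omega>) + u 1 s \<omega>))))"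
        by blast
      interpret S: factor_sample N T "\<lambda>t. F t \<omega>" fh lam "\<lambda>i t. u i t \<omega>" v c by (rule fs)
      have B: "norm (lam i) \<le> B" if "i \<in> {1..N}" for i
        using norm_lam_le[of i] that by (simp add: B_def)
      have one: "1 \<in> {1..N}" using N by simp
      note prems = less_imp_le[OF C] B one S1 S2 S3 S4 S5 small[unfolded A1_def]
      have "(1 / real T) * (\<Sum>t=1..T. (pc_fit (data_mat (\<lambda>j t. Y j t \<omega>) N T) (Fhat N T \<omega>) t - inner (lam 1) (F t \<omega>))\<^sup>2)
          = (1 / real T) * (\<Sum>t=1..T. ((\<Sum>a\<in>UNIV. fh t $ a * ((1 / real T) * (\<Sum>s=1..T. fh s $ a * (inner (lam 1) (F s \<omega>) + u 1 s \<omega>)))) - inner (lam 1) (F t \<omega>))\<^sup>2)"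
        by (intro arg_cong2[of _ _ _ _ "(*)"] sum.cong refl) (simp only: fit)
      also have "\<dots> \<le> Aa * (sqrt (1 / real N + 1 / real T))\<^sup>2"
        unfolding Aa_def const_defs by (rule S.fit_average_rate[OF prems])
      also have "\<dots> = Aa * (1 / real N + 1 / real T)" by simp
      also have "\<dots> \<le> A * (1 / real N + 1 / real T)" using A by (intro mult_right_mono) auto
      finally have avg: "(1 / real T) * (\<Sum>t=1..T. (pc_fit (data_mat (\<lambda>j t. Y j t \<omega>) N T) (Fhat N T \<omega>) t - inner (lam 1) (F t \<omega>))\<^sup>2)
          \<le> A * (1 / real N + 1 / real T)" .
      have "\<bar>pc_fit (data_mat (\<lambda>j t. Y j t \<omega>) N T) (Fhat N T \<omega>) \<tau> - inner (lam 1) (F \<tau> \<omega>)\<bar>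
          \<le> Ap * sqrt (1 / real N + 1 / real T)"
        unfolding fit[OF \<tau>] Ap_def const_defs by (rule S.fit_pointwise_rate[OF prems \<tau> S6 S7 S8])
      also have "\<dots> \<le> A * sqrt (1 / real N + 1 / real T)" using A by (intro mult_right_mono) auto
      also have "\<dots> \<le> A * (sqrt (1 / real N) + sqrt (1 / real T))"
        using A by (intro mult_left_mono sqrt_add_le_add_sqrt) auto
      finally show ?thesis using avg by (simp add: real_sqrt_divide)
    qed
    ultimately show ?thesis using Bad1(1) Bad2(1) by (intro bexI[of _ "Bad1 \<union> Bad2"]) auto
  qed
  then show ?thesis using A(1) by (intro exI[of _ A] exI[of _ n0] conjI allI impI ballI)
qed

section \<open>From events of high probability to stochastic orders\<close>

theorem lemma2:
  fixes M :: "'a measure"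
    and Y u :: "nat \<Rightarrow> nat \<Rightarrow> 'a \<Rightarrow> real"
    and F :: "nat \<Rightarrow> 'a \<Rightarrow> real^'k"
    and lam :: "nat \<Rightarrow> real^'k"
    and Fhat :: "nat \<Rightarrow> nat \<Rightarrow> 'a \<Rightarrow> real mat"
    and D0 :: real
    and Gam Phi :: "nat \<Rightarrow> real^'k^'k"
    and Sig_L Sig_F :: "real^'k^'k"
  assumes prob: "prob_space M"
    and F_rv: "\<And>t. t \<ge> 1 \<Longrightarrow> F t \<in> borel_measurable M"
    and u_rv: "\<And>j t. j \<ge> 1 \<Longrightarrow> t \<ge> 1 \<Longrightarrow> u j t \<in> borel_measurable M"
    and model: "\<And>j t \<omega>. j \<ge> 1 \<Longrightarrow> t \<ge> 1 \<Longrightarrow> \<omega> \<in> space M \<Longrightarrow>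
      Y j t \<omega> = inner (lam j) (F t \<omega>) + u j t \<omega>"
    and uncorr: "\<And>j t. j \<ge> 1 \<Longrightarrow> t \<ge> 1 \<Longrightarrow>
      uncorrelated M (u j t) (F t) \<and> uncorrelated M (u j t) (\<lambda>_. lam j)"
    and D0: "D0 > 0"
    and c1_F: "\<And>t. t \<ge> 1 \<Longrightarrow>
      integrable M (\<lambda>\<omega>. norm (F t \<omega>) ^ 4) \<and> (\<integral>\<omega>. norm (F t \<omega>) ^ 4 \<partial>M) \<le> D0"
    and c1_lam: "\<And>j. j \<ge> 1 \<Longrightarrow> norm (lam j) ^ 4 \<le> D0"
    and c1_u: "\<And>j t. j \<ge> 1 \<Longrightarrow> t \<ge> 1 \<Longrightarrow>
      integrable M (\<lambda>\<omega>. \<bar>u j t \<omega>\<bar> ^ 8) \<and> (\<integral>\<omega>. \<bar>u j t \<omega>\<bar> ^ 8 \<partial>M) \<le> D0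
      \<and> (\<integral>\<omega>. u j t \<omega> \<partial>M) = 0"
    and c2_time: "\<And>N T s. N \<ge> 1 \<Longrightarrow> s \<in> {1..T} \<Longrightarrow>
      (1 / real N) * (\<Sum>t=1..T. \<bar>\<Sum>i=1..N. \<integral>\<omega>. u i s \<omega> * u i t \<omega> \<partial>M\<bar>) \<le> D0"
    and c2_unit: "\<And>N T i. T \<ge> 1 \<Longrightarrow> i \<in> {1..N} \<Longrightarrow>
      (\<Sum>j=1..N. MAX t\<in>{1..T}. \<bar>\<integral>\<omega>. u i t \<omega> * u j t \<omega> \<partial>M\<bar>) \<le> D0"
    and c3_sum: "\<And>N T. N \<ge> 1 \<Longrightarrow> T \<ge> 1 \<Longrightarrow>
      (1 / (real N * real T)) * (\<Sum>s=1..T. \<Sum>t=1..T. \<Sum>i=1..N. \<Sum>j=1..N.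
         \<bar>\<integral>\<omega>. u i t \<omega> * u j s \<omega> \<partial>M\<bar>) \<le> D0"
    and c3_dev: "\<And>N s t. N \<ge> 1 \<Longrightarrow> s \<ge> 1 \<Longrightarrow> t \<ge> 1 \<Longrightarrow>
      (\<integral>\<omega>. \<bar>(1 / sqrt (real N)) * (\<Sum>i=1..N. u i s \<omega> * u i t \<omega>
           - (\<integral>\<eta>. u i s \<eta> * u i t \<eta> \<partial>M))\<bar> ^ 4 \<partial>M) \<le> D0"
    and c4: "\<And>N T. N \<ge> 1 \<Longrightarrow> T \<ge> 1 \<Longrightarrow>
      (1 / real N) * (\<Sum>i=1..N. \<integral>\<omega>.
         (norm ((1 / sqrt (real T)) *\<^sub>R (\<Sum>t=1..T. u i t \<omega> *\<^sub>R F t \<omega>)))\<^sup>2 \<partial>M) \<le> D0"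
    and c5: "\<And>N T t. N \<ge> 1 \<Longrightarrow> t \<in> {1..T} \<Longrightarrow>
      (\<integral>\<omega>. (norm ((1 / sqrt (real N * real T)) *\<^sub>R (\<Sum>s=1..T. \<Sum>i=1..N.
         (u i s \<omega> * u i t \<omega> - (\<integral>\<eta>. u i s \<eta> * u i t \<eta> \<partial>M)) *\<^sub>R F s \<omega>)))\<^sup>2 \<partial>M) \<le> D0"
    and c6: "\<And>N T. N \<ge> 1 \<Longrightarrow> T \<ge> 1 \<Longrightarrow>
      (\<integral>\<omega>. (onorm ((*v) ((1 / sqrt (real N * real T)) *\<^sub>R (\<Sum>t=1..T. \<Sum>i=1..N.
         u i t \<omega> *\<^sub>R outer (F t \<omega>) (lam i)))))\<^sup>2 \<partial>M) \<le> D0"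
    and c7_lim: "\<And>t. t \<ge> 1 \<Longrightarrow>
      (\<lambda>N. (1 / real N) *\<^sub>R (\<Sum>i=1..N. \<Sum>j=1..N.
         (\<integral>\<omega>. u i t \<omega> * u j t \<omega> \<partial>M) *\<^sub>R outer (lam i) (lam j))) \<longlonglongrightarrow> Gam t"
    and c7_clt: "\<And>t. t \<ge> 1 \<Longrightarrow> \<exists>\<mu>. is_mv_normal \<mu> 0 (Gam t) \<and>
      conv_in_distr M (\<lambda>N \<omega>. (1 / sqrt (real N)) *\<^sub>R (\<Sum>i=1..N. u i t \<omega> *\<^sub>R lam i)) \<mu>"
    and c8_lim: "\<And>i. i \<ge> 1 \<Longrightarrow>
      (\<lambda>T. (1 / real T) *\<^sub>R (\<Sum>s=1..T. \<Sum>t=1..T.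
         \<integral>\<omega>. (u i s \<omega> * u i t \<omega>) *\<^sub>R outer (F t \<omega>) (F s \<omega>) \<partial>M)) \<longlonglongrightarrow> Phi i"
    and c8_clt: "\<And>i. i \<ge> 1 \<Longrightarrow> \<exists>\<mu>. is_mv_normal \<mu> 0 (Phi i) \<and>
      conv_in_distr M (\<lambda>T \<omega>. (1 / sqrt (real T)) *\<^sub>R (\<Sum>t=1..T. u i t \<omega> *\<^sub>R F t \<omega>)) \<mu>"
    and c9_lam: "(\<lambda>N. (1 / real N) *\<^sub>R (\<Sum>i=1..N. outer (lam i) (lam i))) \<longlonglongrightarrow> Sig_L"
    and c9_F: "conv_in_prob M
      (\<lambda>T \<omega>. (1 / real T) *\<^sub>R (\<Sum>t=1..T. outer (F t \<omega>) (F t \<omega>))) Sig_F"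
    and c9_pd: "pos_def Sig_L" "pos_def Sig_F"
    and c9_distinct: "distinct_eigenvalues (Sig_L ** Sig_F)"
    and Fhat_rv: "\<And>N T t l. N \<ge> 1 \<Longrightarrow> T \<ge> CARD('k) \<Longrightarrow> t < T \<Longrightarrow> l < CARD('k) \<Longrightarrow>
      (\<lambda>\<omega>. Fhat N T \<omega> $$ (t, l)) \<in> borel_measurable M"
    and Fhat_pc: "\<And>N T \<omega>. N \<ge> 1 \<Longrightarrow> T \<ge> CARD('k) \<Longrightarrow> \<omega> \<in> space M \<Longrightarrow>
      pc_factors (data_mat (\<lambda>j t. Y j t \<omega>) N T) CARD('k) (Fhat N T \<omega>)"
  defines "P \<equiv> \<lambda>t \<omega>. inner (lam 1) (F t \<omega>)"
    and "Phat \<equiv> \<lambda>N T t \<omega>. pc_fit (data_mat (\<lambda>j t. Y j t \<omega>) N T) (Fhat N T \<omega>) t"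
  shows "(\<forall>\<tau> :: nat \<Rightarrow> nat \<Rightarrow> nat.
           (\<forall>\<^sub>F (N, T) in sequentially \<times>\<^sub>F sequentially. \<tau> N T \<in> {1..T}) \<longrightarrow>
           bigO_prob M (sequentially \<times>\<^sub>F sequentially)
             (\<lambda>(N, T) \<omega>. Phat N T (\<tau> N T) \<omega> - P (\<tau> N T) \<omega>)
             (\<lambda>(N, T). 1 / sqrt (real N) + 1 / sqrt (real T)))
       \<and> bigO_prob M (sequentially \<times>\<^sub>F sequentially)
           (\<lambda>(N, T) \<omega>. (1 / real T) * (\<Sum>t=1..T. (Phat N T t \<omega> - P t \<omega>)\<^sup>2))
           (\<lambda>(N, T). 1 / real N + 1 / real T)"
proof -
  interpret prob_space M by (rule prob)
  interpret factor_model M F lam u D0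
  proof
    show "(\<Sum>j=1..N. \<bar>expectation (\<lambda>\<omega>. u i t \<omega> * u j t \<omega>)\<bar>) \<le> D0"
      if "t \<ge> 1" "i \<in> {1..N}" for N t i
    proof -
      \<comment> \<open>Choosing \<open>t\<close> itself as the length of the time range makes it
        one of the times in the maximum.\<close>
      have "(\<Sum>j=1..N. \<bar>expectation (\<lambda>\<omega>. u i t \<omega> * u j t \<omega>)\<bar>)
          \<le> (\<Sum>j=1..N. MAX t\<in>{1..t}. \<bar>expectation (\<lambda>\<omega>. u i t \<omega> * u j t \<omega>)\<bar>)"
        using that by (intro sum_mono Max_ge) auto
      also have "\<dots> \<le> D0" using that by (intro c2_unit)
      finally show ?thesis .
    qed
    show "expectation (\<lambda>\<omega>. (norm ((1 / sqrt (real T)) *\<^sub>R (\<Sum>t=1..T. u 1 t \<omega> *\<^sub>R F t \<omega>)))\<^sup>2) \<le> D0"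
      if "T \<ge> 1" for T
      \<comment> \<open>An average over a single unit is a bound for unit 1 itself.\<close>
      using c4[of 1 T] that by simp
    show "F t \<in> borel_measurable M" if "t \<ge> 1" for t using F_rv that .
    show "u j t \<in> borel_measurable M" if "j \<ge> 1" "t \<ge> 1" for j t using u_rv that .
    show "0 < D0" by (rule D0)
    show "integrable M (\<lambda>\<omega>. norm (F t \<omega>) ^ 4)" "expectation (\<lambda>\<omega>. norm (F t \<omega>) ^ 4) \<le> D0"
      if "t \<ge> 1" for t
      using c1_F[OF that] by auto
    show "norm (lam j) ^ 4 \<le> D0" if "j \<ge> 1" for j using c1_lam that .
    show "integrable M (\<lambda>\<omega>. \<bar>u j t \<omega>\<bar> ^ 8)" "expectation (\<lambda>\<omega>. \<bar>u j t \<omega>\<bar> ^ 8) \<le> D0"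
      if "j \<ge> 1" "t \<ge> 1" for j t
      using c1_u[OF that] by auto
    show "(1 / real N) * (\<Sum>t=1..T. \<bar>\<Sum>i=1..N. expectation (\<lambda>\<omega>. u i s \<omega> * u i t \<omega>)\<bar>) \<le> D0"
      if "N \<ge> 1" "s \<in> {1..T}" for N s T
      using c2_time that .
    show "expectation (\<lambda>\<omega>. \<bar>(1 / sqrt (real N)) * (\<Sum>i=1..N. u i s \<omega> * u i t \<omega>
        - expectation (\<lambda>\<eta>. u i s \<eta> * u i t \<eta>))\<bar> ^ 4) \<le> D0"
      if "N \<ge> 1" "s \<ge> 1" "t \<ge> 1" for N s t
      using c3_dev that .
  qed
  define ok where "ok A N T \<tau> \<omega> \<longleftrightarrow>
    (1 / real T) * (\<Sum>t=1..T. (Phat N T t \<omega> - P t \<omega>)\<^sup>2) \<le> A * (1 / real N + 1 / real T) \<and>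
    \<bar>Phat N T \<tau> \<omega> - P \<tau> \<omega>\<bar> \<le> A * (1 / sqrt (real N) + 1 / sqrt (real T))" for A N T \<tau> \<omega>
  define good where "good \<epsilon> A N T \<tau> \<longleftrightarrow>
    (\<exists>Bad\<in>events. prob Bad \<le> \<epsilon> \<and> (\<forall>\<omega>\<in>space M - Bad. ok A N T \<tau> \<omega>))" for \<epsilon> A N T \<tau>
  have bounds: "\<exists>A>0. \<exists>n0. \<forall>N\<ge>n0. \<forall>T\<ge>n0. \<forall>\<tau>\<in>{1..T}. good \<epsilon> A N T \<tau>" if "\<epsilon> > 0" for \<epsilon>
    unfolding good_def ok_def P_def Phat_def by (rule pc_fit_bounds[OF model c9_lam c9_F c9_pd Fhat_pc that])
  have pointwise: "bigO_prob M (sequentially \<times>\<^sub>F sequentially)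
      (\<lambda>(N, T) \<omega>. Phat N T (\<tau> N T) \<omega> - P (\<tau> N T) \<omega>)
      (\<lambda>(N, T). 1 / sqrt (real N) + 1 / sqrt (real T))"
    if \<tau>: "\<forall>\<^sub>F (N, T) in sequentially \<times>\<^sub>F sequentially. \<tau> N T \<in> {1..T}" for \<tau>
    unfolding bigO_prob_def
  proof (intro allI impI)
    fix \<epsilon> :: real assume "\<epsilon> > 0"
    from bounds[OF this] obtain A n0 where A: "A > 0"
      and bd': "\<forall>N\<ge>n0. \<forall>T\<ge>n0. \<forall>\<tau>\<in>{1..T}. good \<epsilon> A N T \<tau>"
      by (elim exE conjE)
    have bd: "good \<epsilon> A N T \<tau>" if "N \<ge> n0" "T \<ge> n0" "\<tau> \<in> {1..T}" for N T \<tau>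
      using bd' that by simp
    have ev: "\<forall>\<^sub>F (N, T) in sequentially \<times>\<^sub>F sequentially. N \<ge> n0 \<and> T \<ge> n0"
      unfolding eventually_prod_sequentially by auto
    have "\<forall>\<^sub>F n in sequentially \<times>\<^sub>F sequentially. prob {\<omega> \<in> space M. A * \<bar>case n of (N, T) \<Rightarrow> 1 / sqrt (real N) + 1 / sqrt (real T)\<bar>
        < \<bar>(case n of (N, T) \<Rightarrow> \<lambda>\<omega>. Phat N T (\<tau> N T) \<omega> - P (\<tau> N T) \<omega>) \<omega>\<bar>} \<le> \<epsilon>"
      using eventually_conj[OF \<tau> ev]
    proof (rule eventually_mono, clarsimp simp only: split_paired_all split)
      fix N T assume "\<tau> N T \<in> {1..T}" "n0 \<le> N" "n0 \<le> T"
      then obtain Bad where Bad: "Bad \<in> events" "prob Bad \<le> \<epsilon>" and okB: "\<And>\<omega>. \<omega> \<in> space M - Bad \<Longrightarrow> ok A N T (\<tau> N T) \<omega>"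
        using bd unfolding good_def by meson
      have err: "\<bar>Phat N T (\<tau> N T) \<omega> - P (\<tau> N T) \<omega>\<bar> \<le> A * (1 / sqrt (real N) + 1 / sqrt (real T))"
        if "\<omega> \<in> space M - Bad" for \<omega>
        using okB[OF that] unfolding ok_def by blast
      \<comment> \<open>Monotonicity of the measure asks for measurability of the larger set, which
        is \<open>Bad\<close>.\<close>
      have "{\<omega> \<in> space M. A * \<bar>1 / sqrt (real N) + 1 / sqrt (real T)\<bar> < \<bar>Phat N T (\<tau> N T) \<omega> - P (\<tau> N T) \<omega>\<bar>} \<subseteq> Bad"
      proof
        fix \<omega> assume "\<omega> \<in> {\<omega> \<in> space M. A * \<bar>1 / sqrt (real N) + 1 / sqrt (real T)\<bar> < \<bar>Phat N T (\<tau> N T) \<omega> - P (\<tau> N T) \<omega>\<bar>}"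
        then show "\<omega> \<in> Bad" using err[of \<omega>] by (cases "\<omega> \<in> Bad") simp_all
      qed
      then show "prob {\<omega> \<in> space M. A * \<bar>1 / sqrt (real N) + 1 / sqrt (real T)\<bar> < \<bar>Phat N T (\<tau> N T) \<omega> - P (\<tau> N T) \<omega>\<bar>} \<le> \<epsilon>"
        by (rule order_trans[OF finite_measure_mono[OF _ Bad(1)] Bad(2)])
    qed
    with A show "\<exists>C>0. \<forall>\<^sub>F n in sequentially \<times>\<^sub>F sequentially. prob {\<omega> \<in> space M. C * \<bar>case n of (N, T) \<Rightarrow> 1 / sqrt (real N) + 1 / sqrt (real T)\<bar>
        < \<bar>(case n of (N, T) \<Rightarrow> \<lambda>\<omega>. Phat N T (\<tau> N T) \<omega> - P (\<tau> N T) \<omega>) \<omega>\<bar>} \<le> \<epsilon>"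
      by blast
  qed
  have average: "bigO_prob M (sequentially \<times>\<^sub>F sequentially)
      (\<lambda>(N, T) \<omega>. (1 / real T) * (\<Sum>t=1..T. (Phat N T t \<omega> - P t \<omega>)\<^sup>2))
      (\<lambda>(N, T). 1 / real N + 1 / real T)"
    unfolding bigO_prob_def
  proof (intro allI impI)
    fix \<epsilon> :: real assume "\<epsilon> > 0"
    from bounds[OF this] obtain A n0 where A: "A > 0"
      and bd': "\<forall>N\<ge>n0. \<forall>T\<ge>n0. \<forall>\<tau>\<in>{1..T}. good \<epsilon> A N T \<tau>"
      by (elim exE conjE)
    have bd: "good \<epsilon> A N T \<tau>" if "N \<ge> n0" "T \<ge> n0" "\<tau> \<in> {1..T}" for N T \<tau>
      using bd' that by simp
    \<comment> \<open>The average does not involve the time index of \<open>good\<close>, so time 1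
      is inserted there; it is admissible once T is at least 1.\<close>
    have ev: "\<forall>\<^sub>F (N, T) in sequentially \<times>\<^sub>F sequentially. N \<ge> n0 \<and> T \<ge> n0 \<and> T \<ge> 1"
      unfolding eventually_prod_sequentially by (intro exI[of _ "max n0 1"]) auto
    have "\<forall>\<^sub>F n in sequentially \<times>\<^sub>F sequentially. prob {\<omega> \<in> space M. A * \<bar>case n of (N, T) \<Rightarrow> 1 / real N + 1 / real T\<bar>
        < \<bar>(case n of (N, T) \<Rightarrow> \<lambda>\<omega>. (1 / real T) * (\<Sum>t=1..T. (Phat N T t \<omega> - P t \<omega>)\<^sup>2)) \<omega>\<bar>} \<le> \<epsilon>"
      using ev
    proof (rule eventually_mono, clarsimp simp only: split_paired_all split)
      fix N T :: nat assume "n0 \<le> N" "n0 \<le> T" "1 \<le> T"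
      then obtain Bad where Bad: "Bad \<in> events" "prob Bad \<le> \<epsilon>" and okB: "\<And>\<omega>. \<omega> \<in> space M - Bad \<Longrightarrow> ok A N T 1 \<omega>"
        using bd[of N T 1] unfolding good_def by auto
      have err: "(1 / real T) * (\<Sum>t=1..T. (Phat N T t \<omega> - P t \<omega>)\<^sup>2) \<le> A * (1 / real N + 1 / real T)"
        if "\<omega> \<in> space M - Bad" for \<omega>
        using okB[OF that] unfolding ok_def by blast
      have nonneg: "(1 / real T) * (\<Sum>t=1..T. (Phat N T t \<omega> - P t \<omega>)\<^sup>2) \<ge> 0" for \<omega>
        by (intro mult_nonneg_nonneg sum_nonneg) auto
      have "{\<omega> \<in> space M. A * \<bar>1 / real N + 1 / real T\<bar> < \<bar>(1 / real T) * (\<Sum>t=1..T. (Phat N T t \<omega> - P t \<omega>)\<^sup>2)\<bar>} \<subseteq> Bad"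
        (is "?E \<subseteq> Bad")
      proof
        fix \<omega> assume "\<omega> \<in> ?E"
        then show "\<omega> \<in> Bad"
          using err[of \<omega>] unfolding abs_of_nonneg[OF nonneg] by (cases "\<omega> \<in> Bad") simp_all
      qed
      then show "prob {\<omega> \<in> space M. A * \<bar>1 / real N + 1 / real T\<bar> < \<bar>(1 / real T) * (\<Sum>t=1..T. (Phat N T t \<omega> - P t \<omega>)\<^sup>2)\<bar>} \<le> \<epsilon>"
        by (rule order_trans[OF finite_measure_mono[OF _ Bad(1)] Bad(2)])
    qed
    with A show "\<exists>C>0. \<forall>\<^sub>F n in sequentially \<times>\<^sub>F sequentially. prob {\<omega> \<in> space M. C * \<bar>case n of (N, T) \<Rightarrow> 1 / real N + 1 / real T\<bar>
        < \<bar>(case n of (N, T) \<Rightarrow> \<lambda>\<omega>. (1 / real T) * (\<Sum>t=1..T. (Phat N T t \<omega> - P t \<omega>)\<^sup>2)) \<omega>\<bar>} \<le> \<epsilon>"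
      by blast
  qed
  show ?thesis using pointwise average by blast
qed

end
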